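(* Let $X$ be a nondegenerate Peano continuum. Then there exists a continuous surjection $T\colon X\to X$ that is pure mixing (that is, topologically mixing but not exact) and whose set of periodic points is dense in $X$.
   Context: A continuum is a compact, connected, metrizable space; it is nondegenerate if it has more than one point. A Peano continuum is a continuum $X$ such that for each $p\in X$ and each neighborhood $N$ of $p$ there is a connected open set $U\subset X$ with $p\in U\subset N$ (equivalently, for nonempty spaces, a metrizable continuous image of $[0,1]$). Let $T\colon X\to X$ be a continuous map of a compact metrizable space. $T$ is (topologically) mixing if for any two nonempty open sets $U,V\subset X$ there is $n_0\in\mathbb{N}$ such that $T^n(U)\cap V\neq\emptyset$ for every $n\ge n_0$. $T$ is exact (locally eventually onto) if for every nonempty open set $U\subset X$ there is $n\in\mathbb{N}$ with $T^n(U)=X$. $T$ is pure mixing if it is mixing but not exact. A point $x\in X$ is periodic if $T^n(x)=x$ for some $n>0$. *)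

theory Defs
  imports "HOL-Analysis.Analysis"
begin

text \<open>Spaces are values of type \<^typ>\<open>'a topology\<close>, so the carrier need not be a whole
  type; of a map \<open>T :: 'a \<Rightarrow> 'a\<close> only the values on \<open>topspace X\<close> matter.\<close>

definition continuum :: "'a topology \<Rightarrow> bool" where
  "continuum X \<longleftrightarrow> compact_space X \<and> connected_space X \<and> metrizable_space X"

definition nondegenerate :: "'a topology \<Rightarrow> bool" where
  "nondegenerate X \<longleftrightarrow> (\<exists>x\<in>topspace X. \<exists>y\<in>topspace X. x \<noteq> y)"

text \<open>A neighbourhood of \<open>p\<close> is a set containing an open set around \<open>p\<close>; it need not itself
  be open.\<close>

definition neighbourhood :: "'a topology \<Rightarrow> 'a \<Rightarrow> 'a set \<Rightarrow> bool" where
  "neighbourhood X p N \<longleftrightarrow> N \<subseteq> topspace X \<and> (\<exists>W. openin X W \<and> p \<in> W \<and> W \<subseteq> N)"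

definition peano_continuum :: "'a topology \<Rightarrow> bool" where
  "peano_continuum X \<longleftrightarrow> continuum X \<and>
     (\<forall>p\<in>topspace X. \<forall>N. neighbourhood X p N \<longrightarrow>
        (\<exists>U. openin X U \<and> connectedin X U \<and> p \<in> U \<and> U \<subseteq> N))"

definition mixing :: "'a topology \<Rightarrow> ('a \<Rightarrow> 'a) \<Rightarrow> bool" where
  "mixing X T \<longleftrightarrow>
     (\<forall>U V. openin X U \<and> U \<noteq> {} \<and> openin X V \<and> V \<noteq> {} \<longrightarrow>
        (\<exists>n0::nat. \<forall>n\<ge>n0. (T ^^ n) ` U \<inter> V \<noteq> {}))"

text \<open>Allowing \<open>n = 0\<close> is harmless: for a surjective \<open>T\<close>, an exponent \<open>n\<close> with
  \<open>(T ^^ n) ` U = topspace X\<close> can be replaced by any larger one.\<close>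

definition exact :: "'a topology \<Rightarrow> ('a \<Rightarrow> 'a) \<Rightarrow> bool" where
  "exact X T \<longleftrightarrow>
     (\<forall>U. openin X U \<and> U \<noteq> {} \<longrightarrow> (\<exists>n::nat. (T ^^ n) ` U = topspace X))"

definition pure_mixing :: "'a topology \<Rightarrow> ('a \<Rightarrow> 'a) \<Rightarrow> bool" where
  "pure_mixing X T \<longleftrightarrow> mixing X T \<and> \<not> exact X T"

definition periodic_points :: "'a topology \<Rightarrow> ('a \<Rightarrow> 'a) \<Rightarrow> 'a set" where
  "periodic_points X T = {x \<in> topspace X. \<exists>n>0. (T ^^ n) x = x}"

end

theory Submission
  imports Defs
begin

text \<open>Some point \<open>p\<close> of \<open>X\<close> does not separate it. Fix a function \<open>f\<close> on \<open>X - {p}\<close> close to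
  a multiple of \<open>1 / dist x p\<close>. For \<open>n \<le> f x \<le> n + 1\<close> let \<open>C\<close> be the component of \<open>x\<close> in
  \<open>{f > n - 1}\<close>, up to the perturbation; then \<open>T\<close> is \<open>f\<close> followed by a path, indexed by \<open>C\<close>, that
  fills the part of the parent component of \<open>C\<close> at nearby heights. So \<open>T\<close> factors through the
  tree of components: it fixes \<open>p\<close>, never reaches \<open>p\<close> from elsewhere, and hence is not exact.
  The paths oscillate so fast that \<open>f\<close> expands along them; thus some iterate of every small path
  crosses a full level, further iterates descend to the bottom level and climb from there to every
  level that can be crossed, and the image of a crossing covers a full path. This gives mixing,
  and a path that crosses its own level contains a periodic point by the intermediate value
  theorem.\<close>

section \<open>Wild reparametrizations of the unit interval\<close>

text \<open>A circularity shapes the construction: the paths must expand for \<open>f\<close>, yet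
  the levels of \<open>f\<close> decide which paths are used. It is broken by the order of choices.
  The tree of pieces is cut out by the unperturbed \<open>depth\<close>; its countably many paths
  come next; a generic perturbation of size at most 1/4 then makes \<open>f\<close> nonconstant on
  every subpath; last, the paths are only reparametrized, which leaves their images alone. The
  thresholds in \<open>deep\<close> and \<open>collar\<close> carry margins that absorb the error
  1/4. Since \<open>X\<close> may have any dimension, each path must be space filling on a compact
  part of its parent piece; as \<open>T x\<close> depends only on the piece and the height of
  \<open>x\<close>, one crossing of a level already covers all of that part. Removing a point that
  does not separate \<open>X\<close> leaves the tree with a single root. Every descending chain of
  crossings ends there, and the root path crosses its own level again, so one can wait at the root
  for any number of steps; this is what makes an open set meet its target at all large times rather
  than at some time.\<close>

lemma oscillation_gauge:
  fixes \<psi> :: "real \<Rightarrow> real"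
  assumes B: "0 < B"
    and nc: "\<And>a b. 0 \<le> a \<Longrightarrow> a < b \<Longrightarrow> b \<le> B \<Longrightarrow> \<exists>x\<in>{a..b}. \<exists>y\<in>{a..b}. \<psi> x \<noteq> \<psi> y"
    and e: "0 < e"
  shows "\<exists>\<delta>>0. \<forall>a b. 0 \<le> a \<and> b \<le> B \<and> a + e \<le> b \<longrightarrow>
           (\<exists>x\<in>{a..b}. \<exists>y\<in>{a..b}. \<delta> \<le> \<bar>\<psi> x - \<psi> y\<bar>)"
proof -
  obtain N :: nat where N: "2 * B / e < real N"
    using reals_Archimedean2 by blast
  have N0: "0 < real N"
    using N B e by (smt (verit) divide_pos_pos)
  \<comment> \<open>Cells are shorter than \<open>e / 2\<close>, so every interval of length
    \<open>e\<close> within the range contains a whole cell, and the least of the finitely many cell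
    oscillations is a gauge.\<close>
  define h where "h = B / real N"
  have h0: "0 < h" and h2: "2 * h < e"
    using N N0 B e by (auto simp: h_def field_simps)
  have "\<exists>\<delta>>0. i < N \<longrightarrow> (\<exists>x\<in>{i * h..(real i + 1) * h}. \<exists>y\<in>{i * h..(real i + 1) * h}. \<delta> \<le> \<bar>\<psi> x - \<psi> y\<bar>)" for i :: nat
  proof (cases "i < N")
    case True
    have "(real i + 1) * h \<le> real N * h"
      using True h0 by (intro mult_right_mono) auto
    also have "\<dots> = B" using N0 by (simp add: h_def)
    finally obtain x y where "x \<in> {i * h..(real i + 1) * h}" "y \<in> {i * h..(real i + 1) * h}" "\<psi> x \<noteq> \<psi> y"
      using nc[of "i * h" "(real i + 1) * h"] h0 by (auto simp: algebra_simps)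
    then show ?thesis
      by (intro exI[of _ "\<bar>\<psi> x - \<psi> y\<bar>"] conjI impI bexI[of _ x] bexI[of _ y]) auto
  qed (auto intro: exI[of _ 1])
  then obtain D where D: "\<And>i::nat. 0 < D i"
      "\<And>i. i < N \<Longrightarrow> \<exists>x\<in>{i * h..(real i + 1) * h}. \<exists>y\<in>{i * h..(real i + 1) * h}. D i \<le> \<bar>\<psi> x - \<psi> y\<bar>"
    by metis
  define \<delta> where "\<delta> = Min (D ` {..<N})"
  have ne: "D ` {..<N} \<noteq> {}" using N0 by auto
  have "0 < \<delta>" using D(1) ne by (auto simp: \<delta>_def)
  moreover have "\<exists>x\<in>{a..b}. \<exists>y\<in>{a..b}. \<delta> \<le> \<bar>\<psi> x - \<psi> y\<bar>"
    if a: "0 \<le> a" and b: "b \<le> B" and ab: "a + e \<le> b" for a b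
  proof -
    define i where "i = nat \<lceil>a / h\<rceil>"
    have "0 \<le> a / h" using a h0 by simp
    then have i: "a / h \<le> real i" "real i < a / h + 1" unfolding i_def by linarith+
    have lo: "a \<le> i * h" and hi: "(real i + 1) * h < b"
      using i h0 h2 ab by (auto simp: field_simps)
    have "(real i + 1) * h < real N * h"
      using hi b N0 by (simp add: h_def)
    then have "i < N" using h0 by (simp add: mult_less_cancel_right)
    then obtain x y where xy: "x \<in> {i * h..(real i + 1) * h}" "y \<in> {i * h..(real i + 1) * h}" "D i \<le> \<bar>\<psi> x - \<psi> y\<bar>"
      using D(2) by blast
    moreover have "\<delta> \<le> D i" using \<open>i < N\<close> by (auto simp: \<delta>_def)
    ultimately show ?thesis using lo hi
      by (intro bexI[of _ x] bexI[of _ y]) auto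
  qed
  ultimately show ?thesis by blast
qed

section \<open>A cosine wave folding the line onto the unit interval\<close>

definition wave :: "real \<Rightarrow> real" where "wave x = (1 - cos (pi * x)) / 2"

lemma wave_range: "0 \<le> wave x" "wave x \<le> 1"
  using cos_le_one[of "pi * x"] cos_ge_minus_one[of "pi * x"] by (auto simp: wave_def)

lemma continuous_wave: "continuous_on A wave"
  unfolding wave_def by (intro continuous_intros) auto

lemma wave_even: "wave (2 * of_int j) = 0"
proof -
  have "cos (pi * (2 * of_int j)) = cos (0 :: real)"
    by (subst cos_eq) (auto simp: intro!: exI[of _ j])
  then show ?thesis by (simp add: wave_def)
qed

lemma wave_odd: "wave (2 * of_int j + 1) = 1"
proof -
  have "cos (pi * (2 * of_int j + 1)) = cos pi"
    by (subst cos_eq) (auto simp: algebra_simps intro!: exI[of _ j])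
  then show ?thesis by (simp add: wave_def)
qed

text \<open>The derivative is bounded by \<open>pi / 2\<close>; the round constant 2 comes from
  \<open>pi < 4\<close>.\<close>

lemma wave_lipschitz: "\<bar>wave x - wave y\<bar> \<le> 2 * \<bar>x - y\<bar>"
proof -
  have "\<bar>cos (pi * x) - cos (pi * y)\<bar> \<le> \<bar>pi * x - pi * y\<bar>"
  proof -
    have "\<bar>cos (pi * x) - cos (pi * y)\<bar> = 2 * (\<bar>sin ((pi * x + pi * y) / 2)\<bar> * \<bar>sin ((pi * y - pi * x) / 2)\<bar>)"
      by (simp add: cos_diff_cos abs_mult)
    also have "\<dots> \<le> 2 * (1 * \<bar>(pi * y - pi * x) / 2\<bar>)"
      by (intro mult_left_mono mult_mono abs_sin_x_le_abs_x) auto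
    finally show ?thesis by simp
  qed
  also have "\<dots> = pi * \<bar>x - y\<bar>" by (simp add: abs_mult flip: right_diff_distrib)
  also have "\<dots> \<le> 4 * \<bar>x - y\<bar>" using pi_less_4 by (intro mult_right_mono) auto
  finally show ?thesis by (simp add: wave_def abs_if field_simps split: if_splits)
qed

text \<open>An interval of length 2 contains an even and an odd integer, where \<open>wave\<close>
  is 0 and 1; the rest is connectedness.\<close>

lemma wave_onto:
  assumes "a + 2 \<le> b"
  shows "wave ` {a..b} = {0..1}"
proof
  show "wave ` {a..b} \<subseteq> {0..1}" using wave_range by auto
  define j where "j = \<lceil>a / 2\<rceil>"
  have j: "a \<le> 2 * of_int j" "2 * of_int j < a + 2" unfolding j_def by linarith+
  have conn: "connected (wave ` {a..b})"
    by (intro connected_continuous_image continuous_wave) simp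
  have 0: "0 \<in> wave ` {a..b}"
    using j assms by (intro image_eqI[where x = "2 * of_int j"]) (auto simp: wave_even)
  have 1: "1 \<in> wave ` {a..b}"
  proof (cases "2 * of_int j + 1 \<le> b")
    case True
    then show ?thesis using j by (intro image_eqI[where x = "2 * of_int j + 1"]) (auto simp: wave_odd)
  next
    case False
    have "wave (2 * of_int (j - 1) + 1) = 1" by (rule wave_odd)
    then show ?thesis using j assms False
      by (intro image_eqI[where x = "2 * of_int (j - 1) + 1"]) auto
  qed
  show "{0..1} \<subseteq> wave ` {a..b}"
    using connected_contains_Icc[OF conn 0 1] .
qed

text \<open>Constancy on an interval would make the derivative, hence \<open>sin (pi * x)\<close>,
  vanish there; differentiating once more gives \<open>cos (pi * m) = 0\<close> at the midpoint as
  well, and sine and cosine have no common zero.\<close>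

lemma wave_nonconstant:
  assumes "a < b"
  shows "\<exists>x\<in>{a..b}. \<exists>y\<in>{a..b}. wave x < wave y"
proof (rule ccontr)
  assume "\<not> ?thesis"
  then have eq: "wave x = wave y" if "x \<in> {a..b}" "y \<in> {a..b}" for x y
    using that by (meson linorder_neqE)
  define m where "m = (a + b) / 2"
  have zero: "sin (pi * x) = 0" if x: "x \<in> {a<..<b}" for x
  proof -
    have "(wave has_real_derivative pi * sin (pi * x) / 2) (at x)"
      unfolding wave_def by (auto intro!: derivative_eq_intros)
    moreover have "(wave has_real_derivative 0) (at x)"
    proof (rule has_field_derivative_transform_within_open[where S = "{a<..<b}"])
      show "((\<lambda>_. wave x) has_real_derivative 0) (at x)" by simp
      show "wave x = wave y" if "y \<in> {a<..<b}" for y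
        using eq[of x y] that x by auto
    qed (use x in auto)
    ultimately have "pi * sin (pi * x) / 2 = 0" by (rule DERIV_unique)
    then show ?thesis by simp
  qed
  have m: "m \<in> {a<..<b}" using assms by (auto simp: m_def)
  have "((\<lambda>x. sin (pi * x)) has_real_derivative pi * cos (pi * m)) (at m)"
    by (auto intro!: derivative_eq_intros)
  moreover have "((\<lambda>x. sin (pi * x)) has_real_derivative 0) (at m)"
    by (rule has_field_derivative_transform_within_open[where S = "{a<..<b}" and f = "\<lambda>_. 0"])
      (use m zero in auto)
  ultimately have "pi * cos (pi * m) = 0" by (rule DERIV_unique)
  then have "cos (pi * m) = 0" by simp
  with zero[OF m] show False using sin_cos_squared_add[of "pi * m"] by simp
qed

text \<open>The map is \<open>wave\<close> after \<open>t + (\<Sum>k. a k * wave (b k * t))\<close>. The amplitudes \<open>a k\<close> decay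
  geometrically and are fixed in advance; the frequencies \<open>b k\<close> can therefore be chosen afterwards
  to beat the oscillation gauge of \<open>\<phi>\<close> at scale \<open>a (Suc k)\<close>.\<close>

lemma expanding_reparametrization:
  fixes \<phi> :: "real \<Rightarrow> real"
  assumes nc: "\<And>a b. 0 \<le> a \<Longrightarrow> a < b \<Longrightarrow> b \<le> 1 \<Longrightarrow> \<exists>x\<in>{a..b}. \<exists>y\<in>{a..b}. \<phi> x \<noteq> \<phi> y"
  shows "\<exists>h. continuous_on UNIV h \<and> range h \<subseteq> {0..1} \<and> h 0 = 0 \<and> h 1 = 1 \<and>
           (\<forall>c d. 0 \<le> c \<and> c < d \<and> d \<le> 1 \<longrightarrow> h ` {c..d} = {0..1} \<or>
             (\<exists>s\<in>{c..d}. \<exists>t\<in>{c..d}. 3 * (d - c) \<le> \<bar>\<phi> (h s) - \<phi> (h t)\<bar>))"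
proof -
  define \<psi> where "\<psi> x = \<phi> (wave x)" for x
  \<comment> \<open>The factor 6 gives \<open>a 0 / 3 = 2\<close>, a length on which
    \<open>wave\<close> is onto. The ratio 1/4 makes all amplitudes after \<open>k\<close> sum to
    \<open>a k / 3\<close>, and all of them to 8, so that the arguments of \<open>wave\<close> stay
    in \<open>{0..9}\<close>.\<close>
  define a :: "nat \<Rightarrow> real" where "a k = 6 * (1/4) ^ k" for k
  have a0: "0 < a k" for k by (simp add: a_def)
  have a_sums: "(\<lambda>j. a (j + k)) sums (a k * (4/3))" for k
  proof -
    have "(\<lambda>j. a k * (1/4) ^ j) sums (a k * (1 / (1 - 1/4)))"
      by (intro sums_mult geometric_sums) auto
    then show ?thesis by (simp add: a_def power_add mult_ac)
  qed
  have psi_nc: "\<exists>x\<in>{c..d}. \<exists>y\<in>{c..d}. \<psi> x \<noteq> \<psi> y" if cd: "c < d" for c d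
  proof -
    obtain x y where xy: "x \<in> {c..d}" "y \<in> {c..d}" "wave x < wave y"
      using wave_nonconstant[OF cd] by blast
    have "connected (wave ` {c..d})"
      by (intro connected_continuous_image continuous_wave) simp
    then have sub: "{wave x..wave y} \<subseteq> wave ` {c..d}"
      using xy by (intro connected_contains_Icc) auto
    obtain u v where "u \<in> {wave x..wave y}" "v \<in> {wave x..wave y}" "\<phi> u \<noteq> \<phi> v"
      using nc[of "wave x" "wave y"] xy wave_range by auto
    with sub show ?thesis unfolding \<psi>_def by (smt (verit) imageE subsetD)
  qed
  have "\<exists>\<delta>>0. \<forall>c d. 0 \<le> c \<and> d \<le> 9 \<and> c + a k / 3 \<le> d \<longrightarrow>
           (\<exists>x\<in>{c..d}. \<exists>y\<in>{c..d}. \<delta> \<le> \<bar>\<psi> x - \<psi> y\<bar>)" for k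
    by (rule oscillation_gauge) (use psi_nc a0[of k] in auto)
  then obtain \<omega> where \<omega>0: "\<And>k. 0 < \<omega> k"
    and \<omega>: "\<And>k c d. 0 \<le> c \<Longrightarrow> d \<le> 9 \<Longrightarrow> c + a k / 3 \<le> d \<Longrightarrow>
           \<exists>x\<in>{c..d}. \<exists>y\<in>{c..d}. \<omega> k \<le> \<bar>\<psi> x - \<psi> y\<bar>"
    by metis
  \<comment> \<open>Evenness makes every summand vanish at 0 and 1; \<open>k < b k\<close> makes the
    frequencies unbounded; the third condition beats the gauge at the next scale; the last one
    bounds by \<open>a k / 3\<close> what the identity and the slower summands change over half a
    period \<open>1 / b k\<close>.\<close>
  have "\<exists>b :: nat \<Rightarrow> nat. \<forall>k. even (b k) \<and> k < b k \<and> 12 / \<omega> (Suc k) \<le> b k \<and>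
      3 / a k * (1 + 2 * (\<Sum>j<k. a j * b j)) \<le> b k"
  proof (rule dependent_wellorder_choice)
    fix r :: nat and f g :: "nat \<Rightarrow> nat" and k
    assume "\<And>j. j < k \<Longrightarrow> f j = g j"
    then have "(\<Sum>j<k. a j * f j) = (\<Sum>j<k. a j * g j)" by (intro sum.cong) auto
    then show "(even r \<and> k < r \<and> 12 / \<omega> (Suc k) \<le> r \<and> 3 / a k * (1 + 2 * (\<Sum>j<k. a j * f j)) \<le> r)
      = (even r \<and> k < r \<and> 12 / \<omega> (Suc k) \<le> r \<and> 3 / a k * (1 + 2 * (\<Sum>j<k. a j * g j)) \<le> r)" by simp
  next
    fix k and f :: "nat \<Rightarrow> nat"
    obtain m :: nat where "max (real k) (max (12 / \<omega> (Suc k)) (3 / a k * (1 + 2 * (\<Sum>j<k. a j * f j)))) < m"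
      using reals_Archimedean2 by blast
    then show "\<exists>r. even r \<and> k < r \<and> 12 / \<omega> (Suc k) \<le> r \<and> 3 / a k * (1 + 2 * (\<Sum>j<k. a j * f j)) \<le> r"
      by (intro exI[of _ "2 * m"]) auto
  qed
  then obtain b :: "nat \<Rightarrow> nat" where b: "\<And>k. even (b k)" "\<And>k. k < b k" "\<And>k. 12 / \<omega> (Suc k) \<le> b k"
      "\<And>k. 3 / a k * (1 + 2 * (\<Sum>j<k. a j * b j)) \<le> b k"
    by blast
  have b0: "0 < b k" for k using b(2)[of k] by simp
  define w :: "nat \<Rightarrow> real \<Rightarrow> real" where "w j t = a j * wave (real (b j) * t)" for j t
  have w_range: "0 \<le> w j t" "w j t \<le> a j" for j t
    using wave_range[of "b j * t"] a0[of j] by (auto simp: w_def mult_left_le)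
  have w_sum: "summable (\<lambda>j. w (j + k) t)" for k t
    by (rule summable_comparison_test[OF _ sums_summable[OF a_sums[of k]]])
      (use w_range in auto)
  define u :: "real \<Rightarrow> real" where "u t = t + (\<Sum>j. w j t)" for t
  have u_cont: "continuous_on UNIV u"
  proof -
    have "uniform_limit UNIV (\<lambda>n t. \<Sum>j<n. w j t) (\<lambda>t. \<Sum>j. w j t) sequentially"
      by (rule Weierstrass_m_test[where M = a])
        (use w_range a_sums[of 0] in \<open>auto simp: sums_iff\<close>)
    then have "continuous_on UNIV (\<lambda>t. \<Sum>j. w j t)"
      by (rule uniform_limit_theorem[rotated])
        (auto simp: w_def intro!: continuous_intros always_eventually
           continuous_on_compose2[OF continuous_wave[of UNIV]])
    then show ?thesis unfolding u_def by (intro continuous_intros)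
  qed
  have u_range: "0 \<le> u t" "u t \<le> 9" if "t \<in> {0..1}" for t
  proof -
    have "0 \<le> (\<Sum>j. w j t)" using w_sum[of 0] w_range by (intro suminf_nonneg) auto
    moreover have "(\<Sum>j. w j t) \<le> (\<Sum>j. a j)"
      using w_sum[of 0] w_range a_sums[of 0] by (intro suminf_le) (auto simp: sums_iff)
    moreover have "(\<Sum>j. a j) = 8" using a_sums[of 0] by (simp add: sums_iff a_def)
    ultimately show "0 \<le> u t" "u t \<le> 9" using that by (auto simp: u_def)
  qed
  have w_end: "w j 0 = 0" "w j 1 = 0" for j
  proof -
    obtain i where i: "b j = 2 * i" using b(1)[of j] by (auto elim: evenE)
    show "w j 0 = 0" "w j 1 = 0"
      using wave_even[of 0] wave_even[of "int i"] by (auto simp: w_def i)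
  qed
  \<comment> \<open>Over half a period of summand \<open>k\<close> that summand rises by
    \<open>a k\<close>. The slower summands and the faster ones can each cancel at most a third of
    this.\<close>
  have u_osc: "\<exists>s\<in>{c..d}. \<exists>t\<in>{c..d}. a k / 3 \<le> \<bar>u s - u t\<bar>" if cd: "4 / b k \<le> d - c" for c d :: real and k
  proof -
    define i where "i = \<lceil>c * b k / 2\<rceil>"
    have i: "c * b k \<le> 2 * of_int i" "2 * of_int i < c * b k + 2"
      unfolding i_def by linarith+
    define s t :: real where "s = 2 * of_int i / b k" and "t = (2 * of_int i + 1) / b k"
    have cdb: "c * b k + 4 \<le> d * b k" using cd b0[of k] by (simp add: field_simps)
    have st: "s \<in> {c..d}" "t \<in> {c..d}"
      using i cdb b0[of k] by (auto simp: s_def t_def field_simps)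
    have ts: "t - s = 1 / b k" by (simp add: s_def t_def add_divide_distrib)
    have mid: "w k t - w k s = a k"
      using b0[of k] wave_even[of i] wave_odd[of i] by (simp add: w_def s_def t_def)
    have split: "(\<Sum>j. w j x) = (\<Sum>j. w (j + Suc k) x) + (\<Sum>j<k. w j x) + w k x" for x
      using suminf_split_initial_segment[OF w_sum[of 0 x, simplified], of "Suc k"] by simp
    have lower: "\<bar>(\<Sum>j<k. w j t) - (\<Sum>j<k. w j s)\<bar> \<le> 2 * (\<Sum>j<k. a j * b j) / b k"
    proof -
      have "\<bar>(\<Sum>j<k. w j t) - (\<Sum>j<k. w j s)\<bar> \<le> (\<Sum>j<k. \<bar>w j t - w j s\<bar>)"
        by (simp flip: sum_subtractf)
      also have "\<dots> \<le> (\<Sum>j<k. a j * (2 * (b j * (1 / b k))))"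
      proof (rule sum_mono)
        fix j
        have "\<bar>w j t - w j s\<bar> = a j * \<bar>wave (b j * t) - wave (b j * s)\<bar>"
          using a0[of j] by (simp add: w_def abs_mult flip: right_diff_distrib)
        also have "\<dots> \<le> a j * (2 * \<bar>b j * t - b j * s\<bar>)"
          using a0[of j] by (intro mult_left_mono wave_lipschitz) auto
        also have "\<bar>b j * t - b j * s\<bar> = b j * (1 / b k)"
          by (simp add: ts abs_mult flip: right_diff_distrib)
        finally show "\<bar>w j t - w j s\<bar> \<le> a j * (2 * (b j * (1 / b k)))" .
      qed
      also have "\<dots> = 2 * (\<Sum>j<k. a j * b j) / b k"
        by (simp add: sum_distrib_left sum_divide_distrib mult_ac)
      finally show ?thesis .
    qed
    have tail: "(\<Sum>j. w (j + Suc k) x) \<in> {0..a k / 3}" for x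
    proof -
      have "(\<Sum>j. w (j + Suc k) x) \<le> (\<Sum>j. a (j + Suc k))"
        using w_sum[of "Suc k"] w_range a_sums[of "Suc k"]
        by (intro suminf_le) (auto simp: sums_iff)
      also have "\<dots> = a k / 3" using a_sums[of "Suc k"] by (simp add: sums_iff a_def)
      finally show ?thesis
        using w_sum[of "Suc k"] w_range by (auto intro!: suminf_nonneg)
    qed
    have "3 * (1 + 2 * (\<Sum>j<k. a j * b j)) \<le> a k * b k"
      using b(4)[of k] a0[of k] by (simp add: field_simps)
    then have "1 / b k + 2 * (\<Sum>j<k. a j * b j) / b k \<le> a k / 3"
      using b0[of k] by (simp add: field_simps)
    moreover have "0 \<le> 1 / b k" using b0[of k] by simp
    moreover have "u t - u s = (t - s) + ((\<Sum>j. w (j + Suc k) t) - (\<Sum>j. w (j + Suc k) s))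
        + ((\<Sum>j<k. w j t) - (\<Sum>j<k. w j s)) + (w k t - w k s)"
      unfolding u_def split[of t] split[of s] by simp
    moreover have "- (a k / 3) \<le> (\<Sum>j. w (j + Suc k) t) - (\<Sum>j. w (j + Suc k) s)"
      using tail[of s] tail[of t] unfolding atLeastAtMost_iff by linarith
    ultimately have "a k / 3 \<le> u t - u s"
      using lower mid ts unfolding abs_le_iff by linarith
    then have "a k / 3 \<le> \<bar>u s - u t\<bar>" by linarith
    with st show ?thesis by blast
  qed
  have u_sub: "\<exists>y z. y \<le> z \<and> a k / 3 \<le> z - y \<and> {y..z} \<subseteq> u ` {c..d}" if cd: "4 / b k \<le> d - c" for c d :: real and k
  proof -
    obtain s t where st: "s \<in> {c..d}" "t \<in> {c..d}" "a k / 3 \<le> \<bar>u s - u t\<bar>"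
      using u_osc[OF cd] by blast
    have conn: "connected (u ` {c..d})"
      by (intro connected_continuous_image continuous_on_subset[OF u_cont]) auto
    show ?thesis
    proof (cases "u s \<le> u t")
      case True
      then show ?thesis using st connected_contains_Icc[OF conn, of "u s" "u t"] by auto
    next
      case False
      then show ?thesis using st connected_contains_Icc[OF conn, of "u t" "u s"]
        by (intro exI[of _ "u t"] exI[of _ "u s"]) auto
    qed
  qed
  define h :: "real \<Rightarrow> real" where "h t = wave (u t)" for t
  have "h ` {c..d} = {0..1} \<or> (\<exists>s\<in>{c..d}. \<exists>t\<in>{c..d}. 3 * (d - c) \<le> \<bar>\<phi> (h s) - \<phi> (h t)\<bar>)"
    if cd: "0 \<le> c" "c < d" "d \<le> 1" for c d
  proof -
    \<comment> \<open>The first frequency that completes two periods within \<open>{c..d}\<close>.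
      If \<open>k = 0\<close>, the image under \<open>u\<close> is long enough for
      \<open>wave\<close> to be onto; otherwise the previous frequency failed, so
      \<open>d - c < 4 / b j\<close>, which the gauge at scale \<open>k = Suc j\<close>
      beats.\<close>
    define k where "k = (LEAST k. 4 / b k \<le> d - c)"
    obtain m :: nat where "4 / (d - c) < m" using reals_Archimedean2 by blast
    then have "4 / (d - c) < b m" using b(2)[of m] by linarith
    then have "4 / b m \<le> d - c" using cd b0[of m] by (simp add: field_simps)
    then have k: "4 / b k \<le> d - c" unfolding k_def by (rule LeastI)
    obtain y z where yz: "y \<le> z" "a k / 3 \<le> z - y" "{y..z} \<subseteq> u ` {c..d}"
      using u_sub[OF k] by blast
    have hsub: "wave ` {y..z} \<subseteq> h ` {c..d}" using yz(3) by (auto simp: h_def)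
    show ?thesis
    proof (cases k)
      case 0
      then have "{0..1} \<subseteq> h ` {c..d}"
        using hsub wave_onto[of y z] yz(2) by (simp add: a_def)
      then show ?thesis using wave_range by (auto simp: h_def)
    next
      case (Suc j)
      have "\<not> 4 / b j \<le> d - c" using not_less_Least[of j "\<lambda>k. 4 / b k \<le> d - c"] Suc by (auto simp: k_def)
      then have small: "3 * (d - c) \<le> 12 / b j" by simp
      have "12 / b j \<le> \<omega> k" using b(3)[of j] \<omega>0[of k] b0[of j] Suc by (simp add: field_simps)
      with small have small: "3 * (d - c) \<le> \<omega> k" by linarith
      have "y \<in> u ` {c..d}" "z \<in> u ` {c..d}" using yz by auto
      then have "0 \<le> y" "z \<le> 9" using u_range cd by auto
      then obtain x x' where xx: "x \<in> {y..z}" "x' \<in> {y..z}" "\<omega> k \<le> \<bar>\<psi> x - \<psi> x'\<bar>"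
        using \<omega>[of y z k] yz(2) by auto
      then obtain s t where "s \<in> {c..d}" "t \<in> {c..d}" "x = u s" "x' = u t" using yz(3) by blast
      moreover from this have "3 * (d - c) \<le> \<bar>\<phi> (h s) - \<phi> (h t)\<bar>"
        using xx(3) small by (simp add: \<psi>_def h_def)
      ultimately show ?thesis by blast
    qed
  qed
  moreover have "h 0 = 0" "h 1 = 1"
    using wave_even[of 0] wave_odd[of 0] by (auto simp: h_def u_def w_end)
  moreover have "continuous_on UNIV h"
    unfolding h_def by (rule continuous_on_compose2[OF continuous_wave u_cont]) auto
  moreover have "range h \<subseteq> {0..1}" using wave_range by (auto simp: h_def)
  ultimately show ?thesis by blast
qed

section \<open>Paths and non-cut points in Peano continua\<close>

text \<open>A tour is a chain of \<open>M\<close> sets from \<open>\<V>\<close> with junctions \<open>x j\<close>. The compact sets \<open>L j\<close> record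
  which part of \<open>K\<close> is to be covered inside the \<open>j\<close>-th link when the chain is refined.\<close>

definition tour :: "'b::metric_space set set \<Rightarrow> 'b \<Rightarrow> 'b \<Rightarrow> 'b set \<Rightarrow> 'b set \<Rightarrow> nat \<Rightarrow> bool" where
  "tour \<V> a b K Q M \<longleftrightarrow> (\<exists>V x L. x 0 = a \<and> x M = b \<and>
     (\<forall>j<M. V j \<in> \<V> \<and> x j \<in> V j \<and> x (Suc j) \<in> V j \<and> compact (L j) \<and> L j \<subseteq> V j) \<and>
     K \<subseteq> (\<Union>j<M. L j) \<and> Q \<subseteq> x ` {..M})"

lemma tour_refl: "tour \<V> a a {} {a} 0"
  unfolding tour_def by (intro exI[of _ "\<lambda>_. {}"] exI[of _ "\<lambda>_. a"]) auto

lemma tour_step: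
  assumes "V \<in> \<V>" "a \<in> V" "b \<in> V" "compact K" "K \<subseteq> V"
  shows "tour \<V> a b K {a, b} 1"
  unfolding tour_def
  by (intro exI[of _ "\<lambda>_. V"] exI[of _ "\<lambda>j. if j = 0 then a else b"] exI[of _ "\<lambda>_. K"])
    (use assms in \<open>auto simp: image_iff\<close>)

lemma tour_mono: "tour \<V> a b K Q M \<Longrightarrow> K' \<subseteq> K \<Longrightarrow> Q' \<subseteq> Q \<Longrightarrow> tour \<V> a b K' Q' M"
  unfolding tour_def by (elim ex_forward) auto

lemma tour_trans:
  assumes "tour \<V> a b K Q M" "tour \<V> b c K' Q' M'"
  shows "tour \<V> a c (K \<union> K') (Q \<union> Q') (M + M')"
proof -
  obtain V x L where 1: "x 0 = a" "x M = b"
      "\<And>j. j < M \<Longrightarrow> V j \<in> \<V> \<and> x j \<in> V j \<and> x (Suc j) \<in> V j \<and> compact (L j) \<and> L j \<subseteq> V j"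
      "K \<subseteq> (\<Union>j<M. L j)" "Q \<subseteq> x ` {..M}"
    using assms(1) unfolding tour_def by metis
  obtain V' x' L' where 2: "x' 0 = b" "x' M' = c"
      "\<And>j. j < M' \<Longrightarrow> V' j \<in> \<V> \<and> x' j \<in> V' j \<and> x' (Suc j) \<in> V' j \<and> compact (L' j) \<and> L' j \<subseteq> V' j"
      "K' \<subseteq> (\<Union>j<M'. L' j)" "Q' \<subseteq> x' ` {..M'}"
    using assms(2) unfolding tour_def by metis
  define W where "W j = (if j < M then V j else V' (j - M))" for j
  define y where "y j = (if j < M then x j else x' (j - M))" for j
  define J where "J j = (if j < M then L j else L' (j - M))" for j
  have y1: "y j = x j" if "j \<le> M" for j using that 1(2) 2(1) by (auto simp: y_def)
  have y2: "y (M + j) = x' j" for j by (simp add: y_def)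
  have J2: "J (M + j) = L' j" for j by (simp add: J_def)
  have f1: "y 0 = a" using 1(1) y1[of 0] by simp
  have f2: "y (M + M') = c" using 2(2) y2[of M'] by simp
  have f3: "W j \<in> \<V> \<and> y j \<in> W j \<and> y (Suc j) \<in> W j \<and> compact (J j) \<and> J j \<subseteq> W j" if "j < M + M'" for j
  proof (cases "j < M")
    case True
    then show ?thesis using 1(3)[OF True] y1[of j] y1[of "Suc j"] by (auto simp: W_def J_def)
  next
    case False
    then have "j - M < M'" "Suc j - M = Suc (j - M)" "\<not> Suc j < M" using that by auto
    then show ?thesis using 2(3)[of "j - M"] False by (auto simp: W_def J_def y_def)
  qed
  have f4: "K \<union> K' \<subseteq> (\<Union>j<M + M'. J j)"
  proof
    fix z assume "z \<in> K \<union> K'"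
    then consider j where "j < M" "z \<in> L j" | j where "j < M'" "z \<in> L' j" using 1(4) 2(4) by blast
    then show "z \<in> (\<Union>j<M + M'. J j)"
    proof cases
      case (1 j) then show ?thesis by (auto simp: J_def intro!: bexI[of _ j])
    next
      case (2 j) then show ?thesis by (auto simp: J2 intro!: bexI[of _ "M + j"])
    qed
  qed
  have f5: "Q \<union> Q' \<subseteq> y ` {..M + M'}"
  proof
    fix z assume "z \<in> Q \<union> Q'"
    then consider j where "j \<le> M" "z = x j" | j where "j \<le> M'" "z = x' j" using 1(5) 2(5) by blast
    then show "z \<in> y ` {..M + M'}"
    proof cases
      case (1 j) then show ?thesis by (auto simp: y1 intro!: image_eqI[of _ _ j])
    next
      case (2 j) then show ?thesis by (auto simp: y2 intro!: image_eqI[of _ _ "M + j"])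
    qed
  qed
  show ?thesis unfolding tour_def
    by (rule exI[of _ W], rule exI[of _ y], rule exI[of _ J]) (intro conjI allI impI f1 f2 f4 f5; use f3 in blast)
qed

text \<open>Repeating the last junction lengthens a tour at will, so the tours refining different
  links of a walk can all be given one common length.\<close>

lemma tour_pad:
  assumes "tour \<V> a b K Q M" "V \<in> \<V>" "b \<in> V" "M \<le> N"
  shows "tour \<V> a b K Q N"
  using assms(4)
proof (induction rule: dec_induct)
  case base then show ?case by (rule assms(1))
next
  case (step n)
  have "tour \<V> b b {} {b, b} 1" by (rule tour_step) (use assms in auto)
  from tour_mono[OF tour_trans[OF step.IH this]] show ?case by auto
qed

lemma tour_connected:
  assumes W: "connected W"
    and nb: "\<And>x. x \<in> W \<Longrightarrow> \<exists>V\<in>\<V>. openin (top_of_set W) V \<and> x \<in> V"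
    and ab: "a \<in> W" "b \<in> W"
  shows "\<exists>M. tour \<V> a b {} {} M"
proof -
  \<comment> \<open>Reachability is stated in both directions so that the relation is symmetric; its
    classes are open because a link joins any two of its points.\<close>
  have "\<exists>M M'. tour \<V> a b {} {} M \<and> tour \<V> b a {} {} M'"
  proof (rule connected_equivalence_relation[OF W ab])
    fix x y assume "\<exists>M M'. tour \<V> x y {} {} M \<and> tour \<V> y x {} {} M'"
    then show "\<exists>M M'. tour \<V> y x {} {} M \<and> tour \<V> x y {} {} M'" by blast
  next
    fix x y z assume "\<exists>M M'. tour \<V> x y {} {} M \<and> tour \<V> y x {} {} M'"
      "\<exists>M M'. tour \<V> y z {} {} M \<and> tour \<V> z y {} {} M'"
    then show "\<exists>M M'. tour \<V> x z {} {} M \<and> tour \<V> z x {} {} M'"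
      using tour_trans[of \<V> x y "{}" "{}" _ z "{}" "{}"] tour_trans[of \<V> z y "{}" "{}" _ x "{}" "{}"]
      by (metis Un_empty)
  next
    fix x assume "x \<in> W"
    then obtain V where V: "V \<in> \<V>" "openin (top_of_set W) V" "x \<in> V" using nb by blast
    have "tour \<V> y z {} {} 1" if "y \<in> V" "z \<in> V" for y z
      using tour_mono[OF tour_step[OF V(1) that, of "{}"], of "{}" "{}"] by auto
    then show "\<exists>T. openin (top_of_set W) T \<and> x \<in> T \<and>
        (\<forall>y\<in>T. \<exists>M M'. tour \<V> x y {} {} M \<and> tour \<V> y x {} {} M')"
      using V by blast
  qed
  then show ?thesis by blast
qed

text \<open>Visit the centres one by one; at each centre \<open>y\<close> a stationary step inside
  \<open>V y\<close> takes charge of \<open>L y\<close>.\<close>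

lemma tour_finite_cover:
  assumes conn: "\<And>a b. a \<in> W \<Longrightarrow> b \<in> W \<Longrightarrow> \<exists>M. tour \<V> a b {} {} M"
    and sub: "\<And>V. V \<in> \<V> \<Longrightarrow> V \<subseteq> W"
    and "finite F" and F: "\<And>y. y \<in> F \<Longrightarrow> V y \<in> \<V> \<and> y \<in> V y \<and> compact (L y) \<and> L y \<subseteq> V y"
    and ab: "a \<in> W" "b \<in> W"
  shows "\<exists>M. tour \<V> a b (\<Union>y\<in>F. L y) {} M"
  using \<open>finite F\<close> F ab
proof (induction F arbitrary: a b rule: finite_induct)
  case empty
  then show ?case using conn by auto
next
  case (insert y F)
  have y: "V y \<in> \<V>" "y \<in> V y" "compact (L y)" "L y \<subseteq> V y" "y \<in> W"
    using insert.prems(1)[of y] sub by auto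
  obtain M1 where 1: "tour \<V> a y {} {} M1" using conn insert.prems(2) y by blast
  have 2: "tour \<V> y y (L y) {} 1" using tour_mono[OF tour_step[of "V y" \<V> y y "L y"]] y by auto
  obtain M3 where 3: "tour \<V> y b (\<Union>y\<in>F. L y) {} M3"
    using insert.IH[of y b] insert.prems y by auto
  show ?case using tour_trans[OF 1 tour_trans[OF 2 3]] by auto
qed

section \<open>Fine tours in compact, connected, locally connected sets\<close>

locale peano_set =
  fixes S :: "'b::metric_space set"
  assumes compact_S: "compact S" and connected_S: "connected S"
    and locally_connected_S: "locally connected S"
    and nontrivial_S: "\<exists>x\<in>S. \<exists>y\<in>S. x \<noteq> y"
begin

lemma small_neighbourhood:
  assumes W: "openin (top_of_set S) W" "x \<in> W" and e: "0 < e"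
  shows "\<exists>V. openin (top_of_set S) V \<and> connected V \<and> x \<in> V \<and> closure V \<subseteq> W \<and> (\<forall>y\<in>V. \<forall>z\<in>V. dist y z \<le> e)"
proof -
  obtain r where r: "0 < r" "ball x r \<inter> S \<subseteq> W" using W by (meson openin_contains_ball)
  define d where "d = min (r/2) (e/2)"
  have d: "0 < d" using r e by (simp add: d_def)
  have "openin (top_of_set S) (S \<inter> ball x d)" by (simp add: openin_open_Int)
  moreover have "x \<in> S \<inter> ball x d" using W d openin_imp_subset by force
  ultimately obtain V where V: "openin (top_of_set S) V" "connected V" "x \<in> V" "V \<subseteq> S \<inter> ball x d"
    using locally_connected_S unfolding locally_connected by meson
  have "closure V \<subseteq> S \<inter> cball x d"
    by (rule closure_minimal) (use V compact_S in \<open>auto intro: compact_imp_closed\<close>)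
  also have "\<dots> \<subseteq> W" using r by (auto simp: d_def)
  finally have "closure V \<subseteq> W" .
  moreover have "dist y z \<le> e" if "y \<in> V" "z \<in> V" for y z
  proof -
    have "dist x y < d" "dist x z < d" using that V(4) by auto
    then show ?thesis using dist_triangle3[of y z x] by (simp add: d_def)
  qed
  ultimately show ?thesis using V by blast
qed

text \<open>An isolated point would be clopen in the connected set \<open>S\<close>.\<close>

lemma open_has_other_point:
  assumes W: "openin (top_of_set S) W" "x \<in> W"
  shows "\<exists>y\<in>W. y \<noteq> x"
proof (rule ccontr)
  assume "\<not> ?thesis"
  then have "W = {x}" using W(2) by blast
  moreover have "x \<in> S" using openin_imp_subset[OF W(1)] W(2) by blast
  then have "closedin (top_of_set S) {x}" by (simp add: closedin_subset)
  ultimately have "S = {x}"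
    using connected_S W unfolding connected_clopen by (metis insert_not_empty)
  then show False using nontrivial_S by auto
qed

text \<open>The closures, not just the links, must lie in \<open>W\<close>: a limit of points taken
  from one link then still lies in the open set \<open>W\<close>.\<close>

definition fine_sets :: "'b set \<Rightarrow> real \<Rightarrow> 'b set set" where
  "fine_sets W e = {V. openin (top_of_set S) V \<and> connected V \<and> closure V \<subseteq> W \<and> (\<forall>y\<in>V. \<forall>z\<in>V. dist y z \<le> e)}"

text \<open>The waypoint \<open>c\<close> is what later makes the limit path nonconstant. Closed
  balls around finitely many points of \<open>K\<close> cut it into compact parts, each inside one
  link of the cover.\<close>

lemma tour_exists:
  assumes W: "openin (top_of_set S) W" "connected W" and K: "compact K" "K \<subseteq> W"
    and abc: "a \<in> W" "b \<in> W" "c \<in> W" and e: "0 < e"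
  shows "\<exists>M0. \<forall>M\<ge>M0. tour (fine_sets W e) a b K {c} M"
proof -
  let ?V = "fine_sets W e"
  have nb: "\<exists>V\<in>?V. x \<in> V" if "x \<in> W" for x
    using small_neighbourhood[OF W(1) that e] by (auto simp: fine_sets_def)
  have sub: "V \<subseteq> W" if "V \<in> ?V" for V
    using that closure_subset by (auto simp: fine_sets_def)
  have op: "openin (top_of_set W) V" if "V \<in> ?V" for V
    using that sub[OF that] W(1) openin_imp_subset[OF W(1)] by (auto simp: fine_sets_def intro: openin_subset_trans)
  have conn: "\<exists>M. tour ?V x y {} {} M" if "x \<in> W" "y \<in> W" for x y
  proof (rule tour_connected[OF W(2) _ that])
    show "\<exists>V\<in>?V. openin (top_of_set W) V \<and> z \<in> V" if z: "z \<in> W" for z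
    proof -
      obtain V where "V \<in> ?V" "z \<in> V" using nb[OF z] by (rule bexE)
      then show ?thesis using op by (intro bexI[of _ V] conjI)
    qed
  qed
  have "\<forall>x\<in>W. \<exists>V r. V \<in> ?V \<and> x \<in> V \<and> 0 < r \<and> cball x r \<inter> S \<subseteq> V"
  proof
    fix x assume "x \<in> W"
    then obtain V where V: "V \<in> ?V" "x \<in> V" using nb by blast
    then obtain r where "0 < r" "ball x r \<inter> S \<subseteq> V" by (auto simp: fine_sets_def openin_contains_ball)
    then have "0 < r/2" "cball x (r/2) \<inter> S \<subseteq> V" by auto
    with V show "\<exists>V r. V \<in> ?V \<and> x \<in> V \<and> 0 < r \<and> cball x r \<inter> S \<subseteq> V" by blast
  qed
  then obtain V r where Vr: "\<And>x. x \<in> W \<Longrightarrow> V x \<in> ?V \<and> x \<in> V x \<and> 0 < r x \<and> cball x (r x) \<inter> S \<subseteq> V x"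
    by metis
  have "K \<subseteq> (\<Union>x\<in>K. ball x (r x))" using Vr K(2) by force
  then obtain F where F: "F \<subseteq> K" "finite F" "K \<subseteq> (\<Union>x\<in>F. ball x (r x))"
    using compactE_image[OF K(1), of K "\<lambda>x. ball x (r x)"] by auto
  define L where "L y = K \<inter> cball y (r y)" for y
  have L: "V y \<in> ?V \<and> y \<in> V y \<and> compact (L y) \<and> L y \<subseteq> V y" if "y \<in> F" for y
  proof -
    have y: "y \<in> W" using that F K by auto
    have "L y \<subseteq> V y" using Vr[OF y] K(2) openin_imp_subset[OF W(1)] by (auto simp: L_def)
    then show ?thesis using Vr[OF y] K(1) by (auto simp: L_def intro: compact_Int_closed)
  qed
  have KL: "K \<subseteq> (\<Union>y\<in>F. L y)" 
  proof
    fix z assume z: "z \<in> K"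
    then obtain y where "y \<in> F" "z \<in> ball y (r y)" using F(3) by blast
    then show "z \<in> (\<Union>y\<in>F. L y)" using z by (intro UN_I[of y]) (auto simp: L_def)
  qed
  obtain M1 where M1: "tour ?V a c (\<Union>y\<in>F. L y) {} M1"
    using tour_finite_cover[OF conn sub F(2) L abc(1,3)] by blast
  obtain M2 where M2: "tour ?V c b {} {} M2" using conn abc by blast
  have "tour ?V a b ((\<Union>y\<in>F. L y) \<union> ({} \<union> {})) ({} \<union> ({c} \<union> {})) (M1 + (0 + M2))"
    by (rule tour_trans[OF M1 tour_trans[OF tour_refl M2]])
  then have *: "tour ?V a b K {c} (M1 + (0 + M2))"
    by (rule tour_mono) (use KL in auto)
  show ?thesis using tour_pad[OF *] nb[OF abc(2)] by blast
qed

section \<open>Refining walks and their limit path\<close>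

definition walk_level :: "'b set \<Rightarrow> 'b set \<Rightarrow> 'b \<Rightarrow> 'b \<Rightarrow> nat \<Rightarrow> nat \<times> (nat \<Rightarrow> 'b set) \<times> (nat \<Rightarrow> 'b) \<times> (nat \<Rightarrow> 'b set) \<Rightarrow> bool" where
  "walk_level W K a b k = (\<lambda>(N, V, x, L). 0 < N \<and> x 0 = a \<and> x N = b \<and> K \<subseteq> (\<Union>i<N. L i) \<and>
     (\<forall>i<N. openin (top_of_set S) (V i) \<and> connected (V i) \<and> V i \<subseteq> W \<and> x i \<in> V i \<and> x (Suc i) \<in> V i \<and>
        compact (L i) \<and> L i \<subseteq> V i \<and> (0 < k \<longrightarrow> closure (V i) \<subseteq> W \<and> (\<forall>y\<in>V i. \<forall>z\<in>V i. dist y z \<le> (1/2) ^ k))))"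

text \<open>One factor \<open>M\<close> serves all links, so node \<open>i\<close> of the coarse
  walk becomes node \<open>i * M\<close> and keeps its parameter \<open>i / N\<close>, and link
  \<open>l\<close> lies inside link \<open>l div M\<close>. The last clause prevents the limit from
  being constant on the parameter interval of a link.\<close>

definition walk_refines :: "nat \<times> (nat \<Rightarrow> 'b set) \<times> (nat \<Rightarrow> 'b) \<times> (nat \<Rightarrow> 'b set) \<Rightarrow> nat \<times> (nat \<Rightarrow> 'b set) \<times> (nat \<Rightarrow> 'b) \<times> (nat \<Rightarrow> 'b set) \<Rightarrow> bool" where
  "walk_refines = (\<lambda>(N, V, x, L) (N', V', x', L'). \<exists>M\<ge>2. N' = N * M \<and> (\<forall>l<N'. V' l \<subseteq> V (l div M)) \<and>
     (\<forall>i\<le>N. x' (i * M) = x i) \<and> (\<forall>i<N. \<exists>j\<le>M. x' (i * M + j) \<noteq> x i))"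

lemma walk_refinement:
  assumes "walk_level W K a b k s"
  shows "\<exists>s'. walk_level W K a b (Suc k) s' \<and> walk_refines s s'"
proof -
  obtain N V x L where s: "s = (N, V, x, L)" by (cases s)
  have N: "0 < N" and x0: "x 0 = a" and xN: "x N = b" and K: "K \<subseteq> (\<Union>i<N. L i)"
    using assms by (auto simp: s walk_level_def)
  have lev: "openin (top_of_set S) (V i)" "connected (V i)" "V i \<subseteq> W" "x i \<in> V i" "x (Suc i) \<in> V i"
      "compact (L i)" "L i \<subseteq> V i" if "i < N" for i
    using assms that by (auto simp: s walk_level_def)
  let ?e = "(1/2) ^ Suc k :: real"
  have "\<forall>i. \<exists>c M0. i < N \<longrightarrow> c \<noteq> x i \<and> (\<forall>M\<ge>M0. tour (fine_sets (V i) ?e) (x i) (x (Suc i)) (L i) {c} M)"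
  proof
    fix i
    show "\<exists>c M0. i < N \<longrightarrow> c \<noteq> x i \<and> (\<forall>M\<ge>M0. tour (fine_sets (V i) ?e) (x i) (x (Suc i)) (L i) {c} M)"
    proof (cases "i < N")
      case True
      obtain c where "c \<in> V i" "c \<noteq> x i" using open_has_other_point[OF lev(1,4)[OF True]] by blast
      then show ?thesis using tour_exists[of "V i" "L i" "x i" "x (Suc i)" c ?e] lev[OF True] by auto
    qed auto
  qed
  then obtain c M0 where cM: "\<And>i M. i < N \<Longrightarrow> c i \<noteq> x i"
     "\<And>i M. i < N \<Longrightarrow> M0 i \<le> M \<Longrightarrow> tour (fine_sets (V i) ?e) (x i) (x (Suc i)) (L i) {c i} M"
    by metis
  \<comment> \<open>The maximum of the thresholds makes one length fit every link; being at least 2,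
    it forces the number of links to grow geometrically.\<close>
  define M where "M = max 2 (Max (M0 ` {..<N}))"
  have M: "M0 i \<le> M" if "i < N" for i using that by (auto simp: M_def intro!: max.coboundedI2)
  have M2: "2 \<le> M" by (simp add: M_def)
  have "\<exists>U y J. i < N \<longrightarrow> y 0 = x i \<and> y M = x (Suc i) \<and>
     (\<forall>j<M. U j \<in> fine_sets (V i) ?e \<and> y j \<in> U j \<and> y (Suc j) \<in> U j \<and> compact (J j) \<and> J j \<subseteq> U j) \<and>
     L i \<subseteq> (\<Union>j<M. J j) \<and> {c i} \<subseteq> y ` {..M}" for i
  proof (cases "i < N")
    case True
    from cM(2)[OF True M[OF True]] show ?thesis
      unfolding tour_def by (elim ex_forward) (intro impI, assumption)
  qed auto
  then obtain U y J where T: "\<And>i. i < N \<Longrightarrow> y i 0 = x i" "\<And>i. i < N \<Longrightarrow> y i M = x (Suc i)"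
     "\<And>i j. i < N \<Longrightarrow> j < M \<Longrightarrow> U i j \<in> fine_sets (V i) ?e \<and> y i j \<in> U i j \<and> y i (Suc j) \<in> U i j \<and> compact (J i j) \<and> J i j \<subseteq> U i j"
     "\<And>i. i < N \<Longrightarrow> L i \<subseteq> (\<Union>j<M. J i j)" "\<And>i. i < N \<Longrightarrow> c i \<in> y i ` {..M}"
    by (metis insert_subset)
  have idx: "i * M + j < N * M" if "i < N" "j < M" for i j
  proof -
    have "i * M + j < Suc i * M" using that by simp
    also have "\<dots> \<le> N * M" using that by (intro mult_right_mono) auto
    finally show ?thesis .
  qed
  \<comment> \<open>At a junction of two blocks the descriptions agree, because the tour of link
    \<open>i\<close> ends at \<open>x (Suc i)\<close>, where the next one starts.\<close>
  define x' where "x' l = (if l < N * M then y (l div M) (l mod M) else b)" for l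
  have x'1: "x' (i * M + j) = y i j" if "i < N" "j < M" for i j
  proof -
    have "i * M + j < N * M" using that by (rule idx)
    then show ?thesis using that by (simp add: x'_def)
  qed
  have x'2: "x' (i * M) = x i" if "i \<le> N" for i
  proof (cases "i = N")
    case True then show ?thesis by (simp add: x'_def xN)
  next
    case False then show ?thesis using x'1[of i 0] that M2 T(1)[of i] by simp
  qed
  have x'3: "x' (i * M + j) = y i j" if "i < N" "j \<le> M" for i j
  proof (cases "j = M")
    case True
    then show ?thesis using x'2[of "Suc i"] that T(2)[of i] by (simp add: add.commute)
  qed (use x'1 that in auto)
  define V' where "V' l = U (l div M) (l mod M)" for l
  define L' where "L' l = J (l div M) (l mod M)" for l
  have dm: "l div M < N" "l mod M < M" if "l < N * M" for l
    using that M2 by (auto simp: less_mult_imp_div_less)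
  have xV: "x' l \<in> V' l" "x' (Suc l) \<in> V' l" if "l < N * M" for l
  proof -
    have "x' l = y (l div M) (l mod M)" "x' (Suc l) = y (l div M) (Suc (l mod M))"
      using x'3[OF dm(1)[OF that], of "l mod M"] x'3[OF dm(1)[OF that], of "Suc (l mod M)"] dm(2)[OF that]
      by auto
    then show "x' l \<in> V' l" "x' (Suc l) \<in> V' l" using T(3)[OF dm[OF that]] by (auto simp: V'_def)
  qed
  have V'1: "V' l \<in> fine_sets (V (l div M)) ?e \<and> compact (L' l) \<and> L' l \<subseteq> V' l" if "l < N * M" for l
    using T(3)[OF dm[OF that]] by (auto simp: V'_def L'_def)
  have V'2: "V' l \<subseteq> V (l div M)" if "l < N * M" for l
    using V'1[OF that] closure_subset by (auto simp: fine_sets_def)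
  have KL: "K \<subseteq> (\<Union>l<N * M. L' l)"
  proof
    fix z assume "z \<in> K"
    then obtain i where i: "i < N" "z \<in> L i" using K by blast
    then obtain j where j: "j < M" "z \<in> J i j" using T(4)[OF i(1)] by blast
    have "i * M + j < N * M" using i(1) j(1) by (rule idx)
    moreover have "z \<in> L' (i * M + j)" using j by (simp add: L'_def)
    ultimately show "z \<in> (\<Union>l<N * M. L' l)" by blast
  qed
  have other: "\<exists>j\<le>M. x' (i * M + j) \<noteq> x i" if "i < N" for i
    using T(5)[OF that] x'3[OF that] cM(1)[OF that] by fastforce
  have "walk_level W K a b (Suc k) (N * M, V', x', L')"
    unfolding walk_level_def prod.case
  proof (intro conjI allI impI ballI)
    show "0 < N * M" using N M2 by simp
    show "x' 0 = a" using x'2[of 0] x0 by simp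
    show "x' (N * M) = b" by (simp add: x'_def)
    show "K \<subseteq> (\<Union>l<N * M. L' l)" by (rule KL)
    fix l assume l: "l < N * M"
    show "openin (top_of_set S) (V' l)" "connected (V' l)" "x' l \<in> V' l" "x' (Suc l) \<in> V' l"
      "compact (L' l)" "L' l \<subseteq> V' l"
      using V'1[OF l] xV[OF l] by (auto simp: fine_sets_def)
    show "V' l \<subseteq> W" using V'2[OF l] lev(3)[OF dm(1)[OF l]] by blast
    show "closure (V' l) \<subseteq> W" using V'1[OF l] lev(3)[OF dm(1)[OF l]] by (auto simp: fine_sets_def)
    show "dist u v \<le> (1/2) ^ Suc k" if "u \<in> V' l" "v \<in> V' l" for u v
      using V'1[OF l] that by (auto simp: fine_sets_def)
  qed
  moreover have "walk_refines s (N * M, V', x', L')"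
    unfolding walk_refines_def s prod.case using M2 V'2 x'2 other by blast
  ultimately show ?thesis by blast
qed

text \<open>Compactness supplies a convergent subsequence, and the telescoped bound passes to its
  limit. The subtracted term \<open>4 * (1/2) ^ (k + m)\<close> in \<open>far\<close> is what makes
  the induction close.\<close>

lemma geometric_limit:
  fixes u :: "nat \<Rightarrow> 'b"
  assumes "\<And>k. u k \<in> S" and step: "\<And>k. dist (u k) (u (Suc k)) \<le> 2 * (1/2) ^ k"
  shows "\<exists>l\<in>S. \<forall>k. dist (u k) l \<le> 4 * (1/2) ^ k"
proof -
  have far: "dist (u k) (u (k + m)) \<le> 4 * (1/2) ^ k - 4 * (1/2) ^ (k + m)" for k m
  proof (induction m)
    case (Suc m)
    have "dist (u k) (u (k + Suc m)) \<le> dist (u k) (u (k + m)) + dist (u (k + m)) (u (Suc (k + m)))"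
      by (simp add: dist_triangle)
    also have "\<dots> \<le> 4 * (1/2) ^ k - 4 * (1/2) ^ (k + m) + 2 * (1/2) ^ (k + m)"
      using Suc step[of "k + m"] by linarith
    finally show ?case by simp
  qed auto
  have bound: "dist (u k) (u n) \<le> 4 * (1/2) ^ k" if kn: "k \<le> n" for k n
  proof -
    obtain m where "n = k + m" using kn le_Suc_ex by blast
    then show ?thesis using far[of k m] by (smt (verit) zero_le_power divide_nonneg_nonneg)
  qed
  obtain l r where l: "l \<in> S" "strict_mono r" "(u \<circ> r) \<longlonglongrightarrow> l"
    using compact_S assms(1) unfolding compact_def by metis
  have "dist (u k) l \<le> 4 * (1/2) ^ k" for k
  proof (rule tendsto_upperbound)
    show "(\<lambda>n. dist (u k) ((u \<circ> r) n)) \<longlonglongrightarrow> dist (u k) l" by (intro tendsto_intros l)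
    show "\<forall>\<^sub>F n in sequentially. dist (u k) ((u \<circ> r) n) \<le> 4 * (1/2) ^ k"
      using eventually_ge_at_top[of k]
    proof eventually_elim
      case (elim n)
      then have "k \<le> r n" using seq_suble[OF l(2), of n] by linarith
      then show ?case using bound by simp
    qed
  qed auto
  then show ?thesis using l by blast
qed

text \<open>A Hahn-Mazurkiewicz argument with prescribed ends: the step functions \<open>g'\<close>
  of refining walks converge uniformly, the nodes are actual values of the limit and approximate
  \<open>K\<close>, and each refinement puts a node different from the old one into every parameter
  interval.\<close>

lemma path_through:
  assumes W: "openin (top_of_set S) W" "connected W" and K: "compact K" "K \<subseteq> W"
    and ab: "a \<in> W" "b \<in> W"
  shows "\<exists>g :: real \<Rightarrow> 'b. continuous_on {0..1} g \<and> g ` {0..1} \<subseteq> W \<and> K \<subseteq> g ` {0..1} \<and> g 0 = a \<and> g 1 = b \<and>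
    (\<forall>c d. 0 \<le> c \<and> c < d \<and> d \<le> 1 \<longrightarrow> (\<exists>s\<in>{c..d}. \<exists>t\<in>{c..d}. g s \<noteq> g t))"
proof -
  have "\<exists>f. \<forall>k. walk_level W K a b k (f k) \<and> walk_refines (f k) (f (Suc k))"
  proof (rule dependent_nat_choice)
    \<comment> \<open>Level 0 is the single link \<open>W\<close>; the guard \<open>0 < k\<close> in
      \<open>walk_level\<close> exempts it from the conditions on closure and diameter.\<close>
    show "\<exists>s. walk_level W K a b 0 s"
      by (rule exI[of _ "(1, \<lambda>_. W, \<lambda>i. if i = 0 then a else b, \<lambda>_. K)"])
        (use W K ab in \<open>auto simp: walk_level_def\<close>)
  qed (rule walk_refinement)
  then obtain f where f: "\<And>k. walk_level W K a b k (f k)" "\<And>k. walk_refines (f k) (f (Suc k))" by blast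
  define N where "N k = fst (f k)" for k
  define V where "V k = fst (snd (f k))" for k
  define x where "x k = fst (snd (snd (f k)))" for k
  define L where "L k = snd (snd (snd (f k)))" for k
  have fk: "f k = (N k, V k, x k, L k)" for k by (simp add: N_def V_def x_def L_def)
  note f = f[unfolded fk walk_level_def walk_refines_def prod.case]
  have N0: "0 < N k" for k using f(1) by blast
  have ends: "x k 0 = a" "x k (N k) = b" for k using f(1) by blast+
  have VS: "openin (top_of_set S) (V k i)" "x k i \<in> V k i" "x k (Suc i) \<in> V k i" if "i < N k" for k i
    using f(1) that by blast+
  have small: "dist y z \<le> (1/2) ^ k" if "i < N k" "0 < k" "y \<in> V k i" "z \<in> V k i" for k i y z
    using f(1) that by blast
  obtain M where M: "\<And>k. 2 \<le> M k" "\<And>k. N (Suc k) = N k * M k"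
      "\<And>k l. l < N (Suc k) \<Longrightarrow> V (Suc k) l \<subseteq> V k (l div M k)"
      "\<And>k i. i \<le> N k \<Longrightarrow> x (Suc k) (i * M k) = x k i"
      "\<And>k i. i < N k \<Longrightarrow> \<exists>j\<le>M k. x (Suc k) (i * M k + j) \<noteq> x k i"
    using f(2) by metis
  have N_large: "k < N k" for k
  proof (induction k)
    case (Suc k)
    have "Suc k < 2 * N k" using Suc by simp
    also have "\<dots> \<le> N (Suc k)" using M(1)[of k] by (simp add: M(2))
    finally show ?case .
  qed (use N0 in auto)
  \<comment> \<open>The index of the link whose parameter interval contains \<open>t\<close>. At
    \<open>t = 1\<close> it equals \<open>N k\<close>, one past the last link, so several steps
    treat that end point separately.\<close>
  define ix where "ix k t = nat \<lfloor>t * real (N k)\<rfloor>" for k and t :: real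
  have ix_le: "ix k t \<le> N k" if "t \<in> {0..1}" for k t
  proof -
    have "t * real (N k) \<le> 1 * real (N k)" using that by (intro mult_right_mono) auto
    then show ?thesis unfolding ix_def by linarith
  qed
  have ix_less: "ix k t < N k" if "0 \<le> t" "t < 1" for k t
  proof -
    have "t * real (N k) < 1 * real (N k)" using that N0 by (intro mult_strict_right_mono) auto
    then show ?thesis using that by (simp add: ix_def nat_less_iff floor_less_iff)
  qed
  have ix_div: "ix (Suc k) t div M k = ix k t" if "0 \<le> t" for k t
  proof -
    have "\<lfloor>t * real (N (Suc k))\<rfloor> div int (M k) = \<lfloor>t * real (N (Suc k)) / real_of_int (int (M k))\<rfloor>"
      by (rule floor_divide_real_eq_div[symmetric]) simp
    also have "t * real (N (Suc k)) / real_of_int (int (M k)) = t * real (N k)"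
      using M(1)[of k] by (simp add: M(2))
    finally have "ix k t = nat (\<lfloor>t * real (N (Suc k))\<rfloor> div int (M k))" by (simp add: ix_def)
    also have "\<dots> = nat \<lfloor>t * real (N (Suc k))\<rfloor> div nat (int (M k))"
      using that by (intro nat_div_distrib) simp
    finally show ?thesis by (simp add: ix_def)
  qed
  define g' where "g' k t = x k (ix k t)" for k t
  have g'S: "g' k t \<in> S" if "t \<in> {0..1}" for k t
  proof (cases "t = 1")
    case True then show ?thesis using ends ab openin_imp_subset[OF W(1)] by (auto simp: g'_def ix_def)
  next
    case False
    then have "ix k t < N k" using ix_less[of t k] that by auto
    from VS(2)[OF this] openin_imp_subset[OF VS(1)[OF this]] show ?thesis by (auto simp: g'_def)
  qed
  have g'V: "g' (Suc k) t \<in> V k (ix k t)" if "0 \<le> t" "t < 1" for k t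
    using M(3)[of "ix (Suc k) t" k] ix_less[OF that, of "Suc k"] VS(2)[of "ix (Suc k) t" "Suc k"] ix_div[OF that(1), of k]
    by (auto simp: g'_def)
  have step: "dist (g' (Suc k) t) (g' (Suc (Suc k)) t) \<le> 2 * (1/2) ^ Suc k" if "t \<in> {0..1}" for k t
  proof (cases "t = 1")
    case True then show ?thesis using ends by (simp add: g'_def ix_def)
  next
    case False
    then have t: "0 \<le> t" "t < 1" using that by auto
    have "dist (g' (Suc k) t) (g' (Suc (Suc k)) t) \<le> (1/2) ^ Suc k"
      by (rule small[of "ix (Suc k) t"])
        (use ix_less[OF t] VS(2)[of "ix (Suc k) t" "Suc k"] g'V[OF t, of "Suc k"] in \<open>auto simp: g'_def\<close>)
    also have "\<dots> \<le> 2 * (1/2) ^ Suc k" by simp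
    finally show ?thesis .
  qed
  have "\<forall>t. \<exists>l. t \<in> {0..1} \<longrightarrow> l \<in> S \<and> (\<forall>k. dist (g' (Suc k) t) l \<le> 4 * (1/2) ^ k)"
  proof
    fix t :: real
    show "\<exists>l. t \<in> {0..1} \<longrightarrow> l \<in> S \<and> (\<forall>k. dist (g' (Suc k) t) l \<le> 4 * (1/2) ^ k)"
    proof (cases "t \<in> {0..1}")
      case True
      have "dist (g' (Suc k) t) (g' (Suc (Suc k)) t) \<le> 2 * (1/2) ^ k" for k
        using step[OF True, of k] by (rule order_trans) simp
      from geometric_limit[of "\<lambda>k. g' (Suc k) t", OF g'S[OF True] this] show ?thesis by blast
    qed auto
  qed
  then obtain g where gS: "\<And>t. t \<in> {0..1} \<Longrightarrow> g t \<in> S"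
    and g: "\<And>t k. t \<in> {0..1} \<Longrightarrow> dist (g' (Suc k) t) (g t) \<le> 4 * (1/2) ^ k" by metis
  have pow0: "\<exists>k. C * (1/2) ^ k < e" if eC: "0 < e" "0 < C" for e C :: real
  proof -
    obtain k where "(1/2) ^ k < e / C" using real_arch_pow_inv[of "e / C" "1/2"] eC by auto
    then show ?thesis using eC by (intro exI[of _ k]) (simp add: field_simps)
  qed
  have eqI: "y = z" if le: "\<And>k. dist y z \<le> C * (1/2) ^ k" and C: "0 < C" for y z :: 'b and C
  proof (rule ccontr)
    assume "y \<noteq> z"
    then obtain k where "C * (1/2) ^ k < dist y z" using pow0[of "dist y z" C] C by auto
    then show False using le[of k] by simp
  qed
  have close: "dist (g' k s) (g' k t) \<le> (1/2) ^ k"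
    if "s \<in> {0..1}" "t \<in> {0..1}" "s \<le> t" "t - s < 1 / real (N k)" "0 < k" for k s t
  proof -
    have "s * real (N k) \<le> t * real (N k)" "t * real (N k) < s * real (N k) + 1"
      using that N0[of k] by (auto simp: field_simps mult_right_mono)
    then have "ix k t = ix k s \<or> ix k t = Suc (ix k s)"
      unfolding ix_def using that by (auto simp: nat_eq_iff) linarith+
    then show ?thesis
    proof
      assume *: "ix k t = Suc (ix k s)"
      then have "ix k s < N k" using ix_le[OF that(2), of k] by simp
      then show ?thesis using small[of "ix k s" k] VS[of "ix k s" k] * that by (auto simp: g'_def)
    qed (simp add: g'_def)
  qed
  have cont: "continuous_on {0..1} g"
    unfolding continuous_on_iff
  proof (intro ballI allI impI)
    fix s e :: real assume s: "s \<in> {0..1}" and e: "0 < e"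
    obtain k where k: "9 * (1/2) ^ k < e" using pow0[OF e, of 9] by auto
    have "dist (g t) (g s) < e" if t: "t \<in> {0..1}" and d: "dist t s < 1 / real (N (Suc k))" for t
    proof -
      have "dist (g' (Suc k) t) (g' (Suc k) s) \<le> (1/2) ^ Suc k"
      proof (cases "s \<le> t")
        case True then show ?thesis using close[OF s t, of "Suc k"] d by (simp add: dist_real_def dist_commute)
      next
        case False then show ?thesis using close[OF t s, of "Suc k"] d by (simp add: dist_real_def)
      qed
      also have "\<dots> \<le> (1/2) ^ k" by simp
      finally have "dist (g t) (g s) \<le> 4 * (1/2) ^ k + (1/2) ^ k + 4 * (1/2) ^ k"
        using g[OF t, of k] g[OF s, of k] dist_triangle[of "g t" "g s" "g' (Suc k) t"]
          dist_triangle[of "g' (Suc k) t" "g s" "g' (Suc k) s"] by (simp add: dist_commute)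
      then show ?thesis using k by linarith
    qed
    then show "\<exists>d>0. \<forall>t\<in>{0..1}. dist t s < d \<longrightarrow> dist (g t) (g s) < e"
      using N0[of "Suc k"] by (intro exI[of _ "1 / real (N (Suc k))"]) auto
  qed
  \<comment> \<open>Refinement keeps both the position and the parameter of a node, so at that
    parameter the step functions no longer change.\<close>
  have persist: "\<exists>j. j \<le> N (k + m) \<and> real j / real (N (k + m)) = real i / real (N k) \<and> x (k + m) j = x k i"
    if i: "i \<le> N k" for k m i
  proof (induction m)
    case 0 then show ?case using i by auto
  next
    case (Suc m)
    then obtain j where j: "j \<le> N (k + m)" "real j / real (N (k + m)) = real i / real (N k)" "x (k + m) j = x k i" by blast
    then show ?case using M(4)[OF j(1)] M(1)[of "k + m"]
      by (intro exI[of _ "j * M (k + m)"]) (auto simp: M(2))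
  qed
  have node: "g (real i / real (N k)) = x k i" if i: "i \<le> N k" for k i
  proof -
    let ?t = "real i / real (N k)"
    have t: "?t \<in> {0..1}" using i N0[of k] by auto
    have "dist (g ?t) (x k i) \<le> 4 * (1/2) ^ m" for m
    proof -
      obtain j where j: "j \<le> N (k + Suc m)" "real j / real (N (k + Suc m)) = ?t" "x (k + Suc m) j = x k i"
        using persist[OF i] by blast
      have "?t * real (N (k + Suc m)) = real j" using j(2) N0[of "k + Suc m"] by (simp add: field_simps)
      then have "ix (k + Suc m) ?t = j" by (simp only: ix_def floor_of_nat nat_int)
      then have "g' (Suc (k + m)) ?t = x k i" using j(3) by (simp add: g'_def)
      then have "dist (g ?t) (x k i) \<le> 4 * (1/2) ^ (k + m)" using g[OF t, of "k + m"] by (simp add: dist_commute)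
      also have "\<dots> \<le> 4 * (1/2) ^ m" by (simp add: power_decreasing)
      finally show ?thesis .
    qed
    then show ?thesis by (rule eqI) simp
  qed
  have "g ` {0..1} \<subseteq> W"
  proof clarify
    fix t :: real assume t: "t \<in> {0..1}"
    show "g t \<in> W"
    proof (cases "t = 1")
      case True
      then show ?thesis using node[of "N 0" 0] ends[of 0] N0[of 0] ab by simp
    next
      case False
      then have t': "0 \<le> t" "t < 1" using t by auto
      have sub: "g' (Suc (Suc k)) t \<in> V 1 (ix 1 t)" for k
      proof -
        have anc: "V (Suc k) (ix (Suc k) t) \<subseteq> V 1 (ix 1 t)" for k
        proof (induction k)
          case (Suc k)
          then show ?case using M(3)[of "ix (Suc (Suc k)) t" "Suc k"] ix_less[OF t', of "Suc (Suc k)"] ix_div[OF t'(1), of "Suc k"] by simp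
        qed simp
        then show ?thesis using g'V[OF t', of "Suc k"] by blast
      qed
      \<comment> \<open>Level 1 is the coarsest level whose links are required to have their closure
        in \<open>W\<close>.\<close>
      have "g t \<in> closure (V 1 (ix 1 t))"
        unfolding closure_approachable
      proof (intro allI impI)
        fix e :: real assume "0 < e"
        then obtain k where "4 * (1/2) ^ k < e" using pow0[of e 4] by auto
        moreover have "4 * (1/2) ^ Suc k \<le> (4 * (1/2) ^ k :: real)" by simp
        ultimately show "\<exists>y\<in>V 1 (ix 1 t). dist y (g t) < e"
          using g[OF t, of "Suc k"] by (intro bexI[OF _ sub[of k]]) linarith
      qed
      then show ?thesis using f(1)[of 1] ix_less[OF t', of 1] by auto
    qed
  qed
  moreover have "K \<subseteq> g ` {0..1}"
  proof
    fix y assume y: "y \<in> K"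
    have "closed (g ` {0..1})"
      by (intro compact_imp_closed compact_continuous_image cont) simp
    moreover have "y \<in> closure (g ` {0..1})"
      unfolding closure_approachable
    proof (intro allI impI)
      fix e :: real assume "0 < e"
      then obtain k where k: "1 * (1/2) ^ k < e" using pow0[of e 1] by auto
      obtain i where i: "i < N (Suc k)" "y \<in> L (Suc k) i" using f(1)[of "Suc k"] y by blast
      have "dist (x (Suc k) i) y \<le> (1/2) ^ Suc k"
        by (rule small[of i]) (use i VS[of i "Suc k"] f(1)[of "Suc k"] in auto)
      also have "\<dots> \<le> (1/2) ^ k" by simp
      finally have "dist (x (Suc k) i) y < e" using k by linarith
      moreover have "x (Suc k) i \<in> g ` {0..1}"
        using node[of i "Suc k"] i(1) by (intro image_eqI[of _ _ "real i / real (N (Suc k))"]) auto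
      ultimately show "\<exists>z\<in>g ` {0..1}. dist z y < e" by blast
    qed
    ultimately show "y \<in> g ` {0..1}" by (simp add: closure_closed)
  qed
  moreover have "g 0 = a" using node[of 0 0] ends by simp
  moreover have "g 1 = b" using node[of "N 0" 0] ends N0[of 0] by simp
  moreover have "\<exists>s\<in>{c..d}. \<exists>t\<in>{c..d}. g s \<noteq> g t" if cd: "0 \<le> c" "c < d" "d \<le> 1" for c d
  proof -
    obtain k :: nat where "2 / (d - c) < k" using reals_Archimedean2 by blast
    then have "2 / (d - c) < N k" using N_large[of k] by linarith
    then have h: "2 < (d - c) * N k" using cd by (simp add: field_simps)
    \<comment> \<open>As \<open>2 < (d - c) * N k\<close>, a whole parameter interval of level
      \<open>k\<close> fits into \<open>{c..d}\<close>; it contains an inserted node that differs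
      from its left end.\<close>
    define i where "i = nat \<lceil>c * N k\<rceil>"
    have "0 \<le> c * N k" using cd by simp
    then have i: "c * N k \<le> i" "i < c * N k + 1" unfolding i_def by linarith+
    then have i2: "real i + 1 < d * N k" using h by (simp add: algebra_simps)
    have "d * real (N k) \<le> 1 * real (N k)" using cd by (intro mult_right_mono) auto
    then have iN: "i < N k" using i2 by linarith
    obtain j where j: "j \<le> M k" "x (Suc k) (i * M k + j) \<noteq> x k i" using M(5)[OF iN] by blast
    let ?s = "real i / N k" and ?t = "real (i * M k + j) / N (Suc k)"
    have "Suc i * M k \<le> N k * M k" using iN by (intro mult_right_mono) auto
    then have le: "i * M k + j \<le> N (Suc k)" using j(1) by (simp add: M(2))
    have "g ?s \<noteq> g ?t" using node[of i k] node[OF le] iN j(2) by simp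
    moreover have "?s \<in> {c..d}" using i i2 N0[of k] by (auto simp: field_simps)
    moreover have "?t \<in> {c..d}"
    proof -
      define q where "q = real j / real (M k)"
      have t: "?t = (real i + q) / N k" using M(1)[of k] by (simp add: M(2) q_def field_simps)
      have "0 \<le> q" "q \<le> 1" using j(1) M(1)[of k] by (auto simp: q_def)
      then show ?thesis unfolding t using i i2 N0[of k] by (auto simp: field_simps)
    qed
    ultimately show ?thesis by blast
  qed
  ultimately show ?thesis using cont by blast
qed

text \<open>The complement of a maximal proper connected open set is a single point: adding a small
  connected neighbourhood of a boundary point must give everything.\<close>

lemma noncut_point: "\<exists>p\<in>S. connected (S - {p})"
proof -
  define A where "A = {U. openin (top_of_set S) U \<and> connected U \<and> U \<noteq> {} \<and> U \<noteq> S}"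
  have "\<exists>U\<in>A. \<forall>X\<in>A. U \<subseteq> X \<longrightarrow> X = U"
  proof (rule subset_Zorn_nonempty)
    obtain x y where xy: "x \<in> S" "y \<in> S" "x \<noteq> y" using nontrivial_S by blast
    then have "openin (top_of_set S) (S - {y})" by (simp add: openin_delete)
    then obtain V where "openin (top_of_set S) V" "connected V" "x \<in> V" "V \<subseteq> S - {y}"
      using locally_connected_S xy unfolding locally_connected by (metis Diff_iff singletonD)
    then have "V \<in> A" using xy by (auto simp: A_def)
    then show "A \<noteq> {}" by blast
  next
    fix \<C> assume "\<C> \<noteq> {}" and chain: "subset.chain A \<C>"
    then have A: "\<And>U. U \<in> \<C> \<Longrightarrow> U \<in> A" by (auto simp: subset.chain_def)
    have "openin (top_of_set S) (\<Union>\<C>)" using A by (auto simp: A_def)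
    moreover have "connected (\<Union>\<C>)"
    proof -
      obtain U0 where U0: "U0 \<in> \<C>" using \<open>\<C> \<noteq> {}\<close> by blast
      then obtain x where x: "x \<in> U0" using A by (auto simp: A_def)
      have "\<Union>\<C> = \<Union>{U \<in> \<C>. U0 \<subseteq> U}" using chain U0 by (fastforce simp: subset.chain_def)
      moreover have "connected (\<Union>{U \<in> \<C>. U0 \<subseteq> U})"
        by (rule connected_Union) (use A x in \<open>auto simp: A_def\<close>)
      ultimately show ?thesis by simp
    qed
    moreover have "\<Union>\<C> \<noteq> {}" using \<open>\<C> \<noteq> {}\<close> A by (auto simp: A_def)
    \<comment> \<open>By compactness a finite subchain would already cover \<open>S\<close>, and its
      largest member would be an element of \<open>A\<close> equal to \<open>S\<close>.\<close>
    moreover have "\<Union>\<C> \<noteq> S"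
    proof
      assume eq: "\<Union>\<C> = S"
      have "\<forall>U\<in>\<C>. \<exists>T. open T \<and> U = S \<inter> T" using A by (auto simp: A_def openin_open)
      then obtain T where T: "\<And>U. U \<in> \<C> \<Longrightarrow> open (T U) \<and> U = S \<inter> T U" by metis
      have "S \<subseteq> (\<Union>U\<in>\<C>. T U)" using eq T by blast
      then obtain F where F: "F \<subseteq> \<C>" "finite F" "S \<subseteq> (\<Union>U\<in>F. T U)"
        using compactE_image[OF compact_S, of \<C> T] T by metis
      have "F \<noteq> {}" using F(3) nontrivial_S by auto
      moreover have "subset.chain A F" using chain F(1) unfolding subset.chain_def by blast
      ultimately have "\<Union>F \<in> F" using F(2) by (intro Union_in_chain)
      then have "\<Union>F \<in> A" using F(1) A by blast
      moreover have "S \<subseteq> \<Union>F" using F(1,3) T by blast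
      ultimately show False by (auto simp: A_def dest: openin_imp_subset)
    qed
    ultimately show "\<Union>\<C> \<in> A" by (simp add: A_def)
  qed
  then obtain U where U: "U \<in> A" and max: "\<And>X. X \<in> A \<Longrightarrow> U \<subseteq> X \<Longrightarrow> X = U" by blast
  have Uo: "openin (top_of_set S) U" and Uc: "connected U" and Un: "U \<noteq> {}" "U \<noteq> S"
    using U by (auto simp: A_def)
  have "\<not> closedin (top_of_set S) U"
    using connected_S Uo Un unfolding connected_clopen by blast
  then obtain q where q: "q \<in> S" "q \<in> closure U" "q \<notin> U"
    using openin_imp_subset[OF Uo] by (metis Int_iff closedin_closed closed_closure closure_subset inf.absorb_iff2 subsetI subset_antisym)
  have "S \<subseteq> insert q U"
  proof
    fix x assume x: "x \<in> S"
    show "x \<in> insert q U"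
    proof (rule ccontr)
      assume nx: "x \<notin> insert q U"
      have "openin (top_of_set S) (S - {x})" using x by (simp add: openin_delete)
      then obtain N where N: "openin (top_of_set S) N" "connected N" "q \<in> N" "N \<subseteq> S - {x}"
        using locally_connected_S q nx unfolding locally_connected by (metis Diff_iff insertCI singletonD)
      obtain T where T: "open T" "N = S \<inter> T" using N(1) by (auto simp: openin_open)
      then have "U \<inter> T \<noteq> {}" using q N(3) by (metis IntD2 open_Int_closure_eq_empty disjoint_iff inf_commute)
      then have "U \<inter> N \<noteq> {}" using T openin_imp_subset[OF Uo] by blast
      then have "connected (U \<union> N)" using Uc N(2) by (rule connected_Un[rotated 2])
      then have "U \<union> N \<in> A" using Uo N Un x nx by (auto simp: A_def)
      then show False using max[of "U \<union> N"] N(3) q(3) by auto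
    qed
  qed
  then have "S - {q} = U" using q openin_imp_subset[OF Uo] by auto
  then show ?thesis using q Uc by auto
qed

end

section \<open>The tower over a non-cut point\<close>

text \<open>The functions separating a given pair of points are open and dense among the bounded
  continuous functions, so Baire's theorem applies.\<close>

lemma generic_perturbation:
  fixes E :: "'i \<Rightarrow> 'b::metric_space set" and f0 :: "'b \<Rightarrow> real"
  assumes "countable I" and E: "\<And>i. i \<in> I \<Longrightarrow> \<exists>x\<in>E i. \<exists>y\<in>E i. x \<noteq> y" and "0 < \<epsilon>"
  shows "\<exists>e :: 'b \<Rightarrow> real. continuous_on UNIV e \<and> (\<forall>x. \<bar>e x\<bar> \<le> \<epsilon>) \<and>
     (\<forall>i\<in>I. \<exists>x\<in>E i. \<exists>y\<in>E i. f0 x + e x \<noteq> f0 y + e y)"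
proof -
  obtain X Y where XY: "\<And>i. i \<in> I \<Longrightarrow> X i \<in> E i \<and> Y i \<in> E i \<and> X i \<noteq> Y i" using E by metis
  define O' :: "'i \<Rightarrow> ('b, real) bcontfun set" where
    "O' i = {e. apply_bcontfun e (X i) - apply_bcontfun e (Y i) \<noteq> f0 (Y i) - f0 (X i)}" for i
  have lip: "\<bar>apply_bcontfun e x - apply_bcontfun e' x\<bar> \<le> dist e e'" for e e' :: "('b, real) bcontfun" and x
    using dist_bounded[of e x e'] by (simp add: dist_real_def)
  have cont: "continuous_on UNIV (\<lambda>e :: ('b, real) bcontfun. apply_bcontfun e x)" for x
    unfolding continuous_on_iff dist_real_def using lip by (meson le_less_trans UNIV_I)
  have op: "open (O' i)" for i
    unfolding O'_def by (intro open_Collect_neq continuous_intros cont)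
  have dense: "closure (O' i) = UNIV" if i: "i \<in> I" for i
  proof -
    have "\<exists>e'\<in>O' i. dist e' e < d" if "0 < d" for e d
    proof (cases "e \<in> O' i")
      case True then show ?thesis using that by (intro bexI[of _ e]) auto
    next
      case False
      \<comment> \<open>A bump that vanishes at \<open>Y i\<close> and is positive at
        \<open>X i\<close>: where \<open>e\<close> fails to separate the pair, adding the bump
        succeeds, at a cost of at most \<open>d/2\<close> in norm.\<close>
      define b where "b x = d/2 * min 1 (dist x (Y i))" for x
      have "b \<in> bcontfun"
        by (rule bcontfun_normI[of _ "d/2"]) (use that in \<open>auto simp: b_def intro!: continuous_intros\<close>)
      then obtain b' where b': "b = apply_bcontfun b'" by (metis bcontfunE)
      have "norm b' \<le> d/2" by (rule norm_bound) (use that in \<open>auto simp: b_def simp flip: b'\<close>)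
      moreover have "0 < b (X i)" "b (Y i) = 0" using XY[OF i] that by (auto simp: b_def)
      then have "e + b' \<in> O' i"
        using False XY[OF i] that by (auto simp: O'_def plus_bcontfun.rep_eq simp flip: b')
      ultimately show ?thesis using that by (intro bexI[of _ "e + b'"]) (auto simp: dist_norm)
    qed
    then show ?thesis by (auto simp: closure_approachable)
  qed
  have "euclidean closure_of \<Inter>(O' ` I) = topspace euclidean"
    by (rule Baire_category) (use assms(1) op dense in \<open>auto simp: completely_metrizable_space_euclidean\<close>)
  then have "(0::('b, real) bcontfun) \<in> closure (\<Inter>(O' ` I))" by simp
  then obtain e where e: "e \<in> \<Inter>(O' ` I)" "dist e 0 < \<epsilon>" using \<open>0 < \<epsilon>\<close> by (auto simp: closure_approachable)
  have "\<bar>apply_bcontfun e x\<bar> \<le> \<epsilon>" for x using lip[of e x 0] e(2) by (simp add: zero_bcontfun.rep_eq)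
  moreover have "\<exists>x\<in>E i. \<exists>y\<in>E i. f0 x + apply_bcontfun e x \<noteq> f0 y + apply_bcontfun e y" if "i \<in> I" for i
    using XY[OF that] e(1) that by (intro bexI[of _ "X i"] bexI[of _ "Y i"]) (auto simp: O'_def)
  ultimately show ?thesis by (intro exI[of _ "apply_bcontfun e"]) auto
qed

lemma connected_attains:
  fixes h :: "'b::topological_space \<Rightarrow> real"
  assumes "connected C" "continuous_on C h" "x \<in> C" "y \<in> C" "h x \<le> v" "v \<le> h y"
  shows "\<exists>c\<in>C. h c = v"
proof -
  have "{h x..h y} \<subseteq> h ` C"
    using assms by (intro connected_contains_Icc connected_continuous_image) auto
  moreover have "v \<in> {h x..h y}" using assms by simp
  ultimately show ?thesis by auto
qed

section \<open>Depth, pieces and base points around the removed point\<close>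

locale punctured_peano = peano_set S for S :: "'b::metric_space set" +
  fixes p :: 'b and r :: real and D :: "'b set"
  assumes p: "p \<in> S" and connected_punctured: "connected (S - {p})"
    and r: "0 < r" and dist_p: "\<And>x. x \<in> S \<Longrightarrow> dist x p \<le> 2 * r"
    and far_point: "\<exists>x\<in>S. dist x p = 2 * r"
    and D: "countable D" "D \<subseteq> S" "S \<subseteq> closure D"
begin

text \<open>The pieces of \<open>deep n\<close> are the vertices of the tree, and \<open>piece (n - 1) z\<close> is the parent of
  \<open>piece n z\<close>. Truncated subtraction at \<open>n = 0\<close> is harmless, as \<open>deep 0\<close> and \<open>deep 1\<close> are both the
  whole of \<open>Y\<close>. Taking base points in the countable set \<open>D\<close> makes the family of paths countable.\<close>

definition Y where "Y = S - {p}"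
definition depth :: "'b \<Rightarrow> real" where "depth x = r / dist x p"
definition deep :: "nat \<Rightarrow> 'b set" where "deep n = {x \<in> Y. real n - 1 < depth x}"
definition piece :: "nat \<Rightarrow> 'b \<Rightarrow> 'b set" where "piece n x = connected_component_set (deep n) x"
definition base_pt :: "nat \<Rightarrow> 'b \<Rightarrow> 'b" where "base_pt n x = (SOME z. z \<in> D \<inter> piece n x)"
text \<open>A compact band in the parent piece: for positive \<open>n\<close> the bound
  \<open>n - 3/2\<close> lies strictly above the threshold \<open>n - 2\<close> of
  \<open>deep (n - 1)\<close>, and the upper bound keeps away from \<open>p\<close>. Between them
  fit the heights needed later, from \<open>n - 5/4\<close> up to \<open>n + 9/4\<close>, and up to
  3 when \<open>n = 0\<close>.\<close>

definition collar :: "nat \<Rightarrow> 'b \<Rightarrow> 'b set" where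
  "collar n z = {y \<in> piece (n - 1) z. real n - 3/2 \<le> depth y \<and> depth y \<le> real n + 4}"

lemma openin_Y: "openin (top_of_set S) Y"
  using p by (simp add: Y_def openin_delete)

lemma continuous_depth: "continuous_on Y depth"
  unfolding depth_def by (intro continuous_intros) (auto simp: Y_def)

text \<open>Since \<open>r\<close> is half the largest distance from \<open>p\<close>, depths start
  at 1/2; after the perturbation by 1/4 this keeps \<open>f\<close> positive.\<close>

lemma depth_ge: "1/2 \<le> depth x" if "x \<in> Y"
proof -
  have "0 < dist x p" "dist x p \<le> 2 * r" using that dist_p by (auto simp: Y_def)
  then show ?thesis using r by (simp add: depth_def field_simps)
qed

lemma depth_min: "\<exists>x\<in>Y. depth x = 1/2"
proof -
  obtain x where "x \<in> S" "dist x p = 2 * r" using far_point by blast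
  then show ?thesis using r by (intro bexI[of _ x]) (auto simp: depth_def Y_def)
qed

lemma depth_unbounded: "\<exists>x\<in>Y. b \<le> depth x"
proof -
  define e where "e = r / max b 1"
  have e: "0 < e" using r by (simp add: e_def)
  have "openin (top_of_set S) (S \<inter> ball p e)" by (simp add: openin_open_Int)
  then obtain x where x: "x \<in> S" "dist p x < e" "x \<noteq> p"
    using open_has_other_point[of "S \<inter> ball p e" p] p e by auto
  then have "max b 1 * dist x p < r" using r by (simp add: e_def field_simps dist_commute)
  then have "max b 1 \<le> depth x" using x by (simp add: depth_def pos_le_divide_eq del: max.bounded_iff)
  then show ?thesis using x by (intro bexI[of _ x]) (auto simp: Y_def)
qed

lemma deep_sub: "deep n \<subseteq> Y" by (auto simp: deep_def)

lemma deep_mono: "m \<le> n \<Longrightarrow> deep n \<subseteq> deep m" by (auto simp: deep_def)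

lemma deep_root: "n \<le> 1 \<Longrightarrow> deep n = Y"
  using depth_ge by (force simp: deep_def)

lemma openin_deep: "openin (top_of_set S) (deep n)"
proof -
  have "openin (top_of_set Y) (Y \<inter> depth -` {real n - 1<..})"
    by (rule continuous_openin_preimage_gen[OF continuous_depth]) simp
  moreover have "Y \<inter> depth -` {real n - 1<..} = deep n" by (auto simp: deep_def)
  ultimately show ?thesis using openin_Y openin_trans by metis
qed

lemma piece_sub: "piece n x \<subseteq> deep n" unfolding piece_def by (rule connected_component_subset)

lemma piece_self: "x \<in> deep n \<Longrightarrow> x \<in> piece n x" by (simp add: piece_def)

lemma connected_piece: "connected (piece n x)" unfolding piece_def by simp

lemma openin_piece: "openin (top_of_set S) (piece n x)"
proof (cases "x \<in> deep n")
  case True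
  then show ?thesis
    using locally_connected_S openin_deep unfolding locally_connected_open_connected_component piece_def by blast
next
  case False
  then have "piece n x = {}" unfolding piece_def using connected_component_eq_empty by blast
  then show ?thesis by simp
qed

lemma piece_eq: "y \<in> piece n x \<Longrightarrow> piece n y = piece n x"
  unfolding piece_def by (rule connected_component_eq)

lemma piece_mono: "m \<le> n \<Longrightarrow> piece n x \<subseteq> piece m x"
  unfolding piece_def by (rule connected_component_mono[OF deep_mono])

lemma connected_sub_piece: "connected C \<Longrightarrow> C \<subseteq> deep n \<Longrightarrow> x \<in> C \<Longrightarrow> C \<subseteq> piece n x"
  unfolding piece_def by (rule connected_component_maximal)

lemma piece_root: "n \<le> 1 \<Longrightarrow> x \<in> Y \<Longrightarrow> piece n x = Y"
  using connected_punctured connected_component_eq_self[of Y x] by (simp add: piece_def deep_root Y_def)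

lemma base_pt_mem: "base_pt n x \<in> D" "base_pt n x \<in> piece n x" if "x \<in> deep n"
proof -
  obtain T where T: "open T" "piece n x = S \<inter> T" using openin_piece[of n x] by (auto simp: openin_open)
  have "x \<in> S \<inter> T" using piece_self[OF that] T by simp
  then have "D \<inter> T \<noteq> {}" using D(3) T(1) by (metis IntD1 IntD2 disjoint_iff open_Int_closure_eq_empty subsetD inf_commute)
  then have "\<exists>z. z \<in> D \<inter> piece n x" using T(2) D(2) by blast
  then have "base_pt n x \<in> D \<inter> piece n x" unfolding base_pt_def by (rule someI_ex)
  then show "base_pt n x \<in> D" "base_pt n x \<in> piece n x" by auto
qed

lemma base_pt_eq: "y \<in> piece n x \<Longrightarrow> base_pt n y = base_pt n x"
  using piece_eq[of y n x] by (simp add: base_pt_def)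

lemma base_pt_deep: "x \<in> deep n \<Longrightarrow> base_pt n x \<in> deep n"
  using base_pt_mem(2) piece_sub by blast

text \<open>Boundary bumping: a piece staying above \<open>v\<close> would be closed in
  \<open>Y\<close>, because \<open>v\<close> exceeds the threshold of \<open>deep m\<close>; being
  open too, it would be all of \<open>Y\<close>, which contains a point of depth 1/2.\<close>

lemma piece_low:
  assumes x: "x \<in> deep m" and v: "real m - 1 < v" "1/2 \<le> v"
  shows "\<exists>y\<in>piece m x. depth y \<le> v"
proof (rule ccontr)
  assume "\<not> ?thesis"
  then have hi: "v < depth y" if "y \<in> piece m x" for y using that by force
  have "closedin (top_of_set Y) (piece m x)"
  proof -
    have "closedin (top_of_set Y) (Y \<inter> depth -` {v..})"
      by (rule continuous_closedin_preimage[OF continuous_depth]) simp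
    moreover have "closedin (top_of_set (Y \<inter> depth -` {v..})) (piece m x)"
    proof -
      have "Y \<inter> depth -` {v..} \<subseteq> deep m" using v by (auto simp: deep_def)
      moreover have "closedin (top_of_set (deep m)) (piece m x)"
        unfolding piece_def by (rule closedin_connected_component)
      moreover have "piece m x \<subseteq> Y \<inter> depth -` {v..}" using hi piece_sub deep_sub by fastforce
      ultimately show ?thesis by (meson closedin_subset_trans)
    qed
    ultimately show ?thesis by (rule closedin_trans[rotated])
  qed
  moreover have "openin (top_of_set Y) (piece m x)"
    by (rule openin_subset_trans[OF openin_piece subset_trans[OF piece_sub deep_sub]]) (auto simp: Y_def)
  moreover have "piece m x \<noteq> {}" using piece_self[OF x] by auto
  ultimately have "piece m x = Y"
    using connected_punctured unfolding Y_def[symmetric] connected_clopen by blast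
  then show False using depth_min hi v by force
qed

lemma compact_collar: "compact (collar n z)"
proof -
  define A where "A = S \<inter> {y. r \<le> (real n + 4) * dist y p} \<inter> {y. (real n - 3/2) * dist y p \<le> r}"
  have depth_le: "depth y \<le> v \<longleftrightarrow> r \<le> v * dist y p" "v \<le> depth y \<longleftrightarrow> v * dist y p \<le> r" if "y \<in> Y" for y v
  proof -
    have "0 < dist y p" using that by (simp add: Y_def)
    then show "depth y \<le> v \<longleftrightarrow> r \<le> v * dist y p" "v \<le> depth y \<longleftrightarrow> v * dist y p \<le> r"
      by (auto simp: depth_def field_simps)
  qed
  have "compact A" unfolding A_def
    by (intro compact_Int_closed compact_S closed_Collect_le continuous_intros)
  have pA: "p \<notin> A" using r by (auto simp: A_def)
  then have AY: "A \<subseteq> Y" by (auto simp: A_def Y_def)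
  have AW: "A \<subseteq> deep (n - 1)"
  proof
    fix y assume y: "y \<in> A"
    then have "real n - 3/2 \<le> depth y" using depth_le(2) AY by (auto simp: A_def)
    \<comment> \<open>Only at \<open>n = 0\<close> does the bound \<open>n - 3/2\<close> fall short,
      since \<open>n - 1\<close> truncates to 0 there; the least depth takes over.\<close>
    moreover have "1/2 \<le> depth y" using depth_ge y AY by blast
    ultimately show "y \<in> deep (n - 1)" using y AY by (cases n) (auto simp: deep_def)
  qed
  have "collar n z = A \<inter> piece (n - 1) z"
    using piece_sub deep_sub depth_le by (fastforce simp: collar_def A_def Y_def)
  moreover have "closedin (top_of_set A) (A \<inter> piece (n - 1) z)"
  proof -
    have "closedin (top_of_set (deep (n - 1))) (piece (n - 1) z)"
      unfolding piece_def by (rule closedin_connected_component)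
    then obtain C where "closed C" "piece (n - 1) z = deep (n - 1) \<inter> C" by (auto simp: closedin_closed)
    then have "A \<inter> piece (n - 1) z = A \<inter> C" using AW by blast
    then show ?thesis using \<open>closed C\<close> by (auto simp: closedin_closed)
  qed
  ultimately show ?thesis using \<open>compact A\<close> closedin_compact by metis
qed

text \<open>Three layers: \<open>c\<close> supplies the images, \<open>e\<close> makes
  \<open>f\<close> nonconstant along them, and \<open>h\<close> supplies the expansion. Composing
  with \<open>h\<close> changes neither images nor end points, because \<open>h\<close> maps the
  unit interval onto itself with \<open>h 0 = 0\<close> and \<open>h 1 = 1\<close>.\<close>

lemma tower_data_exists:
  "\<exists>f g. continuous_on Y f \<and> (\<forall>x\<in>Y. \<bar>f x - depth x\<bar> \<le> 1/4) \<and>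
    (\<forall>n z. z \<in> D \<inter> deep n \<longrightarrow> continuous_on {0..1::real} (g n z) \<and> g n z ` {0..1} \<subseteq> piece (n - 1) z \<and>
       g n z 0 = base_pt (n - 1) z \<and> g n z 1 = z \<and> collar n z \<subseteq> g n z ` {0..1} \<and>
       (\<forall>c d. 0 \<le> c \<and> c < d \<and> d \<le> 1 \<longrightarrow> g n z ` {c..d} = g n z ` {0..1} \<or>
          (\<exists>s\<in>{c..d}. \<exists>t\<in>{c..d}. 3 * (d - c) \<le> \<bar>f (g n z s) - f (g n z t)\<bar>)))"
proof -
  have "\<exists>c. z \<in> D \<inter> deep n \<longrightarrow> continuous_on {0..1::real} c \<and> c ` {0..1} \<subseteq> piece (n - 1) z \<and> collar n z \<subseteq> c ` {0..1} \<and>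
     c 0 = base_pt (n - 1) z \<and> c 1 = z \<and> (\<forall>a b. 0 \<le> a \<and> a < b \<and> b \<le> 1 \<longrightarrow> (\<exists>s\<in>{a..b}. \<exists>t\<in>{a..b}. c s \<noteq> c t))"
    for n z
  proof (cases "z \<in> D \<inter> deep n")
    case True
    then have z: "z \<in> deep (n - 1)" using deep_mono[of "n - 1" n] by auto
    have "collar n z \<subseteq> piece (n - 1) z" by (auto simp: collar_def)
    from path_through[OF openin_piece connected_piece compact_collar this base_pt_mem(2)[OF z] piece_self[OF z]]
    show ?thesis by blast
  qed auto
  then have "\<exists>c. \<forall>n z. z \<in> D \<inter> deep n \<longrightarrow> continuous_on {0..1::real} (c n z) \<and> c n z ` {0..1} \<subseteq> piece (n - 1) z \<and> collar n z \<subseteq> c n z ` {0..1} \<and>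
     c n z 0 = base_pt (n - 1) z \<and> c n z 1 = z \<and> (\<forall>a b. 0 \<le> a \<and> a < b \<and> b \<le> 1 \<longrightarrow> (\<exists>s\<in>{a..b}. \<exists>t\<in>{a..b}. c n z s \<noteq> c n z t))"
    by (intro choice allI)
  then obtain c where c: "\<And>n z. z \<in> D \<inter> deep n \<Longrightarrow> continuous_on {0..1::real} (c n z)"
      "\<And>n z. z \<in> D \<inter> deep n \<Longrightarrow> c n z ` {0..1} \<subseteq> piece (n - 1) z"
      "\<And>n z. z \<in> D \<inter> deep n \<Longrightarrow> collar n z \<subseteq> c n z ` {0..1}"
      "\<And>n z. z \<in> D \<inter> deep n \<Longrightarrow> c n z 0 = base_pt (n - 1) z"
      "\<And>n z. z \<in> D \<inter> deep n \<Longrightarrow> c n z 1 = z"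
      "\<And>n z a b. z \<in> D \<inter> deep n \<Longrightarrow> 0 \<le> a \<Longrightarrow> a < b \<Longrightarrow> b \<le> 1 \<Longrightarrow> \<exists>s\<in>{a..b}. \<exists>t\<in>{a..b}. c n z s \<noteq> c n z t"
    by (elim exE) blast
  \<comment> \<open>Rational end points keep the family countable, as Baire's theorem requires, and
    every nondegenerate interval contains one with rational ends.\<close>
  define I where "I = {(n, z, a, b). z \<in> D \<inter> deep n \<and> a \<in> \<rat> \<and> b \<in> \<rat> \<and> (0::real) \<le> a \<and> a < b \<and> b \<le> 1}"
  have "countable I"
    by (rule countable_subset[of _ "UNIV \<times> D \<times> \<rat> \<times> \<rat>"])
      (use D(1) countable_rat in \<open>auto simp: I_def\<close>)
  then have "\<exists>e. continuous_on UNIV e \<and> (\<forall>x. \<bar>e x\<bar> \<le> 1/4) \<and>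
    (\<forall>i\<in>I. \<exists>x\<in>(\<lambda>(n, z, a, b). c n z ` {a..b}) i. \<exists>y\<in>(\<lambda>(n, z, a, b). c n z ` {a..b}) i. depth x + e x \<noteq> depth y + e y)"
  proof (rule generic_perturbation)
    fix i assume "i \<in> I"
    then obtain n z a b where "i = (n, z, a, b)" "z \<in> D \<inter> deep n" "0 \<le> a" "a < b" "b \<le> 1"
      by (auto simp: I_def)
    then show "\<exists>x\<in>(\<lambda>(n, z, a, b). c n z ` {a..b}) i. \<exists>y\<in>(\<lambda>(n, z, a, b). c n z ` {a..b}) i. x \<noteq> y"
      using c(6)[of z n a b] by simp
  qed simp
  then obtain e where e: "continuous_on UNIV e" "\<And>x. \<bar>e x\<bar> \<le> 1/4"
    and e': "\<forall>i\<in>I. \<exists>x\<in>(\<lambda>(n, z, a, b). c n z ` {a..b}) i. \<exists>y\<in>(\<lambda>(n, z, a, b). c n z ` {a..b}) i. depth x + e x \<noteq> depth y + e y"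
    by (elim exE conjE) blast
  have e3: "\<exists>s\<in>{a..b}. \<exists>t\<in>{a..b}. depth (c n z s) + e (c n z s) \<noteq> depth (c n z t) + e (c n z t)"
    if "(n, z, a, b) \<in> I" for n z a b
    using bspec[OF e' that] by simp
  define f where "f x = depth x + e x" for x
  have "\<exists>h. z \<in> D \<inter> deep n \<longrightarrow> continuous_on UNIV h \<and> range h \<subseteq> {0..1::real} \<and> h (0::real) = 0 \<and> h 1 = 1 \<and>
           (\<forall>a b. 0 \<le> a \<and> a < b \<and> b \<le> 1 \<longrightarrow> h ` {a..b} = {0..1} \<or>
             (\<exists>s\<in>{a..b}. \<exists>t\<in>{a..b}. 3 * (b - a) \<le> \<bar>f (c n z (h s)) - f (c n z (h t))\<bar>))" for n z
  proof (cases "z \<in> D \<inter> deep n")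
    case True
    have "\<exists>x\<in>{a..b}. \<exists>y\<in>{a..b}. f (c n z x) \<noteq> f (c n z y)" if ab: "0 \<le> a" "a < b" "b \<le> 1" for a b
    proof -
      obtain a' where a': "a' \<in> \<rat>" "a < a'" "a' < b" using Rats_dense_in_real[OF ab(2)] by blast
      obtain b' where b': "b' \<in> \<rat>" "a' < b'" "b' < b" using Rats_dense_in_real[OF a'(3)] by blast
      have "(n, z, a', b') \<in> I" using True a' b' ab by (auto simp: I_def)
      then obtain s t where "s \<in> {a'..b'}" "t \<in> {a'..b'}" "f (c n z s) \<noteq> f (c n z t)"
        using e3 unfolding f_def by blast
      then show ?thesis using a' b' by (intro bexI[of _ s] bexI[of _ t]) auto
    qed
    from expanding_reparametrization[of "\<lambda>x. f (c n z x)", OF this] show ?thesis by blast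
  qed auto
  then have "\<exists>h. \<forall>n z. z \<in> D \<inter> deep n \<longrightarrow> continuous_on UNIV (h n z) \<and> range (h n z) \<subseteq> {0..1::real} \<and> h n z (0::real) = 0 \<and> h n z 1 = 1 \<and>
           (\<forall>a b. 0 \<le> a \<and> a < b \<and> b \<le> 1 \<longrightarrow> h n z ` {a..b} = {0..1} \<or>
             (\<exists>s\<in>{a..b}. \<exists>t\<in>{a..b}. 3 * (b - a) \<le> \<bar>f (c n z (h n z s)) - f (c n z (h n z t))\<bar>))"
    by (intro choice allI)
  then obtain h where h: "\<And>n z. z \<in> D \<inter> deep n \<Longrightarrow> continuous_on UNIV (h n z)"
     "\<And>n z. z \<in> D \<inter> deep n \<Longrightarrow> range (h n z) \<subseteq> {0..1::real}"
     "\<And>n z. z \<in> D \<inter> deep n \<Longrightarrow> h n z (0::real) = 0"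
     "\<And>n z. z \<in> D \<inter> deep n \<Longrightarrow> h n z 1 = 1"
     "\<And>n z a b. z \<in> D \<inter> deep n \<Longrightarrow> 0 \<le> a \<Longrightarrow> a < b \<Longrightarrow> b \<le> 1 \<Longrightarrow> h n z ` {a..b} = {0..1} \<or>
             (\<exists>s\<in>{a..b}. \<exists>t\<in>{a..b}. 3 * (b - a) \<le> \<bar>f (c n z (h n z s)) - f (c n z (h n z t))\<bar>)"
    by (elim exE) blast
  define g where "g n z t = c n z (h n z t)" for n z t
  have onto: "h n z ` {0..1} = {0..1}" if "z \<in> D \<inter> deep n" for n z
  proof
    show "h n z ` {0..1} \<subseteq> {0..1}" using h(2)[OF that] by auto
    have "connected (h n z ` {0..1})"
      by (intro connected_continuous_image continuous_on_subset[OF h(1)[OF that]]) auto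
    moreover have "0 \<in> h n z ` {0..1}" using h(3)[OF that] by (intro image_eqI[of _ _ 0]) auto
    moreover have "1 \<in> h n z ` {0..1}" using h(4)[OF that] by (intro image_eqI[of _ _ 1]) auto
    ultimately show "{0..1} \<subseteq> h n z ` {0..1}" by (rule connected_contains_Icc)
  qed
  have img: "g n z ` {0..1} = c n z ` {0..1}" if "z \<in> D \<inter> deep n" for n z
    using onto[OF that] by (simp add: g_def flip: image_image)
  show ?thesis
  proof (intro exI[of _ f] exI[of _ g] conjI allI impI ballI)
    show "continuous_on Y f" unfolding f_def
      by (intro continuous_intros continuous_depth continuous_on_subset[OF e(1)]) auto
    show "\<bar>f x - depth x\<bar> \<le> 1/4" for x using e(2) by (simp add: f_def)
    fix n z assume z: "z \<in> D \<inter> deep n"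
    show "continuous_on {0..1} (g n z)" unfolding g_def
      by (rule continuous_on_compose2[OF c(1)[OF z] continuous_on_subset[OF h(1)[OF z]]])
        (use h(2)[OF z] in auto)
    show "g n z ` {0..1} \<subseteq> piece (n - 1) z" "collar n z \<subseteq> g n z ` {0..1}"
      using img[OF z] c(2,3)[OF z] by auto
    show "g n z 0 = base_pt (n - 1) z" "g n z 1 = z"
      using h(3,4)[OF z] c(4,5)[OF z] by (auto simp: g_def)
    fix a b :: real assume ab: "0 \<le> a \<and> a < b \<and> b \<le> 1"
    show "g n z ` {a..b} = g n z ` {0..1} \<or>
      (\<exists>s\<in>{a..b}. \<exists>t\<in>{a..b}. 3 * (b - a) \<le> \<bar>f (g n z s) - f (g n z t)\<bar>)"
      using h(5)[OF z, of a b] ab img[OF z] unfolding g_def by (auto simp flip: image_image)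
  qed
qed

end

section \<open>Local gluing of continuous maps, and crossings of a band\<close>

lemma continuous_on_locally:
  fixes h :: "'b::metric_space \<Rightarrow> 'c::metric_space"
  assumes "\<And>x. x \<in> A \<Longrightarrow> \<exists>U. openin (top_of_set A) U \<and> x \<in> U \<and> continuous_on U h"
  shows "continuous_on A h"
  unfolding continuous_on_iff
proof (intro ballI allI impI)
  fix x and e :: real assume x: "x \<in> A" and e: "0 < e"
  obtain U where U: "openin (top_of_set A) U" "x \<in> U" "continuous_on U h" using assms[OF x] by blast
  obtain d where d: "0 < d" "ball x d \<inter> A \<subseteq> U" using U(1,2) by (meson openin_contains_ball)
  obtain d' where d': "0 < d'" "\<And>y. y \<in> U \<Longrightarrow> dist y x < d' \<Longrightarrow> dist (h y) (h x) < e"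
    using U(2,3) e unfolding continuous_on_iff by blast
  have "dist (h y) (h x) < e" if "y \<in> A" "dist y x < min d d'" for y
  proof (rule d'(2))
    show "y \<in> U" using that d(2) by (auto simp: dist_commute)
  qed (use that in simp)
  then show "\<exists>d>0. \<forall>y\<in>A. dist y x < d \<longrightarrow> dist (h y) (h x) < e"
    using d(1) d'(1) by (intro exI[of _ "min d d'"]) auto
qed

text \<open>Take \<alpha> as the last time at height at most \<open>c\<close> and \<beta> as the
  first time after it at height at least \<open>d\<close>. The bound below by \<open>c\<close> holds
  up to \<open>t\<close>, even beyond \<beta>, so that the piece containing the crossing can later
  be read off at \<open>t\<close>.\<close>

lemma subinterval_upcrossing:
  fixes u :: "real \<Rightarrow> real"
  assumes cont: "continuous_on {s..t} u" and st: "s \<le> t" "u s \<le> c" "d \<le> u t" "c < d"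
  shows "\<exists>\<alpha> \<beta>. s \<le> \<alpha> \<and> \<alpha> \<le> \<beta> \<and> \<beta> \<le> t \<and> u ` {\<alpha>..\<beta>} = {c..d} \<and> (\<forall>x\<in>{\<alpha>..t}. c \<le> u x)"
proof -
  define A where "A = {x \<in> {s..t}. u x \<le> c}"
  have "compact A"
  proof -
    have "closedin (top_of_set {s..t}) ({s..t} \<inter> u -` {..c})"
      by (rule continuous_closedin_preimage[OF cont]) simp
    moreover have "{s..t} \<inter> u -` {..c} = A" by (auto simp: A_def)
    ultimately show ?thesis using closedin_compact compact_Icc by metis
  qed
  moreover have "s \<in> A" using st by (simp add: A_def)
  ultimately obtain \<alpha> where \<alpha>: "\<alpha> \<in> A" "\<And>x. x \<in> A \<Longrightarrow> x \<le> \<alpha>"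
    using compact_attains_sup[of A] by blast
  have \<alpha>': "s \<le> \<alpha>" "\<alpha> \<le> t" "u \<alpha> \<le> c" using \<alpha>(1) by (auto simp: A_def)
  have above: "c < u x" if "\<alpha> < x" "x \<le> t" for x
    using \<alpha>(2)[of x] that \<alpha>' by (force simp: A_def)
  obtain x where x: "\<alpha> \<le> x" "x \<le> t" "u x = c"
    using IVT'[of u \<alpha> c t] \<alpha>' st continuous_on_subset[OF cont] by (auto simp: subset_iff)
  then have u\<alpha>: "u \<alpha> = c" using above[of x] by (cases "\<alpha> = x") auto
  define B where "B = {x \<in> {\<alpha>..t}. d \<le> u x}"
  have cont': "continuous_on {\<alpha>..t} u" using cont by (rule continuous_on_subset) (use \<alpha>' in auto)
  have "compact B"
  proof -
    have "closedin (top_of_set {\<alpha>..t}) ({\<alpha>..t} \<inter> u -` {d..})"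
      by (rule continuous_closedin_preimage[OF cont']) simp
    moreover have "{\<alpha>..t} \<inter> u -` {d..} = B" by (auto simp: B_def)
    ultimately show ?thesis using closedin_compact compact_Icc by metis
  qed
  moreover have "t \<in> B" using st \<alpha>' by (simp add: B_def)
  ultimately obtain \<beta> where \<beta>: "\<beta> \<in> B" "\<And>x. x \<in> B \<Longrightarrow> \<beta> \<le> x"
    using compact_attains_inf[of B] by blast
  have \<beta>': "\<alpha> \<le> \<beta>" "\<beta> \<le> t" "d \<le> u \<beta>" using \<beta>(1) by (auto simp: B_def)
  have below: "u x < d" if "\<alpha> \<le> x" "x < \<beta>" for x
    using \<beta>(2)[of x] that \<beta>' by (force simp: B_def)
  have cont'': "continuous_on {\<alpha>..\<beta>} u" using cont' by (rule continuous_on_subset) (use \<beta>' in auto)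
  obtain y where y: "\<alpha> \<le> y" "y \<le> \<beta>" "u y = d"
    using IVT'[of u \<alpha> d \<beta>] \<beta>' u\<alpha> st cont'' by auto
  then have u\<beta>: "u \<beta> = d" using below[of y] by (cases "\<beta> = y") auto
  have "u ` {\<alpha>..\<beta>} = {c..d}"
  proof
    show "u ` {\<alpha>..\<beta>} \<subseteq> {c..d}"
    proof clarify
      fix x assume "x \<in> {\<alpha>..\<beta>}"
      then show "u x \<in> {c..d}" using above[of x] below[of x] \<beta>' u\<alpha> u\<beta> st
        by (cases "x = \<alpha>"; cases "x = \<beta>") auto
    qed
    show "{c..d} \<subseteq> u ` {\<alpha>..\<beta>}"
      by (rule connected_contains_Icc[OF connected_continuous_image[OF cont'']])
        (use \<beta>' u\<alpha> u\<beta> in \<open>auto intro: image_eqI[of _ _ \<alpha>] image_eqI[of _ _ \<beta>]\<close>)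
  qed
  moreover have "c \<le> u x" if "x \<in> {\<alpha>..t}" for x
    using above[of x] u\<alpha> that by (cases "x = \<alpha>") auto
  ultimately show ?thesis using \<alpha>' \<beta>' by blast
qed

text \<open>A descending crossing is an ascending one run backwards, hence the substitution
  \<open>- x\<close>. The interval \<open>{l..r}\<close> joins the crossing to \<open>t\<close>
  without going below \<open>c\<close>.\<close>

lemma subinterval_crossing:
  fixes u :: "real \<Rightarrow> real"
  assumes cont: "continuous_on {a..b} u" and st: "s \<in> {a..b}" "t \<in> {a..b}" "u s \<le> c" "d \<le> u t" "c < d"
  shows "\<exists>\<alpha> \<beta> l r. a \<le> l \<and> l \<le> \<alpha> \<and> \<alpha> \<le> \<beta> \<and> \<beta> \<le> r \<and> r \<le> b \<and> l \<le> t \<and> t \<le> r \<and>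
           u ` {\<alpha>..\<beta>} = {c..d} \<and> (\<forall>x\<in>{l..r}. c \<le> u x)"
proof (cases "s \<le> t")
  case True
  have "continuous_on {s..t} u" using cont by (rule continuous_on_subset) (use st in auto)
  from subinterval_upcrossing[OF this True st(3-5)] obtain \<alpha> \<beta>
    where "s \<le> \<alpha>" "\<alpha> \<le> \<beta>" "\<beta> \<le> t" "u ` {\<alpha>..\<beta>} = {c..d}" "\<forall>x\<in>{\<alpha>..t}. c \<le> u x" by blast
  then show ?thesis using st by (intro exI[of _ \<alpha>] exI[of _ \<beta>] exI[of _ \<alpha>] exI[of _ t]) auto
next
  case False
  define v where "v x = u (- x)" for x
  have "continuous_on {- s..- t} v" unfolding v_def
    by (rule continuous_on_compose2[OF cont]) (use st in \<open>auto intro!: continuous_intros\<close>)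
  from subinterval_upcrossing[OF this, of c d] obtain \<alpha> \<beta>
    where ab: "- s \<le> \<alpha>" "\<alpha> \<le> \<beta>" "\<beta> \<le> - t" "v ` {\<alpha>..\<beta>} = {c..d}" "\<forall>x\<in>{\<alpha>..- t}. c \<le> v x"
    using st False by (auto simp: v_def)
  have "u ` {- \<beta>..- \<alpha>} = v ` {\<alpha>..\<beta>}"
  proof -
    have eq: "{- \<beta>..- \<alpha>} = uminus ` {\<alpha>..\<beta>}" by simp
    show ?thesis unfolding eq image_image v_def ..
  qed
  moreover have "c \<le> u x" if "x \<in> {t..- \<alpha>}" for x
    using ab(5)[rule_format, of "- x"] that by (auto simp: v_def)
  moreover have "a \<le> t" "t \<le> - \<beta>" "- \<beta> \<le> - \<alpha>" "- \<alpha> \<le> b" using ab(1-3) st by auto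
  ultimately show ?thesis using ab(4)
    by (intro exI[of _ "- \<beta>"] exI[of _ "- \<alpha>"] exI[of _ t] exI[of _ "- \<alpha>"]) simp
qed

section \<open>The map \<open>T\<close> and its continuity\<close>

locale tower = punctured_peano S p r D for S :: "'b::metric_space set" and p r D +
  fixes f :: "'b \<Rightarrow> real" and g :: "nat \<Rightarrow> 'b \<Rightarrow> real \<Rightarrow> 'b"
  assumes continuous_f: "continuous_on Y f" and f_near: "\<And>x. x \<in> Y \<Longrightarrow> \<bar>f x - depth x\<bar> \<le> 1/4"
    and continuous_g: "\<And>n z. z \<in> D \<inter> deep n \<Longrightarrow> continuous_on {0..1} (g n z)"
    and g_piece: "\<And>n z. z \<in> D \<inter> deep n \<Longrightarrow> g n z ` {0..1} \<subseteq> piece (n - 1) z"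
    and g_0: "\<And>n z. z \<in> D \<inter> deep n \<Longrightarrow> g n z 0 = base_pt (n - 1) z"
    and g_1: "\<And>n z. z \<in> D \<inter> deep n \<Longrightarrow> g n z 1 = z"
    and g_covers: "\<And>n z. z \<in> D \<inter> deep n \<Longrightarrow> collar n z \<subseteq> g n z ` {0..1}"
    and g_expands: "\<And>n z c d. z \<in> D \<inter> deep n \<Longrightarrow> 0 \<le> c \<Longrightarrow> c < d \<Longrightarrow> d \<le> 1 \<Longrightarrow>
       g n z ` {c..d} = g n z ` {0..1} \<or>
       (\<exists>s\<in>{c..d}. \<exists>t\<in>{c..d}. 3 * (d - c) \<le> \<bar>f (g n z s) - f (g n z t)\<bar>)"
begin

definition T :: "'b \<Rightarrow> 'b" where
  "T x = (if x = p then p else let n = nat \<lfloor>f x\<rfloor> in g n (base_pt n x) (f x - n))"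

lemma f_pos: "1/4 \<le> f x" if "x \<in> Y"
  using depth_ge[OF that] f_near[OF that] by linarith

lemma f_le: "f x \<le> depth x + 1/4" and f_ge: "depth x - 1/4 \<le> f x" if "x \<in> Y"
  using f_near[OF that] by linarith+

lemma f_deep: "x \<in> deep n" if "x \<in> Y" "real n \<le> f x"
  using that f_le[OF that(1)] by (simp add: deep_def)

lemma base_pt_idx: "base_pt n x \<in> D \<inter> deep n" if "x \<in> deep n"
  using base_pt_mem(1)[OF that] base_pt_deep[OF that] by blast

lemma g_deep: "g n z t \<in> deep (n - 1)" "g n z t \<in> Y" if "z \<in> D \<inter> deep n" "t \<in> {0..1}"
  using g_piece[OF that(1)] piece_sub deep_sub that(2) by blast+

text \<open>At an integer height the two neighbouring formulas agree: the path of a child piece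
  starts at the base point of its parent, which is where the path of the parent ends. This permits
  closed strips in the arguments on continuity and on crossings.\<close>

lemma T_eq: "T x = g n (base_pt n x) (f x - n)" if x: "x \<in> Y" and n: "real n \<le> f x" "f x \<le> real n + 1"
proof (cases "f x = real n + 1")
  case False
  then have "\<lfloor>f x\<rfloor> = int n" using n by (simp add: floor_eq_iff)
  then have "nat \<lfloor>f x\<rfloor> = n" by simp
  then show ?thesis using x by (simp add: T_def Y_def)
next
  case True
  then have "f x = real (Suc n)" by simp
  then have "nat \<lfloor>f x\<rfloor> = Suc n" by (simp only: floor_of_nat nat_int)
  then have "T x = g (Suc n) (base_pt (Suc n) x) 0" using x True by (simp add: T_def Y_def)
  also have "\<dots> = base_pt n (base_pt (Suc n) x)"
    using g_0[OF base_pt_idx[OF f_deep[OF x, of "Suc n"]]] True by simp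
  also have "\<dots> = base_pt n x"
    using base_pt_eq base_pt_mem(2)[OF f_deep[OF x, of "Suc n"]] piece_mono[of n "Suc n" x] True by auto
  also have "\<dots> = g n (base_pt n x) (f x - n)"
    using g_1[OF base_pt_idx[OF f_deep[OF x n(1)]]] True by simp
  finally show ?thesis .
qed

lemma level_exists: "\<exists>n. real n \<le> f x \<and> f x < real n + 1" if "x \<in> Y"
  using f_pos[OF that] by (intro exI[of _ "nat \<lfloor>f x\<rfloor>"]) linarith

lemma T_deep: "T x \<in> deep (n - 1)" if "x \<in> Y" "real n \<le> f x" "f x \<le> real n + 1"
  unfolding T_eq[OF that] by (rule g_deep(1)[OF base_pt_idx[OF f_deep[OF that(1,2)]]]) (use that in auto)

lemma T_Y: "T x \<in> Y" if "x \<in> Y"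
  using level_exists[OF that] T_deep[OF that] deep_sub by (meson less_imp_le subsetD)

lemma T_p: "T p = p" by (simp add: T_def)

lemma T_S: "T x \<in> S" if "x \<in> S"
  using T_Y[of x] that T_p by (cases "x = p") (auto simp: Y_def)

text \<open>The base point is constant on the open set \<open>piece n x\<close>, so near
  \<open>x\<close> the map is one fixed path composed with \<open>f\<close>.\<close>

lemma continuous_T_strip: "continuous_on {x \<in> Y. real n \<le> f x \<and> f x \<le> real n + 1} T" (is "continuous_on ?A T")
proof (rule continuous_on_locally)
  fix x assume x: "x \<in> ?A"
  then have xW: "x \<in> deep n" using f_deep by blast
  have AY: "?A \<subseteq> Y" by auto
  let ?U = "?A \<inter> piece n x"
  have "openin (top_of_set ?A) ?U"
  proof -
    obtain C where "open C" "piece n x = S \<inter> C" using openin_piece[of n x] by (auto simp: openin_open)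
    then have "?U = ?A \<inter> C" by (auto simp: Y_def)
    then show ?thesis using \<open>open C\<close> by (auto simp: openin_open)
  qed
  moreover have "x \<in> ?U" using x piece_self[OF xW] by blast
  moreover have "continuous_on ?U T"
  proof -
    have "continuous_on ?U (\<lambda>y. g n (base_pt n x) (f y - n))"
      by (rule continuous_on_compose2[OF continuous_g[OF base_pt_idx[OF xW]]])
        (auto intro!: continuous_intros continuous_on_subset[OF continuous_f])
    moreover have "g n (base_pt n x) (f y - n) = T y" if "y \<in> ?U" for y
      using T_eq[of y n] base_pt_eq[of y n x] that by auto
    ultimately show ?thesis by (rule continuous_on_eq) simp
  qed
  ultimately show "\<exists>U. openin (top_of_set ?A) U \<and> x \<in> U \<and> continuous_on U T" by blast
qed

lemma continuous_T_Y: "continuous_on Y T"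
proof (rule continuous_on_locally)
  fix x assume x: "x \<in> Y"
  \<comment> \<open>An open band of height 2 around \<open>f x\<close> meets only two closed strips;
    when \<open>f x < 1\<close> the choice \<open>m = 0\<close> works because \<open>f\<close> is
    positive.\<close>
  obtain m where m: "real m < f x" "f x < real m + 2"
  proof -
    obtain n where n: "real n \<le> f x" "f x < real n + 1" using level_exists[OF x] by blast
    show thesis
      using that[of "n - 1"] n f_pos[OF x] by (cases n) auto
  qed
  define U where "U = {y \<in> Y. real m < f y \<and> f y < real m + 2}"
  define A where "A = {y \<in> U. f y \<le> real m + 1}"
  define B where "B = {y \<in> U. real m + 1 \<le> f y}"
  have "openin (top_of_set Y) (Y \<inter> f -` {real m<..<real m + 2})"
    by (rule continuous_openin_preimage_gen[OF continuous_f]) simp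
  moreover have "Y \<inter> f -` {real m<..<real m + 2} = U" by (auto simp: U_def)
  ultimately have 1: "openin (top_of_set Y) U" by simp
  have UAB: "A \<union> B = U" by (auto simp: A_def B_def)
  have fU: "continuous_on U f" by (rule continuous_on_subset[OF continuous_f]) (auto simp: U_def)
  have "closedin (top_of_set U) (U \<inter> f -` {..real m + 1})" "closedin (top_of_set U) (U \<inter> f -` {real m + 1..})"
    by (rule continuous_closedin_preimage[OF fU], simp)+
  moreover have "U \<inter> f -` {..real m + 1} = A" "U \<inter> f -` {real m + 1..} = B" by (auto simp: A_def B_def)
  ultimately have cl: "closedin (top_of_set (A \<union> B)) A" "closedin (top_of_set (A \<union> B)) B"
    by (simp_all add: UAB)
  have "continuous_on A T"
    by (rule continuous_on_subset[OF continuous_T_strip[of m]]) (auto simp: A_def U_def)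
  moreover have "continuous_on B T"
    by (rule continuous_on_subset[OF continuous_T_strip[of "Suc m"]]) (auto simp: B_def U_def)
  ultimately have "continuous_on (A \<union> B) T" using cl by (intro continuous_on_Un_local)
  then have "continuous_on U T" using UAB by simp
  then show "\<exists>U. openin (top_of_set Y) U \<and> x \<in> U \<and> continuous_on U T"
    using 1 x m by (intro exI[of _ U]) (simp add: U_def)
qed

lemma continuous_T: "continuous_on S T"
proof -
  have near_p: "\<exists>d>0. \<forall>y\<in>S. dist y p < d \<longrightarrow> dist (T y) p < e" if e: "0 < e" for e
  proof -
    \<comment> \<open>The slack 4 covers the loss of depth under \<open>T\<close>: 1/4 from
      \<open>f\<close>, less than 1 from rounding down, and 2 from the threshold of
      \<open>deep (n - 1)\<close>.\<close>
    define d where "d = r / (r / e + 4)"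
    have re: "0 < r / e" using r e by simp
    have d: "0 < d" using r re by (simp add: d_def)
    have "dist (T y) p < e" if y: "y \<in> S" "dist y p < d" for y
    proof (cases "y = p")
      case True then show ?thesis using e T_p by simp
    next
      case False
      then have yY: "y \<in> Y" and y0: "0 < dist y p" using y by (auto simp: Y_def)
      have "(r / e + 4) * dist y p < r" using y(2) re by (simp add: d_def field_simps)
      then have "r / e + 4 < depth y" using y0 by (simp add: depth_def pos_less_divide_eq)
      moreover obtain n where n: "real n \<le> f y" "f y < real n + 1" using level_exists[OF yY] by blast
      ultimately have "r / e < real (n - 1) - 1" using f_ge[OF yY] by linarith
      moreover have "T y \<in> deep (n - 1)" using T_deep[OF yY n(1)] n(2) by simp
      ultimately have "r / e < r / dist (T y) p" "T y \<in> Y" by (auto simp: deep_def depth_def)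
      then show ?thesis using r e by (auto simp: Y_def field_simps)
    qed
    then show ?thesis using d by blast
  qed
  have near_Y: "\<exists>d>0. \<forall>y\<in>S. dist y x < d \<longrightarrow> dist (T y) (T x) < e" if x: "x \<in> Y" and e: "0 < e" for x e
  proof -
    obtain d where d: "0 < d" "ball x d \<inter> S \<subseteq> Y" using openin_Y x by (meson openin_contains_ball)
    obtain d' where d': "0 < d'" "\<forall>y\<in>Y. dist y x < d' \<longrightarrow> dist (T y) (T x) < e"
      using continuous_T_Y x e unfolding continuous_on_iff by blast
    have "y \<in> Y" if "y \<in> S" "dist y x < d" for y using d(2) that by (auto simp: dist_commute)
    then show ?thesis using d(1) d' by (intro exI[of _ "min d d'"]) auto
  qed
  show ?thesis unfolding continuous_on_iff
  proof (intro ballI allI impI)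
    fix x and e :: real assume "x \<in> S" "0 < e"
    then show "\<exists>d>0. \<forall>y\<in>S. dist y x < d \<longrightarrow> dist (T y) (T x) < e"
      using near_p near_Y[of x] T_p by (cases "x = p") (auto simp: Y_def)
  qed
qed

end

section \<open>Crossing and covering\<close>

context tower begin

text \<open>A piece that is active but not \<open>live\<close> is a dead end: it is entered from below but no path
  crosses it. Every point is on the path of a live piece.\<close>

definition active :: "nat \<Rightarrow> 'b \<Rightarrow> bool" where
  "active n z \<longleftrightarrow> z \<in> D \<inter> deep n \<and> base_pt n z = z \<and> (\<exists>x\<in>piece n z. real n \<le> f x)"

definition live :: "nat \<Rightarrow> 'b \<Rightarrow> bool" where
  "live n z \<longleftrightarrow> active n z \<and> (\<exists>x\<in>piece n z. real n + 1 \<le> f x)"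

text \<open>The constant base point makes \<open>T\<close> along the crossing equal to the single
  path \<open>g n z\<close>, run at the parameter \<open>f - n\<close>, which sweeps all of
  \<open>{0..1}\<close>.\<close>

definition crosses :: "(real \<Rightarrow> 'b) \<Rightarrow> real \<Rightarrow> real \<Rightarrow> nat \<Rightarrow> 'b \<Rightarrow> bool" where
  "crosses \<gamma> a b n z \<longleftrightarrow> (\<exists>a' b'. a \<le> a' \<and> a' \<le> b' \<and> b' \<le> b \<and> continuous_on {a'..b'} \<gamma> \<and> \<gamma> ` {a'..b'} \<subseteq> Y \<and>
     (\<forall>s\<in>{a'..b'}. base_pt n (\<gamma> s) = z) \<and> (\<lambda>s. f (\<gamma> s)) ` {a'..b'} = {real n..real n + 1})"

definition root :: 'b where "root = (SOME z. z \<in> D \<inter> Y)"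

lemma base_pt_piece: "piece n (base_pt n x) = piece n x" if "x \<in> deep n"
  by (rule piece_eq[OF base_pt_mem(2)[OF that]])

lemma active_base_pt:
  assumes x: "x \<in> deep n" and y: "y \<in> piece n x" "real n \<le> f y"
  shows "active n (base_pt n x)"
  unfolding active_def using base_pt_idx[OF x] base_pt_eq[OF base_pt_mem(2)[OF x]] base_pt_piece[OF x] y by auto

lemma active_base_pt_self: "x \<in> Y \<Longrightarrow> real n \<le> f x \<Longrightarrow> active n (base_pt n x)"
  using active_base_pt[OF f_deep piece_self[OF f_deep]] by blast

lemma live_base_pt:
  assumes x: "x \<in> deep n" and y: "y \<in> piece n x" "real n + 1 \<le> f y"
  shows "live n (base_pt n x)"
  unfolding live_def using active_base_pt[OF x y(1)] base_pt_piece[OF x] y by auto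

lemma active_idx: "active n z \<Longrightarrow> z \<in> D \<inter> deep n" by (simp add: active_def)

lemma base_pt_root: "base_pt n x = root" if "n \<le> 1" "x \<in> Y"
  using piece_root[OF that] by (simp add: base_pt_def root_def)

lemma piece_Y: "piece n x \<subseteq> Y" using piece_sub deep_sub by blast

text \<open>Level 0 cannot be crossed, since \<open>f\<close> is at least 1/4, so descent has to
  stop at level 1; hence \<open>max 1 (n - 1)\<close>. For larger \<open>n\<close> the low point
  exists because the parent piece reaches down towards its own threshold.\<close>

lemma collar_span:
  assumes "active n z"
  shows "\<exists>y\<in>collar n z. \<exists>y'\<in>collar n z. f y \<le> real (max 1 (n - 1)) \<and> real (max 1 (n - 1)) + 1 \<le> f y'"
proof (cases "n \<le> 1")
  case True
  have z: "z \<in> Y" using assms deep_sub by (auto simp: active_def)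
  have C: "piece (n - 1) z = Y" using True z by (intro piece_root) auto
  obtain y where y: "y \<in> Y" "depth y = 1/2" using depth_min by blast
  obtain x where x: "x \<in> Y" "3 \<le> depth x" using depth_unbounded by blast
  have "connected Y" using connected_punctured by (simp add: Y_def)
  then obtain y' where y': "y' \<in> Y" "depth y' = 3"
    using connected_attains[OF _ continuous_depth y(1) x(1), of 3] y x by auto
  have "y \<in> collar n z" "y' \<in> collar n z" using True y y' C by (auto simp: collar_def)
  moreover have "f y \<le> 1" "2 \<le> f y'" using f_le[OF y(1)] f_ge[OF y'(1)] y y' by auto
  moreover have "max 1 (n - 1) = 1" using True by simp
  ultimately show ?thesis by (intro bexI[of _ y] bexI[of _ y']) simp_all
next
  case False
  then have n: "2 \<le> n" by simp
  then have rn: "real (n - 1) = real n - 1" by simp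
  have zn: "z \<in> deep n" and "z \<in> deep (n - 1)" using assms deep_mono[of "n - 1" n] by (auto simp: active_def)
  \<comment> \<open>The height \<open>n - 5/4\<close> is above the threshold \<open>n - 2\<close> of
    the parent and, with the error 1/4 added, at most \<open>n - 1\<close>.\<close>
  have "\<exists>y\<in>piece (n - 1) z. depth y \<le> real n - 5/4"
    by (rule piece_low[OF \<open>z \<in> deep (n - 1)\<close>]) (use n in auto)
  then obtain y1 where y1: "y1 \<in> piece (n - 1) z" "depth y1 \<le> real n - 5/4" by blast
  obtain x where x: "x \<in> piece (n - 1) z" "real n \<le> f x"
    using assms piece_mono[of "n - 1" n z] by (auto simp: active_def)
  have xY: "x \<in> Y" "y1 \<in> Y" using x y1 piece_Y by blast+
  have "real n - 5/4 \<le> depth x" using f_le[OF xY(1)] x by linarith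
  then obtain y where y: "y \<in> piece (n - 1) z" "depth y = real n - 5/4"
    using connected_attains[OF connected_piece continuous_on_subset[OF continuous_depth piece_Y] y1(1) x(1)] y1 by blast
  have yY: "y \<in> Y" using y piece_Y by blast
  have fy: "f y \<le> real n - 1" using f_le[OF yY] y by simp
  then obtain y' where y': "y' \<in> piece (n - 1) z" "f y' = real n"
    using connected_attains[OF connected_piece continuous_on_subset[OF continuous_f piece_Y] y(1) x(1), of "real n"] x by auto
  have yY': "y' \<in> Y" using y' piece_Y by blast
  have "y \<in> collar n z" "y' \<in> collar n z" using y y' f_le[OF yY'] f_ge[OF yY'] by (auto simp: collar_def)
  moreover have "max 1 (n - 1) = n - 1" using n by simp
  ultimately show ?thesis using fy y' rn by (intro bexI[of _ y] bexI[of _ y']) simp_all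
qed

section \<open>Crossings and how the map propagates them\<close>

lemma crossesI:
  assumes cont: "continuous_on {a..b} \<gamma>" and Y: "\<gamma> ` {a..b} \<subseteq> Y"
    and st: "s \<in> {a..b}" "t \<in> {a..b}" and ft: "f (\<gamma> s) \<le> real n" "real n + 1 \<le> f (\<gamma> t)"
  shows "crosses \<gamma> a b n (base_pt n (\<gamma> t))"
proof -
  have fc: "continuous_on {a..b} (\<lambda>s. f (\<gamma> s))"
    by (rule continuous_on_compose2[OF continuous_f cont Y])
  \<comment> \<open>All of \<open>{l..r'}\<close> stays at height at least \<open>n\<close>, hence
    in one piece; as it contains \<open>t\<close>, the base point of the crossing is that of the
    chosen high point.\<close>
  obtain \<alpha> \<beta> l r' where i: "a \<le> l" "l \<le> \<alpha>" "\<alpha> \<le> \<beta>" "\<beta> \<le> r'" "r' \<le> b" "l \<le> t" "t \<le> r'"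
      "(\<lambda>s. f (\<gamma> s)) ` {\<alpha>..\<beta>} = {real n..real n + 1}" "\<forall>x\<in>{l..r'}. real n \<le> f (\<gamma> x)"
    using subinterval_crossing[OF fc st ft] by auto
  have "\<gamma> ` {l..r'} \<subseteq> deep n"
    using i Y by (auto intro!: f_deep)
  moreover have "connected (\<gamma> ` {l..r'})"
    by (rule connected_continuous_image[OF continuous_on_subset[OF cont]]) (use i in auto)
  moreover have "\<gamma> t \<in> \<gamma> ` {l..r'}" using i by auto
  ultimately have "\<gamma> ` {l..r'} \<subseteq> piece n (\<gamma> t)" by (intro connected_sub_piece)
  then have "base_pt n (\<gamma> s) = base_pt n (\<gamma> t)" if "s \<in> {\<alpha>..\<beta>}" for s
    using that i by (intro base_pt_eq) auto
  moreover have "continuous_on {\<alpha>..\<beta>} \<gamma>" by (rule continuous_on_subset[OF cont]) (use i in auto)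
  moreover have "\<gamma> ` {\<alpha>..\<beta>} \<subseteq> Y" using Y i by auto
  ultimately show ?thesis unfolding crosses_def using i
    by (intro exI[of _ \<alpha>] exI[of _ \<beta>]) auto
qed

lemma crosses_active: "crosses \<gamma> a b n z \<Longrightarrow> active n z"
proof -
  assume "crosses \<gamma> a b n z"
  then obtain a' b' where c: "a' \<le> b'" "\<gamma> ` {a'..b'} \<subseteq> Y" "\<forall>s\<in>{a'..b'}. base_pt n (\<gamma> s) = z"
     "(\<lambda>s. f (\<gamma> s)) ` {a'..b'} = {real n..real n + 1}" unfolding crosses_def by blast
  have "f (\<gamma> a') \<in> {real n..real n + 1}" using c(1,4) by auto
  moreover have "\<gamma> a' \<in> Y" "base_pt n (\<gamma> a') = z" using c by auto
  ultimately show ?thesis using active_base_pt_self[of "\<gamma> a'" n] by auto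
qed

lemma crosses_follow:
  assumes "crosses \<gamma> a b n z"
  obtains a' b' where "a \<le> a'" "a' \<le> b'" "b' \<le> b" "continuous_on {a'..b'} (\<lambda>s. f (\<gamma> s) - n)"
    "(\<lambda>s. f (\<gamma> s) - n) ` {a'..b'} = {0..1}" "\<And>s. s \<in> {a'..b'} \<Longrightarrow> T (\<gamma> s) = g n z (f (\<gamma> s) - n)"
proof -
  obtain a' b' where c: "a \<le> a'" "a' \<le> b'" "b' \<le> b" "continuous_on {a'..b'} \<gamma>" "\<gamma> ` {a'..b'} \<subseteq> Y"
     "\<forall>s\<in>{a'..b'}. base_pt n (\<gamma> s) = z" "(\<lambda>s. f (\<gamma> s)) ` {a'..b'} = {real n..real n + 1}"
    using assms unfolding crosses_def by blast
  have "continuous_on {a'..b'} (\<lambda>s. f (\<gamma> s) - n)"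
    by (intro continuous_intros continuous_on_compose2[OF continuous_f c(4) c(5)])
  moreover have "(\<lambda>s. f (\<gamma> s) - n) ` {a'..b'} = {0..1}"
  proof -
    have "(\<lambda>s. f (\<gamma> s) - n) ` {a'..b'} = (\<lambda>y. y - real n) ` {real n..real n + 1}"
      unfolding c(7)[symmetric] image_image ..
    then show ?thesis by simp
  qed
  moreover have "T (\<gamma> s) = g n z (f (\<gamma> s) - n)" if "s \<in> {a'..b'}" for s
  proof -
    have "f (\<gamma> s) \<in> {real n..real n + 1}" using that c(7) by blast
    moreover have "\<gamma> s \<in> Y" "base_pt n (\<gamma> s) = z" using that c(5,6) by blast+
    ultimately show ?thesis using T_eq[of "\<gamma> s" n] by simp
  qed
  ultimately show thesis using that c(1-3) by blast
qed

lemma crosses_image: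
  assumes "crosses \<gamma> a b n z"
  shows "g n z ` {0..1} \<subseteq> (\<lambda>s. T (\<gamma> s)) ` {a..b}"
proof -
  obtain a' b' where c: "a \<le> a'" "b' \<le> b" "(\<lambda>s. f (\<gamma> s) - n) ` {a'..b'} = {0..1}"
     "\<And>s. s \<in> {a'..b'} \<Longrightarrow> T (\<gamma> s) = g n z (f (\<gamma> s) - n)"
    using crosses_follow[OF assms] by metis
  show ?thesis
  proof clarify
    fix u :: real assume "u \<in> {0..1}"
    then have "u \<in> (\<lambda>s. f (\<gamma> s) - n) ` {a'..b'}" using c(3) by simp
    then obtain s where "s \<in> {a'..b'}" "u = f (\<gamma> s) - n" by blast
    then show "g n z u \<in> (\<lambda>s. T (\<gamma> s)) ` {a..b}" using c(1,2,4)
      by (intro image_eqI[of _ _ s]) auto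
  qed
qed

text \<open>A covering relation for paths: along the crossing \<open>T\<close> follows
  \<open>g n z\<close>, so a subinterval on which the parameter \<open>f - n\<close> runs over
  exactly the crossing part of \<open>g n z\<close> carries the new crossing.\<close>

lemma crosses_step:
  assumes c: "crosses \<gamma> a b n z" and g: "crosses (g n z) 0 1 m w"
  shows "crosses (\<lambda>s. T (\<gamma> s)) a b m w"
proof -
  obtain a' b' where c: "a \<le> a'" "a' \<le> b'" "b' \<le> b" "continuous_on {a'..b'} (\<lambda>s. f (\<gamma> s) - n)"
     "(\<lambda>s. f (\<gamma> s) - n) ` {a'..b'} = {0..1}"
     "\<And>s. s \<in> {a'..b'} \<Longrightarrow> T (\<gamma> s) = g n z (f (\<gamma> s) - n)"
    using crosses_follow[OF c] by metis
  obtain l u where g: "0 \<le> l" "l \<le> u" "u \<le> 1" "continuous_on {l..u} (g n z)" "g n z ` {l..u} \<subseteq> Y"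
     "\<forall>s\<in>{l..u}. base_pt m (g n z s) = w" "(\<lambda>s. f (g n z s)) ` {l..u} = {real m..real m + 1}"
    using g unfolding crosses_def by blast
  let ?u = "\<lambda>s. f (\<gamma> s) - n"
  have "l \<noteq> u"
  proof
    assume "l = u"
    then have "real m \<in> {f (g n z u)}" "real m + 1 \<in> {f (g n z u)}" using g(7) by auto
    then show False by simp
  qed
  then have lu: "l < u" using g(2) by simp
  have "l \<in> ?u ` {a'..b'}" "u \<in> ?u ` {a'..b'}" using c(5) g lu by auto
  then obtain s t where st: "s \<in> {a'..b'}" "t \<in> {a'..b'}" "?u s = l" "?u t = u" by blast
  from subinterval_crossing[OF c(4) st(1,2), of l u] obtain \<alpha> \<beta>
    where ab: "a' \<le> \<alpha>" "\<alpha> \<le> \<beta>" "\<beta> \<le> b'" "?u ` {\<alpha>..\<beta>} = {l..u}"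
    using st(3,4) lu by (metis order_refl order_trans)
  have Tg: "T (\<gamma> s) = g n z (?u s)" "?u s \<in> {l..u}" if "s \<in> {\<alpha>..\<beta>}" for s
    using c(6)[of s] that ab by auto
  have "continuous_on {\<alpha>..\<beta>} (\<lambda>s. g n z (?u s))"
    by (rule continuous_on_compose2[OF g(4) continuous_on_subset[OF c(4)]]) (use ab in auto)
  then have "continuous_on {\<alpha>..\<beta>} (\<lambda>s. T (\<gamma> s))"
    by (rule continuous_on_eq) (use Tg(1) in simp)
  moreover have "(\<lambda>s. T (\<gamma> s)) ` {\<alpha>..\<beta>} \<subseteq> Y" using Tg g(5) by auto
  moreover have "\<forall>s\<in>{\<alpha>..\<beta>}. base_pt m (T (\<gamma> s)) = w" using Tg g(6) by auto
  moreover have "(\<lambda>s. f (T (\<gamma> s))) ` {\<alpha>..\<beta>} = {real m..real m + 1}"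
  proof -
    have "(\<lambda>s. f (T (\<gamma> s))) ` {\<alpha>..\<beta>} = (\<lambda>s. f (g n z (?u s))) ` {\<alpha>..\<beta>}"
      using Tg(1) by (intro image_cong) auto
    also have "\<dots> = (\<lambda>x. f (g n z x)) ` ?u ` {\<alpha>..\<beta>}" by (simp add: image_image)
    also have "\<dots> = {real m..real m + 1}" unfolding ab(4) by (rule g(7))
    finally show ?thesis .
  qed
  ultimately show ?thesis unfolding crosses_def using ab c(1,3)
    by (intro exI[of _ \<alpha>] exI[of _ \<beta>]) auto
qed

lemma g_crossesI:
  assumes a: "active n z" and y: "y \<in> collar n z" "y' \<in> collar n z" "f y \<le> real m" "real m + 1 \<le> f y'"
  shows "crosses (g n z) 0 1 m (base_pt m y')"
proof -
  note z = active_idx[OF a]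
  have "y \<in> g n z ` {0..1}" "y' \<in> g n z ` {0..1}" using y g_covers[OF z] by auto
  then obtain s t where "s \<in> {0..1}" "t \<in> {0..1}" "y = g n z s" "y' = g n z t" by blast
  then show ?thesis using crossesI[of 0 1 "g n z" s t m] y g_deep(2)[OF z] continuous_g[OF z] by blast
qed

lemma g_descends:
  assumes "active n z"
  shows "\<exists>w. crosses (g n z) 0 1 (max 1 (n - 1)) w"
  using collar_span[OF assms] g_crossesI[OF assms] by blast

lemma crosses_root: "crosses \<gamma> a b 1 z \<Longrightarrow> z = root"
  using crosses_active[of \<gamma> a b 1 z] base_pt_root[of 1 z] deep_sub by (auto simp: active_def)

text \<open>Each application of \<open>T\<close> lowers the level by one until level 1, whose only
  piece belongs to \<open>root\<close>.\<close>

lemma crosses_descend: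
  assumes "crosses \<gamma> a b n z" "1 \<le> n"
  shows "\<exists>k. crosses (\<lambda>s. (T ^^ k) (\<gamma> s)) a b 1 root"
  using assms
proof (induction n arbitrary: \<gamma> z)
  case (Suc n)
  show ?case
  proof (cases "n = 0")
    case True
    then show ?thesis using Suc.prems crosses_root by (intro exI[of _ 0]) auto
  next
    case False
    obtain w where "crosses (g (Suc n) z) 0 1 (max 1 n) w"
      using g_descends[OF crosses_active[OF Suc.prems(1)]] by auto
    then have "crosses (\<lambda>s. T (\<gamma> s)) a b n w"
      using crosses_step[OF Suc.prems(1)] False by (simp add: max_def split: if_splits)
    from Suc.IH[OF this] False obtain k where "crosses (\<lambda>s. (T ^^ k) (T (\<gamma> s))) a b 1 root" by auto
    then show ?thesis by (intro exI[of _ "Suc k"]) (simp add: funpow_swap1)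
  qed
qed simp

text \<open>Since \<open>max 1 (1 - 1) = 1\<close>, the path of the root crosses the level of the
  root again.\<close>

lemma crosses_root_persists:
  assumes "crosses \<gamma> a b 1 root"
  shows "crosses (\<lambda>s. (T ^^ k) (\<gamma> s)) a b 1 root"
proof (induction k)
  case (Suc k)
  obtain w where "crosses (g 1 root) 0 1 1 w" using g_descends[OF crosses_active[OF assms]] by auto
  then have "crosses (g 1 root) 0 1 1 root" using crosses_root by metis
  from crosses_step[OF Suc this] show ?case by simp
qed (use assms in simp)

text \<open>The target piece must reach height \<open>n + 2\<close>, the top of the level to be
  crossed. The number \<open>k\<close> of steps depends on the target but not on the path \<gamma>,
  so the climb can follow any waiting time at the root.\<close>

lemma crosses_climb:
  assumes "x \<in> deep (Suc n)" "y \<in> piece (Suc n) x" "real n + 2 \<le> f y"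
  shows "\<exists>k. \<forall>\<gamma> a b. crosses \<gamma> a b 1 root \<longrightarrow> crosses (\<lambda>s. (T ^^ k) (\<gamma> s)) a b (Suc n) (base_pt (Suc n) x)"
  using assms
proof (induction n)
  case 0
  then have "base_pt (Suc 0) x = root" using base_pt_root[of 1 x] deep_sub by auto
  then show ?case by (intro exI[of _ 0]) simp
next
  case (Suc n)
  let ?m = "Suc n" let ?z = "base_pt (Suc n) x"
  have x: "x \<in> deep ?m" using Suc.prems(1) deep_mono[of ?m "Suc ?m"] by auto
  have sub: "piece (Suc ?m) x \<subseteq> piece ?m x" by (rule piece_mono) simp
  have y: "y \<in> piece ?m x" using Suc.prems(2) sub by blast
  obtain k where k: "\<And>\<gamma> a b. crosses \<gamma> a b 1 root \<Longrightarrow> crosses (\<lambda>s. (T ^^ k) (\<gamma> s)) a b ?m ?z"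
    using Suc.IH[OF x y] Suc.prems(3) by auto
  have act: "active ?m ?z" using active_base_pt[OF x y] Suc.prems(3) by simp
  \<comment> \<open>The given \<open>y\<close> may lie above the collar of level \<open>?m\<close>;
    a low point \<open>u\<close> of the same piece yields, by connectedness, a point
    \<open>v\<close> of height exactly \<open>?m + 2\<close>, which the collar contains.\<close>
  have "\<exists>u\<in>piece (Suc ?m) x. depth u \<le> real (Suc ?m) - 3/4"
    by (rule piece_low[OF Suc.prems(1)]) auto
  then obtain u where u: "u \<in> piece (Suc ?m) x" "depth u \<le> real (Suc ?m) - 3/4" by blast
  have uY: "u \<in> Y" using u piece_Y by blast
  have "f u \<le> real ?m + 2" using f_le[OF uY] u by simp
  then obtain v where v: "v \<in> piece (Suc ?m) x" "f v = real ?m + 2"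
    using connected_attains[OF connected_piece continuous_on_subset[OF continuous_f piece_Y] u(1) Suc.prems(2), of "real ?m + 2"]
      Suc.prems(3) by auto
  have vY: "v \<in> Y" using v piece_Y by blast
  have "v \<in> piece ?m ?z" using v(1) sub base_pt_piece[OF x] by auto
  then have "v \<in> piece (?m - 1) ?z" using piece_mono[of "?m - 1" ?m ?z] by auto
  then have vK: "v \<in> collar ?m ?z" using f_le[OF vY] f_ge[OF vY] v(2) by (auto simp: collar_def)
  obtain y1 where y1: "y1 \<in> collar ?m ?z" "f y1 \<le> real (max 1 (?m - 1))" using collar_span[OF act] by blast
  have "real (max 1 (?m - 1)) \<le> real (Suc ?m)" by simp
  then have "crosses (g ?m ?z) 0 1 (Suc ?m) (base_pt (Suc ?m) v)"
    using g_crossesI[OF act y1(1) vK, of "Suc ?m"] y1(2) v(2) by simp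
  moreover have "base_pt (Suc ?m) v = base_pt (Suc ?m) x" by (rule base_pt_eq[OF v(1)])
  ultimately have "crosses (\<lambda>s. T ((T ^^ k) (\<gamma> s))) a b (Suc ?m) (base_pt (Suc ?m) x)" if "crosses \<gamma> a b 1 root" for \<gamma> a b
    using crosses_step[OF k[OF that]] by simp
  then show ?case by (intro exI[of _ "Suc k"]) simp
qed

text \<open>A point at level \<open>m >= 2\<close> is used one level lower, at
  \<open>n = m - 1\<close>: it then shows by itself that its piece rises to height
  \<open>n + 1\<close>. Points of height below 2 are covered by the root path.\<close>

lemma live_covers:
  assumes v: "v \<in> Y"
  shows "\<exists>n z. 1 \<le> n \<and> live n z \<and> v \<in> g n z ` {0..1}"
proof (cases "f v < 2")
  case True
  have vW: "v \<in> deep 1" using v deep_root by simp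
  obtain x where x: "x \<in> Y" "3 \<le> depth x" using depth_unbounded by blast
  have "x \<in> piece 1 v" using piece_root[of 1 v] v x by simp
  then have live: "live 1 (base_pt 1 v)" using live_base_pt[OF vW] f_ge[OF x(1)] x by simp
  then have z: "base_pt 1 v \<in> D \<inter> deep 1" by (simp add: live_def active_def)
  have "v \<in> piece 0 (base_pt 1 v)" using piece_root[of 0 "base_pt 1 v"] v z deep_sub by auto
  then have "v \<in> collar 1 (base_pt 1 v)" using f_ge[OF v] True depth_ge[OF v] by (simp add: collar_def)
  then show ?thesis using live g_covers[OF z] by (intro exI[of _ 1] exI[of _ "base_pt 1 v"]) auto
next
  case False
  obtain m where m: "real m \<le> f v" "f v < real m + 1" using level_exists[OF v] by blast
  define n where "n = m - 1"
  have n: "1 \<le> n" "real n + 1 \<le> f v" "f v < real n + 2" using m False by (auto simp: n_def)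
  have vW: "v \<in> deep n" using f_deep[OF v, of n] n by simp
  have live: "live n (base_pt n v)" using live_base_pt[OF vW piece_self[OF vW] n(2)] .
  then have z: "base_pt n v \<in> D \<inter> deep n" by (simp add: live_def active_def)
  have "v \<in> piece (n - 1) (base_pt n v)"
    using piece_self[OF vW] base_pt_piece[OF vW] piece_mono[of "n - 1" n "base_pt n v"] by auto
  then have "v \<in> collar n (base_pt n v)" using f_ge[OF v] f_le[OF v] n by (simp add: collar_def)
  then show ?thesis using live g_covers[OF z] n by (intro exI[of _ n] exI[of _ "base_pt n v"]) auto
qed

lemma live_reached:
  assumes "live n z" "1 \<le> n"
  shows "\<exists>k. \<forall>\<gamma> a b. crosses \<gamma> a b 1 root \<longrightarrow> crosses (\<lambda>s. (T ^^ k) (\<gamma> s)) a b n z"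
proof -
  obtain m where m: "n = Suc m" using assms(2) by (cases n) auto
  have z: "z \<in> deep n" "base_pt n z = z" using assms(1) by (auto simp: live_def active_def)
  obtain y where "y \<in> piece n z" "real n + 1 \<le> f y" using assms(1) by (auto simp: live_def)
  then show ?thesis using crosses_climb[of z m y] z by (simp add: m)
qed

lemma T_iter_S: "x \<in> S \<Longrightarrow> (T ^^ k) x \<in> S" by (induction k) (auto simp: T_S)

lemma T_iter_Y: "x \<in> Y \<Longrightarrow> (T ^^ k) x \<in> Y" by (induction k) (auto simp: T_Y)

lemma continuous_T_iter: "continuous_on S (T ^^ k)"
proof (induction k)
  case (Suc k)
  have "continuous_on S (\<lambda>x. T ((T ^^ k) x))"
    by (rule continuous_on_compose2[OF continuous_T Suc]) (use T_iter_S in auto)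
  then show ?case by (simp add: o_def)
qed (simp add: id_def)

section \<open>Growth of uncrossed paths\<close>

lemma unit_subinterval:
  assumes "0 < lo" "lo < hi" and no: "\<And>m. 1 \<le> m \<Longrightarrow> lo \<le> real m \<Longrightarrow> hi < real m + 1"
  shows "\<exists>n c d. real n \<le> c \<and> d \<le> real n + 1 \<and> lo \<le> c \<and> c < d \<and> d \<le> hi \<and> hi - lo \<le> 2 * (d - c)"
proof -
  \<comment> \<open>By \<open>no\<close> at \<open>i\<close>, the interval ends below
    \<open>i + 1\<close>; it is cut at \<open>i\<close> if \<open>i\<close> is interior, and the
    longer part is kept. Positivity of \<open>lo\<close> gives \<open>1 <= i\<close>.\<close>
  define i where "i = nat \<lceil>lo\<rceil>"
  have i: "1 \<le> i" "lo \<le> real i" "real i < lo + 1"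
    using assms(1) unfolding i_def by linarith+
  obtain j where j: "i = Suc j" using i(1) by (cases i) auto
  consider "hi \<le> real i" | "real i < hi" "hi - lo \<le> 2 * (real i - lo)" | "real i < hi" "2 * (real i - lo) < hi - lo"
    by linarith
  then show ?thesis
  proof cases
    case 1
    then show ?thesis using i j assms by (intro exI[of _ j] exI[of _ lo] exI[of _ hi]) auto
  next
    case 2
    then show ?thesis using i j assms by (intro exI[of _ j] exI[of _ lo] exI[of _ "real i"]) auto
  next
    case 3
    then show ?thesis using i no[OF i(1,2)] by (intro exI[of _ i] exI[of _ "real i"] exI[of _ hi]) auto
  qed
qed

text \<open>The range of \<open>f\<close> along an uncrossed path meets at most two levels, so one level contains half
  of it; there the paths expand by 3, whence the factor \<open>3/2\<close>.\<close>

lemma growth_step: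
  assumes cont: "continuous_on {a..b} \<gamma>" and Y: "\<gamma> ` {a..b} \<subseteq> Y"
    and no: "\<And>m z. 1 \<le> m \<Longrightarrow> \<not> crosses \<gamma> a b m z"
    and no': "\<And>m z. 1 \<le> m \<Longrightarrow> \<not> crosses (\<lambda>s. T (\<gamma> s)) a b m z"
    and st: "s \<in> {a..b}" "t \<in> {a..b}" "f (\<gamma> s) < f (\<gamma> t)"
  shows "\<exists>s'\<in>{a..b}. \<exists>t'\<in>{a..b}. 3/2 * (f (\<gamma> t) - f (\<gamma> s)) \<le> f (T (\<gamma> t')) - f (T (\<gamma> s'))"
proof -
  have YS: "\<gamma> ` {a..b} \<subseteq> S" using Y by (auto simp: Y_def)
  have contT: "continuous_on {a..b} (\<lambda>s. T (\<gamma> s))"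
    by (rule continuous_on_compose2[OF continuous_T cont YS])
  have YT: "(\<lambda>s. T (\<gamma> s)) ` {a..b} \<subseteq> Y" using Y T_Y by auto
  have "f (\<gamma> t) < real m + 1" if "1 \<le> m" "f (\<gamma> s) \<le> real m" for m
    using crossesI[OF cont Y st(1,2) that(2)] no[OF that(1)] by (meson not_le)
  moreover have "0 < f (\<gamma> s)" using f_pos[of "\<gamma> s"] Y st(1) by force
  ultimately obtain n c d where ncd: "real n \<le> c" "d \<le> real n + 1" "f (\<gamma> s) \<le> c" "c < d" "d \<le> f (\<gamma> t)"
      "f (\<gamma> t) - f (\<gamma> s) \<le> 2 * (d - c)"
    using unit_subinterval[of "f (\<gamma> s)" "f (\<gamma> t)"] st(3) by blast
  have fc: "continuous_on {a..b} (\<lambda>s. f (\<gamma> s))"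
    by (rule continuous_on_compose2[OF continuous_f cont Y])
  obtain \<alpha> \<beta> where ab: "a \<le> \<alpha>" "\<alpha> \<le> \<beta>" "\<beta> \<le> b" "(\<lambda>s. f (\<gamma> s)) ` {\<alpha>..\<beta>} = {c..d}"
    using subinterval_crossing[OF fc st(1,2) ncd(3,5,4)] by (metis order_trans)
  have strip: "\<gamma> x \<in> Y" "c \<le> f (\<gamma> x)" "f (\<gamma> x) \<le> d" if "x \<in> {\<alpha>..\<beta>}" for x
  proof -
    show "\<gamma> x \<in> Y" using that Y ab by auto
    have "f (\<gamma> x) \<in> {c..d}" using that ab(4) by blast
    then show "c \<le> f (\<gamma> x)" "f (\<gamma> x) \<le> d" by auto
  qed
  have deep: "\<gamma> ` {\<alpha>..\<beta>} \<subseteq> deep n"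
    using strip ncd(1) by (auto intro!: f_deep intro: order_trans)
  define z where "z = base_pt n (\<gamma> \<alpha>)"
  have \<alpha>in: "\<alpha> \<in> {\<alpha>..\<beta>}" using ab by simp
  have "connected (\<gamma> ` {\<alpha>..\<beta>})"
    by (rule connected_continuous_image[OF continuous_on_subset[OF cont]]) (use ab in auto)
  then have "\<gamma> ` {\<alpha>..\<beta>} \<subseteq> piece n (\<gamma> \<alpha>)"
    using deep \<alpha>in by (intro connected_sub_piece) auto
  then have base_ptz: "base_pt n (\<gamma> x) = z" if "x \<in> {\<alpha>..\<beta>}" for x
    unfolding z_def using that by (intro base_pt_eq) auto
  have act: "active n z"
    unfolding z_def using strip[OF \<alpha>in] ncd(1) by (intro active_base_pt_self) auto
  note zi = active_idx[OF act]
  have Tg: "T (\<gamma> x) = g n z (f (\<gamma> x) - n)" if "x \<in> {\<alpha>..\<beta>}" for x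
    using T_eq[of "\<gamma> x" n] strip[OF that] base_ptz[OF that] ncd(1,2) by auto
  have pull: "\<exists>x\<in>{a..b}. T (\<gamma> x) = g n z u" if "u \<in> {c - n..d - n}" for u
  proof -
    have "u + n \<in> (\<lambda>s. f (\<gamma> s)) ` {\<alpha>..\<beta>}" using that ab(4) by auto
    then obtain x where "x \<in> {\<alpha>..\<beta>}" "f (\<gamma> x) = u + n" by force
    then show ?thesis using Tg[of x] ab(1,3) by (intro bexI[of _ x]) auto
  qed
  have "0 \<le> c - n" "c - n < d - n" "d - n \<le> 1" using ncd by auto
  \<comment> \<open>Either the short parameter interval already sweeps the whole image of the path,
    which contains two collar points spanning a level and so contradicts \<open>no'\<close>, or the
    expansion by 3 applies.\<close>
  from g_expands[OF zi this] show ?thesis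
  proof
    assume full: "g n z ` {c - n..d - n} = g n z ` {0..1}"
    obtain y y' where yy: "y \<in> collar n z" "y' \<in> collar n z" "f y \<le> real (max 1 (n - 1))" "real (max 1 (n - 1)) + 1 \<le> f y'"
      using collar_span[OF act] by blast
    then have "y \<in> g n z ` {c - n..d - n}" "y' \<in> g n z ` {c - n..d - n}"
      using g_covers[OF zi] full by auto
    then obtain u u' where u: "u \<in> {c - n..d - n}" "y = g n z u" "u' \<in> {c - n..d - n}" "y' = g n z u'" by blast
    obtain x where x1: "x \<in> {a..b}" "T (\<gamma> x) = y" using pull[OF u(1)] u(2) by blast
    obtain x' where x2: "x' \<in> {a..b}" "T (\<gamma> x') = y'" using pull[OF u(3)] u(4) by blast
    note x = x1(1) x2(1) x1(2) x2(2)
    have "crosses (\<lambda>s. T (\<gamma> s)) a b (max 1 (n - 1)) (base_pt (max 1 (n - 1)) (T (\<gamma> x')))"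
      by (rule crossesI[OF contT YT x(1,2)]) (use yy x in auto)
    then show ?thesis using no'[of "max 1 (n - 1)"] by simp
  next
    assume "\<exists>u\<in>{c - n..d - n}. \<exists>v\<in>{c - n..d - n}. 3 * ((d - n) - (c - n)) \<le> \<bar>f (g n z u) - f (g n z v)\<bar>"
    then obtain u v where uv: "u \<in> {c - n..d - n}" "v \<in> {c - n..d - n}" "3 * (d - c) \<le> \<bar>f (g n z u) - f (g n z v)\<bar>"
      by auto
    obtain x where x1: "x \<in> {a..b}" "T (\<gamma> x) = g n z u" using pull[OF uv(1)] by blast
    obtain x' where x2: "x' \<in> {a..b}" "T (\<gamma> x') = g n z v" using pull[OF uv(2)] by blast
    note x = x1(1) x2(1) x1(2) x2(2)
    show ?thesis
    proof (cases "f (g n z u) \<le> f (g n z v)")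
      case True
      then show ?thesis using x uv(3) ncd(6) by (intro bexI[of _ x] bexI[of _ x']) auto
    next
      case False
      then show ?thesis using x uv(3) ncd(6) by (intro bexI[of _ x'] bexI[of _ x]) auto
    qed
  qed
qed

text \<open>Without crossings the spread of heights would grow like \<open>(3/2) ^ k\<close>; once
  it reaches 2 it contains a full level \<open>{m..m + 1}\<close> with
  \<open>m >= 1\<close>.\<close>

lemma crosses_eventually:
  assumes cont: "continuous_on {a..b} \<gamma>" and Y: "\<gamma> ` {a..b} \<subseteq> Y"
    and st: "s \<in> {a..b}" "t \<in> {a..b}" "f (\<gamma> s) \<noteq> f (\<gamma> t)"
  shows "\<exists>k n z. 1 \<le> n \<and> crosses (\<lambda>s. (T ^^ k) (\<gamma> s)) a b n z"
proof (rule ccontr)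
  assume "\<not> ?thesis"
  then have no: "\<not> crosses (\<lambda>s. (T ^^ k) (\<gamma> s)) a b n z" if "1 \<le> n" for k n z using that by blast
  define \<delta> where "\<delta> = \<bar>f (\<gamma> t) - f (\<gamma> s)\<bar>"
  have \<delta>: "0 < \<delta>" using st by (simp add: \<delta>_def)
  have YS: "\<gamma> ` {a..b} \<subseteq> S" using Y by (auto simp: Y_def)
  have contk: "continuous_on {a..b} (\<lambda>s. (T ^^ k) (\<gamma> s))" for k
    by (rule continuous_on_compose2[OF continuous_T_iter cont YS])
  have Yk: "(\<lambda>s. (T ^^ k) (\<gamma> s)) ` {a..b} \<subseteq> Y" for k using Y T_iter_Y by auto
  have grow: "\<exists>s\<in>{a..b}. \<exists>t\<in>{a..b}. (3/2) ^ k * \<delta> \<le> f ((T ^^ k) (\<gamma> t)) - f ((T ^^ k) (\<gamma> s))" for k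
  proof (induction k)
    case 0
    show ?case
    proof (cases "f (\<gamma> s) \<le> f (\<gamma> t)")
      case True
      then show ?thesis using st by (intro bexI[of _ s] bexI[of _ t]) (auto simp: \<delta>_def)
    next
      case False
      then show ?thesis using st by (intro bexI[of _ t] bexI[of _ s]) (auto simp: \<delta>_def)
    qed
  next
    case (Suc k)
    then obtain s t where st: "s \<in> {a..b}" "t \<in> {a..b}"
      "(3/2) ^ k * \<delta> \<le> f ((T ^^ k) (\<gamma> t)) - f ((T ^^ k) (\<gamma> s))" by blast
    have "0 < (3/2) ^ k * \<delta>" using \<delta> by simp
    then have "f ((T ^^ k) (\<gamma> s)) < f ((T ^^ k) (\<gamma> t))" using st(3) by linarith
    moreover have "\<not> crosses (\<lambda>s. T ((T ^^ k) (\<gamma> s))) a b m z" if "1 \<le> m" for m z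
      using no[OF that, of "Suc k"] by simp
    ultimately obtain s' t' where s't': "s' \<in> {a..b}" "t' \<in> {a..b}"
      "3/2 * (f ((T ^^ k) (\<gamma> t)) - f ((T ^^ k) (\<gamma> s))) \<le> f (T ((T ^^ k) (\<gamma> t'))) - f (T ((T ^^ k) (\<gamma> s')))"
      using growth_step[OF contk Yk no _ st(1,2)] by blast
    then show ?case using st(3) by (intro bexI[of _ s'] bexI[of _ t']) auto
  qed
  obtain k where "2 / \<delta> < (3/2) ^ k" using real_arch_pow[of "3/2" "2 / \<delta>"] by auto
  then have "2 < (3/2) ^ k * \<delta>" using \<delta> by (simp add: field_simps)
  then obtain s t where st: "s \<in> {a..b}" "t \<in> {a..b}" "2 \<le> f ((T ^^ k) (\<gamma> t)) - f ((T ^^ k) (\<gamma> s))"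
    using grow[of k] by (meson less_imp_le order_trans)
  define m where "m = nat \<lceil>f ((T ^^ k) (\<gamma> s))\<rceil>"
  have "0 < f ((T ^^ k) (\<gamma> s))" using f_pos[of "(T ^^ k) (\<gamma> s)"] Yk[of k] st(1) by force
  then have m: "1 \<le> m" "f ((T ^^ k) (\<gamma> s)) \<le> real m" "real m < f ((T ^^ k) (\<gamma> s)) + 1"
    unfolding m_def by linarith+
  then have "real m + 1 \<le> f ((T ^^ k) (\<gamma> t))" using st(3) by linarith
  from crossesI[OF contk Yk st(1,2) m(2) this] no[OF m(1)] show False by blast
qed

text \<open>The total time is \<open>k1\<close> until the first crossing, \<open>k2\<close> for the
  descent to the root, any \<open>i\<close> spent there, and \<open>k3\<close> for the climb; the
  free \<open>i\<close> realises every large \<open>j\<close>.\<close>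

lemma crosses_all_live:
  assumes cont: "continuous_on {a..b} \<gamma>" and Y: "\<gamma> ` {a..b} \<subseteq> Y"
    and st: "s \<in> {a..b}" "t \<in> {a..b}" "f (\<gamma> s) \<noteq> f (\<gamma> t)"
    and live: "live n z" "1 \<le> n"
  shows "\<exists>j0. \<forall>j\<ge>j0. crosses (\<lambda>s. (T ^^ j) (\<gamma> s)) a b n z"
proof -
  obtain k1 m w where "1 \<le> m" "crosses (\<lambda>s. (T ^^ k1) (\<gamma> s)) a b m w"
    using crosses_eventually[OF cont Y st] by blast
  then obtain k2 where k2: "crosses (\<lambda>s. (T ^^ k2) ((T ^^ k1) (\<gamma> s))) a b 1 root"
    using crosses_descend by blast
  obtain k3 where k3: "\<And>\<gamma> a b. crosses \<gamma> a b 1 root \<Longrightarrow> crosses (\<lambda>s. (T ^^ k3) (\<gamma> s)) a b n z"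
    using live_reached[OF live] by blast
  have "crosses (\<lambda>s. (T ^^ j) (\<gamma> s)) a b n z" if j: "k3 + k2 + k1 \<le> j" for j
  proof -
    obtain i where "j = k3 + k2 + k1 + i" using j le_Suc_ex by blast
    then have "j = k3 + (i + (k2 + k1))" by simp
    moreover have "crosses (\<lambda>s. (T ^^ k3) ((T ^^ i) ((T ^^ k2) ((T ^^ k1) (\<gamma> s))))) a b n z"
      by (rule k3[OF crosses_root_persists[OF k2]])
    ultimately show ?thesis by (simp add: funpow_add)
  qed
  then show ?thesis by blast
qed

section \<open>Mixing and periodic points\<close>

lemma g_nonconstant:
  assumes act: "active n z" and cd: "0 \<le> c" "c < d" "d \<le> 1"
  shows "\<exists>s\<in>{c..d}. \<exists>t\<in>{c..d}. f (g n z s) \<noteq> f (g n z t)"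
  using g_expands[OF active_idx[OF act] cd]
proof
  \<comment> \<open>The whole image contains collar points whose heights differ by at least
    1.\<close>
  assume full: "g n z ` {c..d} = g n z ` {0..1}"
  obtain y y' where yy: "y \<in> collar n z" "y' \<in> collar n z" "f y \<le> real (max 1 (n - 1))" "real (max 1 (n - 1)) + 1 \<le> f y'"
    using collar_span[OF act] by blast
  then have "y \<in> g n z ` {c..d}" "y' \<in> g n z ` {c..d}"
    using g_covers[OF active_idx[OF act]] full by auto
  then obtain s t where "s \<in> {c..d}" "t \<in> {c..d}" "y = g n z s" "y' = g n z t" by blast
  then show ?thesis using yy(3,4) by (intro bexI[of _ s] bexI[of _ t]) auto
next
  assume "\<exists>s\<in>{c..d}. \<exists>t\<in>{c..d}. 3 * (d - c) \<le> \<bar>f (g n z s) - f (g n z t)\<bar>"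
  then obtain s t where "s \<in> {c..d}" "t \<in> {c..d}" "3 * (d - c) \<le> \<bar>f (g n z s) - f (g n z t)\<bar>" by blast
  then show ?thesis using cd by (intro bexI[of _ s] bexI[of _ t]) auto
qed

text \<open>Live paths cover \<open>Y\<close>, so by continuity a small parameter interval around a
  preimage of \<open>v\<close> stays in \<open>U\<close>. Liveness is kept because it is what
  guarantees that the piece is crossed again at all large times.\<close>

lemma open_contains_g_path:
  assumes U: "openin (top_of_set S) U" "U \<noteq> {}"
  shows "\<exists>n z c d. 1 \<le> n \<and> live n z \<and> 0 \<le> c \<and> c < d \<and> d \<le> 1 \<and> g n z ` {c..d} \<subseteq> U \<inter> Y"
proof -
  have "U \<inter> Y \<noteq> {}"
  proof -
    obtain x where x: "x \<in> U" using U by blast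
    then obtain y where "y \<in> U" "y \<noteq> x" using open_has_other_point[OF U(1)] by blast
    then show ?thesis using x openin_imp_subset[OF U(1)] by (cases "x = p") (auto simp: Y_def)
  qed
  then obtain v where v: "v \<in> U" "v \<in> Y" by blast
  obtain n z where nz: "1 \<le> n" "live n z" "v \<in> g n z ` {0..1}" using live_covers[OF v(2)] by blast
  then obtain u where u: "u \<in> {0..1}" "v = g n z u" by blast
  have zi: "z \<in> D \<inter> deep n" using nz(2) by (simp add: live_def active_def)
  obtain e where e: "0 < e" "ball v e \<inter> S \<subseteq> U" using U(1) v(1) by (meson openin_contains_ball)
  obtain \<delta> where \<delta>: "0 < \<delta>" "\<And>x. x \<in> {0..1} \<Longrightarrow> dist x u < \<delta> \<Longrightarrow> dist (g n z x) (g n z u) < e"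
    using continuous_g[OF zi] u(1) e(1) unfolding continuous_on_iff by blast
  define c d where "c = max 0 (u - \<delta>/2)" and "d = min 1 (u + \<delta>/2)"
  have cd: "0 \<le> c" "c < d" "d \<le> 1" using u(1) \<delta>(1) by (auto simp: c_def d_def)
  have "g n z x \<in> U \<inter> Y" if "x \<in> {c..d}" for x
  proof -
    have x: "x \<in> {0..1}" "dist x u < \<delta>" using that \<delta>(1) by (auto simp: c_def d_def dist_real_def)
    have "g n z x \<in> Y" by (rule g_deep(2)[OF zi x(1)])
    moreover from this have "g n z x \<in> S" by (simp add: Y_def)
    ultimately show ?thesis using \<delta>(2)[OF x] u(2) e(2) by (auto simp: dist_commute)
  qed
  then show ?thesis using nz cd by blast
qed

text \<open>Stronger than mixing: each single point of \<open>Y\<close> lies in all late images of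
  \<open>U\<close>. The time \<open>n0\<close> may depend on \<open>v\<close>, and \<open>p\<close>
  is excluded, so exactness does not follow.\<close>

lemma open_image_contains:
  assumes U: "openin (top_of_set S) U" "U \<noteq> {}" and v: "v \<in> Y"
  shows "\<exists>n0. \<forall>n\<ge>n0. v \<in> (T ^^ n) ` U"
proof -
  obtain n z c d where nz: "1 \<le> n" "live n z" "0 \<le> c" "c < d" "d \<le> 1" "g n z ` {c..d} \<subseteq> U \<inter> Y"
    using open_contains_g_path[OF U] by blast
  have act: "active n z" using nz(2) by (simp add: live_def)
  obtain s t where st: "s \<in> {c..d}" "t \<in> {c..d}" "f (g n z s) \<noteq> f (g n z t)"
    using g_nonconstant[OF act nz(3-5)] by blast
  have cont: "continuous_on {c..d} (g n z)"
    by (rule continuous_on_subset[OF continuous_g[OF active_idx[OF act]]]) (use nz in auto)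
  obtain m w where mw: "1 \<le> m" "live m w" "v \<in> g m w ` {0..1}" using live_covers[OF v] by blast
  obtain j0 where j0: "\<And>j. j0 \<le> j \<Longrightarrow> crosses (\<lambda>s. (T ^^ j) (g n z s)) c d m w"
    using crosses_all_live[OF cont _ st mw(2,1)] nz(6) by blast
  have "v \<in> (T ^^ j) ` U" if j: "Suc j0 \<le> j" for j
  proof -
    obtain i where i: "j = Suc i" "j0 \<le> i" using j by (cases j) auto
    have "v \<in> (\<lambda>s. T ((T ^^ i) (g n z s))) ` {c..d}"
      using crosses_image[OF j0[OF i(2)]] mw(3) by blast
    then show ?thesis using nz(6) i(1) by auto
  qed
  then show ?thesis by blast
qed

lemma open_contains_periodic:
  assumes U: "openin (top_of_set S) U" "U \<noteq> {}"
  shows "\<exists>x\<in>U. \<exists>n>0. (T ^^ n) x = x"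
proof -
  obtain n z c d where nz: "1 \<le> n" "live n z" "0 \<le> c" "c < d" "d \<le> 1" "g n z ` {c..d} \<subseteq> U \<inter> Y"
    using open_contains_g_path[OF U] by blast
  have act: "active n z" using nz(2) by (simp add: live_def)
  obtain s t where st: "s \<in> {c..d}" "t \<in> {c..d}" "f (g n z s) \<noteq> f (g n z t)"
    using g_nonconstant[OF act nz(3-5)] by blast
  have cont: "continuous_on {c..d} (g n z)"
    by (rule continuous_on_subset[OF continuous_g[OF active_idx[OF act]]]) (use nz in auto)
  obtain k where k: "crosses (\<lambda>s. (T ^^ k) (g n z s)) c d n z"
    using crosses_all_live[OF cont _ st nz(2,1)] nz(6) by blast
  obtain a b where ab: "c \<le> a" "a \<le> b" "b \<le> d"
     "continuous_on {a..b} (\<lambda>s. f ((T ^^ k) (g n z s)) - n)"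
     "(\<lambda>s. f ((T ^^ k) (g n z s)) - n) ` {a..b} = {0..1}"
     "\<And>s. s \<in> {a..b} \<Longrightarrow> T ((T ^^ k) (g n z s)) = g n z (f ((T ^^ k) (g n z s)) - n)"
    using crosses_follow[OF k] by metis
  \<comment> \<open>On \<open>{a..b}\<close> the iterate \<open>T ^^ Suc k\<close> acts in the path
    parameter as \<psi>, which maps \<open>{a..b}\<close> onto \<open>{0..1}\<close>, a superset of
    \<open>{a..b}\<close>; a fixed point of \<psi> therefore gives a periodic point.\<close>
  define \<psi> where "\<psi> s = f ((T ^^ k) (g n z s)) - n" for s
  have \<psi>: "continuous_on {a..b} \<psi>" "\<psi> ` {a..b} = {0..1}" using ab(4,5) by (auto simp: \<psi>_def)
  obtain s0 s1 where s: "s0 \<in> {a..b}" "\<psi> s0 = 0" "s1 \<in> {a..b}" "\<psi> s1 = 1"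
    using \<psi>(2) by (metis (no_types, lifting) atLeastAtMost_iff imageE order_refl zero_le_one)
  have "\<exists>s\<in>{a..b}. \<psi> s - s = 0"
    by (rule connected_attains[of _ _ s0 s1])
      (use s ab nz \<psi>(1) in \<open>auto intro!: continuous_intros\<close>)
  then obtain s where s: "s \<in> {a..b}" "\<psi> s = s" by auto
  have "(T ^^ Suc k) (g n z s) = g n z s" using ab(6)[OF s(1)] s(2) by (simp add: \<psi>_def)
  moreover have "g n z s \<in> U" using nz(6) s(1) ab(1,3) by auto
  ultimately show ?thesis by blast
qed

lemma Y_nonempty: "Y \<noteq> {}" using depth_min by blast

lemma T_onto: "T ` S = S"
proof
  show "T ` S \<subseteq> S" using T_S by blast
  show "S \<subseteq> T ` S"
  proof
    fix v assume v: "v \<in> S"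
    show "v \<in> T ` S"
    proof (cases "v = p")
      case True then show ?thesis using T_p p by (metis imageI)
    next
      case False
      then have "v \<in> Y" using v by (simp add: Y_def)
      then obtain n0 where "v \<in> (T ^^ Suc n0) ` S"
        using open_image_contains[of S v] v by (metis empty_iff le_SucI order_refl openin_subtopology_self)
      then show ?thesis using T_iter_S by auto
    qed
  qed
qed

lemma pure_mixing_T:
  "continuous_on S T" "T ` S = S" "pure_mixing (top_of_set S) T"
  "top_of_set S closure_of periodic_points (top_of_set S) T = S"
proof -
  show "continuous_on S T" "T ` S = S" by (fact continuous_T T_onto)+
  have "mixing (top_of_set S) T"
    unfolding mixing_def
  proof (intro allI impI, elim conjE)
    fix U V assume UV: "openin (top_of_set S) U" "U \<noteq> {}" "openin (top_of_set S) V" "V \<noteq> {}"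
    obtain v where "v \<in> V" "v \<in> Y" using open_contains_g_path[OF UV(3,4)] by fastforce
    then show "\<exists>n0. \<forall>n\<ge>n0. (T ^^ n) ` U \<inter> V \<noteq> {}"
      using open_image_contains[OF UV(1,2), of v] by blast
  qed
  moreover have "\<not> exact (top_of_set S) T"
  proof
    assume "exact (top_of_set S) T"
    then have "\<exists>n. (T ^^ n) ` Y = topspace (top_of_set S)"
      unfolding exact_def by (elim allE[of _ Y] mp) (intro conjI openin_Y Y_nonempty)
    then obtain n where "(T ^^ n) ` Y = S" by auto
    then have "p \<in> (T ^^ n) ` Y" using p by simp
    then obtain y where "y \<in> Y" "p = (T ^^ n) y" by (elim imageE)
    then have "p \<in> Y" using T_iter_Y by metis
    then show False by (simp add: Y_def)
  qed
  ultimately show "pure_mixing (top_of_set S) T" by (simp add: pure_mixing_def)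
  have "periodic_points (top_of_set S) T \<inter> U \<noteq> {}" if U: "openin (top_of_set S) U" "U \<noteq> {}" for U
  proof -
    obtain x n where "x \<in> U" "0 < n" "(T ^^ n) x = x" using open_contains_periodic[OF U] by blast
    then show ?thesis using openin_imp_subset[OF U(1)] by (auto simp: periodic_points_def)
  qed
  then have "top_of_set S closure_of periodic_points (top_of_set S) T = topspace (top_of_set S)"
    unfolding dense_intersects_open by blast
  then show "top_of_set S closure_of periodic_points (top_of_set S) T = S" by simp
qed

end

section \<open>Transfer to abstract spaces\<close>

lemma (in peano_set) pure_mixing_map_exists:
  "\<exists>T. continuous_on S T \<and> T ` S = S \<and> pure_mixing (top_of_set S) T \<and>
       top_of_set S closure_of periodic_points (top_of_set S) T = S"
proof -
  obtain p where p: "p \<in> S" "connected (S - {p})" using noncut_point by blast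
  have "continuous_on S (\<lambda>x. dist x p)" by (intro continuous_intros)
  then obtain x where x: "x \<in> S" "\<And>y. y \<in> S \<Longrightarrow> dist y p \<le> dist x p"
    using continuous_attains_sup[OF compact_S, of "\<lambda>x. dist x p"] p by blast
  have "0 < dist x p"
  proof -
    obtain y where "y \<in> S" "y \<noteq> p" using nontrivial_S by metis
    then have "0 < dist y p" "dist y p \<le> dist x p" using x(2) by auto
    then show ?thesis by linarith
  qed
  \<comment> \<open>Finite \<open>1 / (n + 1)\<close>-nets of the compact set \<open>S\<close>;
    their union is the countable dense set from which base points are taken.\<close>
  have "\<exists>k. finite k \<and> k \<subseteq> S \<and> S \<subseteq> (\<Union>x\<in>k. ball x (inverse (Suc n)))" for n
    using seq_compact_imp_totally_bounded[OF compact_S[unfolded compact_eq_seq_compact_metric], rule_format, of "inverse (Suc n)"] by simp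
  then obtain k where k: "\<And>n. finite (k n)" "\<And>n. k n \<subseteq> S" "\<And>n. S \<subseteq> (\<Union>x\<in>k n. ball x (inverse (Suc n)))"
    by metis
  define D where "D = (\<Union>n. k n)"
  have D: "countable D" "D \<subseteq> S" using k(1,2) by (auto simp: D_def intro: countable_finite)
  have "S \<subseteq> closure D"
  proof
    fix y assume y: "y \<in> S"
    show "y \<in> closure D" unfolding closure_approachable
    proof (intro allI impI)
      fix e :: real assume "0 < e"
      then obtain n where n: "inverse (real (Suc n)) < e" using reals_Archimedean by blast
      obtain c where "c \<in> k n" "y \<in> ball c (inverse (Suc n))" using k(3)[of n] y by blast
      then show "\<exists>c\<in>D. dist c y < e" using n by (intro bexI[of _ c]) (auto simp: D_def)
    qed
  qed
  note D = D this
  interpret punctured_peano S p "dist x p / 2" D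
    by unfold_locales (use p D x \<open>0 < dist x p\<close> in auto)
  obtain f g where fg: "continuous_on Y f" "\<forall>x\<in>Y. \<bar>f x - depth x\<bar> \<le> 1/4"
    "\<And>n z. z \<in> D \<inter> deep n \<Longrightarrow> continuous_on {0..1::real} (g n z) \<and> g n z ` {0..1} \<subseteq> piece (n - 1) z \<and>
       g n z 0 = base_pt (n - 1) z \<and> g n z 1 = z \<and> collar n z \<subseteq> g n z ` {0..1} \<and>
       (\<forall>c d. 0 \<le> c \<and> c < d \<and> d \<le> 1 \<longrightarrow> g n z ` {c..d} = g n z ` {0..1} \<or>
          (\<exists>s\<in>{c..d}. \<exists>t\<in>{c..d}. 3 * (d - c) \<le> \<bar>f (g n z s) - f (g n z t)\<bar>))"
    using tower_data_exists by blast
  interpret tower S p "dist x p / 2" D f g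
  proof unfold_locales
    show "continuous_on Y f" by (rule fg(1))
    show "\<bar>f x - depth x\<bar> \<le> 1/4" if "x \<in> Y" for x using fg(2) that by blast
  next
    fix n z assume z: "z \<in> D \<inter> deep n"
    show "continuous_on {0..1} (g n z)" "g n z ` {0..1} \<subseteq> piece (n - 1) z"
       "g n z 0 = base_pt (n - 1) z" "g n z 1 = z" "collar n z \<subseteq> g n z ` {0..1}"
      using fg(3)[OF z] by blast+
  next
    fix n z and c d :: real assume z: "z \<in> D \<inter> deep n" and "0 \<le> c" "c < d" "d \<le> 1"
    then show "g n z ` {c..d} = g n z ` {0..1} \<or>
       (\<exists>s\<in>{c..d}. \<exists>t\<in>{c..d}. 3 * (d - c) \<le> \<bar>f (g n z s) - f (g n z t)\<bar>)"
      using fg(3)[OF z] by blast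
  qed
  show ?thesis using pure_mixing_T by blast
qed

section \<open>Embedding into a sequence space and transport along homeomorphisms\<close>

lemma compact_metrizable_embedding:
  assumes "compact_space X" "metrizable_space X"
  shows "\<exists>S :: (nat \<Rightarrow> real) set. X homeomorphic_space top_of_set S"
proof -
  obtain M d where Md: "Metric_space M d" "X = Metric_space.mtopology M d"
    using assms(2) unfolding metrizable_space_def by blast
  interpret Metric_space M d by (rule Md(1))
  have topX: "topspace X = M" by (simp add: Md(2))
  show ?thesis
  proof (cases "M = {}")
    case True
    then show ?thesis using topX by (intro exI[of _ "{}"]) (simp add: homeomorphic_empty_space_eq)
  next
    case False
    have "mtotally_bounded M"
      using assms(1) topX compactin_imp_mtotally_bounded by (simp add: Md(2) compact_space_def)
    then have "\<exists>k. finite k \<and> k \<subseteq> M \<and> M \<subseteq> (\<Union>x\<in>k. mball x (inverse (Suc n)))" for n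
      unfolding mtotally_bounded_def by simp
    then obtain k where k: "\<And>n. finite (k n)" "\<And>n. k n \<subseteq> M" "\<And>n. M \<subseteq> (\<Union>x\<in>k n. mball x (inverse (Suc n)))"
      by metis
    define C where "C = (\<Union>n. k n)"
    have C: "countable C" "C \<subseteq> M" using k(1,2) by (auto simp: C_def intro: countable_finite)
    have Cd: "\<exists>c\<in>C. d x c < e" if x: "x \<in> M" and e: "0 < e" for x e
    proof -
      obtain n where n: "inverse (real (Suc n)) < e" using reals_Archimedean[OF e] by blast
      obtain c where "c \<in> k n" "x \<in> mball c (inverse (Suc n))" using k(3)[of n] x by blast
      then show ?thesis using n by (intro bexI[of _ c]) (auto simp: C_def commute)
    qed
    have "C \<noteq> {}" using Cd[of _ 1] False by auto
    then obtain z :: "nat \<Rightarrow> 'a" where z: "range z = C" using C(1) uncountable_def by metis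
    then have zM: "z i \<in> M" for i using C(2) by blast
    \<comment> \<open>Distances to a dense sequence: equal coordinates force equal points by
      density, and a continuous injection of a compact space into a Hausdorff space is an embedding.
      The target type is a metric space, as \<open>peano_set\<close> demands.\<close>
    define h where "h x = (\<lambda>i. d x (z i))" for x
    have cont: "continuous_map X euclidean h"
    proof -
      have "continuous_map X (product_topology (\<lambda>i. euclidean) UNIV) h"
        unfolding continuous_map_componentwise_UNIV
      proof
        fix i
        have "continuous_map (mtopology_of (metric (M, d))) euclidean (mdist (metric (M, d)) (z i))"
          by (rule continuous_on_mdist) (simp add: zM)
        moreover have "(\<lambda>x. d x (z i)) = d (z i)" by (rule ext) (rule commute)
        ultimately have "continuous_map X euclidean (\<lambda>x. d x (z i))"
          by (simp add: Md(2))
        then show "continuous_map X euclidean (\<lambda>x. h x i)" by (simp add: h_def)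
      qed
      then show ?thesis by (simp add: euclidean_product_topology)
    qed
    have inj: "inj_on h (topspace X)"
    proof (rule inj_onI)
      fix x y assume xy: "x \<in> topspace X" "y \<in> topspace X" "h x = h y"
      then have M: "x \<in> M" "y \<in> M" using topX by auto
      have "d x y \<le> e" if e: "0 < e" for e
      proof -
        obtain c where "c \<in> C" "d x c < e/2" using Cd[OF M(1), of "e/2"] e by auto
        then obtain i where i: "d x (z i) < e/2" using z by auto
        moreover have "d y (z i) = d x (z i)" using xy(3) by (simp add: h_def fun_eq_iff)
        ultimately show ?thesis using triangle[of x "z i" y] zM M commute[of "z i" y] by auto
      qed
      then have "d x y \<le> 0" by (rule dense_ge)
      then show "x = y" using M nonneg[of x y] zero by (metis antisym)
    qed
    have "homeomorphic_map X (subtopology euclidean (h ` topspace X)) h"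
    proof (rule continuous_imp_homeomorphic_map)
      show "continuous_map X (subtopology euclidean (h ` topspace X)) h"
        using cont by (simp add: continuous_map_in_subtopology)
      show "Hausdorff_space (subtopology euclidean (h ` topspace X))"
        by (simp add: Hausdorff_space_subtopology)
    qed (use assms inj in auto)
    then show ?thesis using homeomorphic_map_imp_homeomorphic_space by blast
  qed
qed

lemma homeomorphic_peano_continuum:
  assumes X: "peano_continuum X" "nondegenerate X" and S: "X homeomorphic_space top_of_set S"
  shows "peano_set S"
proof
  have c: "compact_space X" "connected_space X" using X(1) by (auto simp: peano_continuum_def continuum_def)
  show "compact S" using c(1) homeomorphic_compact_space[OF S] by (simp add: compact_space_subtopology compact_space_def)
  show "connected S" using c(2) homeomorphic_connected_space[OF S]
    using connectedin_def[of euclidean S] by simp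
  obtain \<phi> where hom: "homeomorphic_map X (top_of_set S) \<phi>" using S by (auto simp: homeomorphic_space)
  have img: "\<phi> ` topspace X = S" "inj_on \<phi> (topspace X)" using hom homeomorphic_imp_surjective_map homeomorphic_imp_injective_map by fastforce+
  show "locally connected S"
    unfolding locally_connected
  proof (intro allI impI, elim conjE)
    fix V y assume V: "openin (top_of_set S) V" "y \<in> V"
    have "y \<in> S" using openin_imp_subset[OF V(1)] V(2) by blast
    then obtain x where x: "x \<in> topspace X" "y = \<phi> x" using img by blast
    define N where "N = {x \<in> topspace X. \<phi> x \<in> V}"
    have "openin X N" unfolding N_def
      using homeomorphic_imp_continuous_map[OF hom] V(1) by (rule openin_continuous_map_preimage)
    moreover have "x \<in> N" using x V by (simp add: N_def)
    ultimately have "neighbourhood X x N" unfolding neighbourhood_def by (auto simp: N_def)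
    then obtain U where U: "openin X U" "connectedin X U" "x \<in> U" "U \<subseteq> N"
      using X(1) x(1) unfolding peano_continuum_def by blast
    have UX: "U \<subseteq> topspace X" by (rule openin_subset[OF U(1)])
    have "openin (top_of_set S) (\<phi> ` U)" using homeomorphic_map_openness[OF hom UX] U(1) by simp
    moreover have "connected (\<phi> ` U)"
      using connectedin_continuous_map_image[OF homeomorphic_imp_continuous_map[OF hom] U(2)]
      by (simp add: connectedin_subtopology)
    ultimately show "\<exists>u. openin (top_of_set S) u \<and> connected u \<and> y \<in> u \<and> u \<subseteq> V"
      using U(3,4) x(2) by (intro exI[of _ "\<phi> ` U"]) (auto simp: N_def)
  qed
  show "\<exists>x\<in>S. \<exists>y\<in>S. x \<noteq> y"
    using X(2) img unfolding nondegenerate_def inj_on_def by blast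
qed

lemma pure_mixing_conjugate:
  assumes maps: "homeomorphic_maps X Y \<phi> \<psi>" and T: "continuous_map Y Y T" "T ` topspace Y = topspace Y"
    "pure_mixing Y T" "Y closure_of periodic_points Y T = topspace Y"
  shows "\<exists>T'. continuous_map X X T' \<and> T' ` topspace X = topspace X \<and>
           pure_mixing X T' \<and> X closure_of (periodic_points X T') = topspace X"
proof -
  define T' where "T' x = \<psi> (T (\<phi> x))" for x
  have \<phi>: "continuous_map X Y \<phi>" and \<psi>: "continuous_map Y X \<psi>"
    and inv: "\<And>x. x \<in> topspace X \<Longrightarrow> \<psi> (\<phi> x) = x" "\<And>y. y \<in> topspace Y \<Longrightarrow> \<phi> (\<psi> y) = y"
    using maps by (auto simp: homeomorphic_maps_def)
  have hom: "homeomorphic_map X Y \<phi>" using maps by (rule homeomorphic_maps_imp_map)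
  have \<phi>_in: "\<phi> x \<in> topspace Y" if "x \<in> topspace X" for x using continuous_map_image_subset_topspace[OF \<phi>] that by blast
  have \<psi>_in: "\<psi> y \<in> topspace X" if "y \<in> topspace Y" for y using continuous_map_image_subset_topspace[OF \<psi>] that by blast
  have T_in: "T y \<in> topspace Y" if "y \<in> topspace Y" for y using T(2) that by blast
  have m1: "continuous_map X X T'"
    using continuous_map_compose[OF continuous_map_compose[OF \<phi> T(1)] \<psi>] by (simp add: T'_def[abs_def] o_def)
  \<comment> \<open>The maps \<phi> and \<psi> are mutually inverse only on the carriers, so the
    conjugacy of iterates is proved together with the fact that orbits stay in
    \<open>topspace X\<close>.\<close>
  have iter: "\<phi> ((T' ^^ n) x) = (T ^^ n) (\<phi> x) \<and> (T' ^^ n) x \<in> topspace X" if "x \<in> topspace X" for n x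
  proof (induction n)
    case (Suc n)
    have "(T ^^ n) (\<phi> x) \<in> topspace Y" using Suc \<phi>_in by metis
    then show ?case using Suc inv(2)[OF T_in] \<psi>_in[OF T_in] by (simp add: T'_def)
  qed (use that in auto)
  have iter_img: "\<phi> ` (T' ^^ n) ` U = (T ^^ n) ` \<phi> ` U" if "U \<subseteq> topspace X" for n U
    unfolding image_image by (rule image_cong) (use iter that in auto)
  have iter_sub: "(T' ^^ n) ` U \<subseteq> topspace X" if "U \<subseteq> topspace X" for n U
    by (rule image_subsetI) (use iter that in auto)
  have \<phi>_img: "\<phi> ` topspace X = topspace Y" using hom homeomorphic_imp_surjective_map by blast
  have inj: "inj_on \<phi> (topspace X)" using inv(1) by (rule inj_on_inverseI)
  have op: "openin Y (\<phi> ` U)" if "openin X U" for U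
    using homeomorphic_map_openness[OF hom openin_subset[OF that]] that by simp
  have full: "A = topspace X" if "A \<subseteq> topspace X" "\<phi> ` A = topspace Y" for A
    using that \<phi>_img inj by (metis inj_on_image_eq_iff order_refl)
  have m2: "T' ` topspace X = topspace X"
  proof (rule full)
    show "T' ` topspace X \<subseteq> topspace X" using iter_sub[of "topspace X" 1] by simp
    show "\<phi> ` T' ` topspace X = topspace Y" using iter_img[of "topspace X" 1] \<phi>_img T(2) by simp
  qed
  have "mixing X T'"
    unfolding mixing_def
  proof (intro allI impI, elim conjE)
    fix U V assume UV: "openin X U" "U \<noteq> {}" "openin X V" "V \<noteq> {}"
    have "mixing Y T" using T(3) by (simp add: pure_mixing_def)
    then obtain n0 where n0: "\<And>n. n0 \<le> n \<Longrightarrow> (T ^^ n) ` \<phi> ` U \<inter> \<phi> ` V \<noteq> {}"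
      using op[OF UV(1)] op[OF UV(3)] UV(2,4) unfolding mixing_def by (metis image_is_empty)
    have "(T' ^^ n) ` U \<inter> V \<noteq> {}" if "n0 \<le> n" for n
    proof -
      have "\<phi> ` (T' ^^ n) ` U \<inter> \<phi> ` V \<noteq> {}" using n0[OF that] iter_img[OF openin_subset[OF UV(1)]] by simp
      moreover have "\<phi> ` ((T' ^^ n) ` U \<inter> V) = \<phi> ` (T' ^^ n) ` U \<inter> \<phi> ` V"
        by (rule inj_on_image_Int[OF inj iter_sub[OF openin_subset[OF UV(1)]] openin_subset[OF UV(3)]])
      ultimately show ?thesis by auto
    qed
    then show "\<exists>n0. \<forall>n\<ge>n0. (T' ^^ n) ` U \<inter> V \<noteq> {}" by blast
  qed
  moreover have "\<not> exact X T'"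
  proof
    assume ex: "exact X T'"
    have "exact Y T"
      unfolding exact_def
    proof (intro allI impI, elim conjE)
      fix V assume V: "openin Y V" "V \<noteq> {}"
      define U where "U = {x \<in> topspace X. \<phi> x \<in> V}"
      have "openin X U" unfolding U_def using \<phi> V(1) by (rule openin_continuous_map_preimage)
      moreover have UV: "\<phi> ` U = V"
        using \<phi>_img openin_subset[OF V(1)] by (force simp: U_def)
      ultimately obtain n where "(T' ^^ n) ` U = topspace X"
        using ex V(2) unfolding exact_def by (metis image_empty)
      then have "(T ^^ n) ` V = topspace Y"
        using iter_img[of U n] UV \<phi>_img by (simp add: U_def)
      then show "\<exists>n. (T ^^ n) ` V = topspace Y" by blast
    qed
    then show False using T(3) by (simp add: pure_mixing_def)
  qed
  ultimately have m3: "pure_mixing X T'" by (simp add: pure_mixing_def)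
  have m4: "X closure_of periodic_points X T' = topspace X"
    unfolding dense_intersects_open
  proof (intro allI impI, elim conjE)
    fix U assume U: "openin X U" "U \<noteq> {}"
    have "periodic_points Y T \<inter> \<phi> ` U \<noteq> {}"
      using T(4) op[OF U(1)] U(2) unfolding dense_intersects_open by (metis image_is_empty)
    then obtain x n where x: "x \<in> U" "0 < n" "(T ^^ n) (\<phi> x) = \<phi> x" by (auto simp: periodic_points_def)
    have xX: "x \<in> topspace X" using x(1) openin_subset[OF U(1)] by blast
    have "\<phi> ((T' ^^ n) x) = \<phi> x" using iter[OF xX, of n] x(3) by simp
    then have "(T' ^^ n) x = x" using iter[OF xX, of n] xX inj by (meson inj_onD)
    then show "periodic_points X T' \<inter> U \<noteq> {}" using x xX by (auto simp: periodic_points_def)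
  qed
  show ?thesis using m1 m2 m3 m4 by blast
qed

theorem theorem1p1:
  fixes X :: "'a topology"
  assumes "peano_continuum X" and "nondegenerate X"
  shows "\<exists>T :: 'a \<Rightarrow> 'a.
           continuous_map X X T \<and> T ` topspace X = topspace X \<and>
           pure_mixing X T \<and>
           X closure_of (periodic_points X T) = topspace X"
proof -
  obtain S :: "(nat \<Rightarrow> real) set" where S: "X homeomorphic_space top_of_set S"
    using compact_metrizable_embedding[of X] assms(1) by (auto simp: peano_continuum_def continuum_def)
  interpret peano_set S by (rule homeomorphic_peano_continuum[OF assms S])
  obtain \<phi> \<psi> where maps: "homeomorphic_maps X (top_of_set S) \<phi> \<psi>"
    using S by (auto simp: homeomorphic_space_def)
  obtain T where T: "continuous_on S T" "T ` S = S" "pure_mixing (top_of_set S) T"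
      "top_of_set S closure_of periodic_points (top_of_set S) T = S"
    using pure_mixing_map_exists by blast
  show ?thesis
    by (rule pure_mixing_conjugate[OF maps]) (use T in auto)
qed

end
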